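(* Let $b\in\mathcal B(\mathbb C_+)$. Then the Hankel operator $h_b$ extends to a bounded operator from $A^1_b(\mathbb C_+)$ to $A^1(\mathbb C_+)$ (that is, there is a constant $C$ with $\|h_b(f)\|_{L^1(\mathbb C_+)}\le C\|f\|_{L^1(\mathbb C_+)}$ for all $f\in A^1_b(\mathbb C_+)\cap A^2(\mathbb C_+)$) if and only if $b$ belongs to $\mathcal B_\omega(\mathbb C_+)$. Moreover, when $f\in A^1(\mathbb C_+)$ and $\langle b,f\rangle\neq 0$, one has $h_b(f)\notin L^1(\mathbb C_+)$.
   Context: $\mathbb C_+=\{z\in\mathbb C:\Im m(z)>0\}$ with Lebesgue measure $dV$; $A^p(\mathbb C_+)$ is the space of holomorphic functions in $L^p(\mathbb C_+,dV)$. With $\ln_+(t)=\max(\ln t,0)$, put $\omega(z)=1+\ln_+\left(\frac1{\Im m(z)}\right)+\ln_+(|z|)$. $\mathcal B(\mathbb C_+)$ is the Bloch space of holomorphic $b$ on $\mathbb C_+$ with $\sup_{z}\Im m(z)|b'(z)|<\infty$; $\mathcal B_\omega(\mathbb C_+)$ is the space of holomorphic $b$ with $\sup_z \Im m(z)\,\omega(z)|b'(z)|<\infty$. The dual of $A^1(\mathbb C_+)$ is the Bloch space modulo constants, and for $b\in\mathcal B(\mathbb C_+)$, $f\in A^1(\mathbb C_+)$ the duality bracket extending the $L^2$ Hermitian product is $\langle b,f\rangle=-2i\int_{\mathbb C_+}b'(z)\overline{f(z)}\,\Im m(z)\,dV(z)$; it equals $\int_{\mathbb C_+} b\overline f\,dV$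 whenever $bf$ is integrable. $A^1_b(\mathbb C_+)$ is the subspace of $f\in A^1(\mathbb C_+)$ such that $\langle b,f\rangle=0$. The Hankel operator $h_b$ is given by $h_b(f)=P(b\overline f)$ when this makes sense, where $P$ is the Bergman projection (orthogonal projection of $L^2(\mathbb C_+)$ onto $A^2(\mathbb C_+)$), with kernel $K(z,\zeta)=-\frac1{\pi(z-\overline\zeta)^2}$. Precisely, for $b\in\mathcal B(\mathbb C_+)$ and $f\in A^2(\mathbb C_+)$, $h_b(f)$ is the element of $A^2(\mathbb C_+)$ such that $\langle h_b(f),g\rangle_{L^2}=\langle b,fg\rangle$ for all $g\in A^2(\mathbb C_+)$ (note $fg\in A^1(\mathbb C_+)$). Equivalently $h_b(f)(z)=\langle b,fK(\cdot,z)\rangle$, and this last formula also defines the holomorphic function $h_b(f)$ for $f\in A^1(\mathbb C_+)$. *)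

theory Defs
  imports "HOL-Complex_Analysis.Complex_Analysis"
begin

definition upper_half_plane :: "complex set" where
  "upper_half_plane = {z. Im z > 0}"

text \<open>
  Function spaces over the half-plane are sets of functions of type
  \<open>complex \<Rightarrow> complex\<close>; the values of such a function outside the half-plane are irrelevant.
  Holomorphic functions are measurable on the half-plane, so only the integrability of
  $|f|^p$ has to be required.
\<close>

definition bergman_space :: "real \<Rightarrow> (complex \<Rightarrow> complex) set" where
  "bergman_space p = {f. f holomorphic_on upper_half_plane \<and>
     set_integrable lborel upper_half_plane (\<lambda>z. norm (f z) powr p)}"

definition L1_norm :: "(complex \<Rightarrow> complex) \<Rightarrow> real" where
  "L1_norm f = (LINT z:upper_half_plane|lborel. norm (f z))"

definition L2_inner :: "(complex \<Rightarrow> complex) \<Rightarrow> (complex \<Rightarrow> complex) \<Rightarrow> complex" where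
  "L2_inner f g = (LINT z:upper_half_plane|lborel. f z * cnj (g z))"

definition ln_plus :: "real \<Rightarrow> real" where
  "ln_plus t = max (ln t) 0"

text \<open>Isabelle's \<open>ln 0 = 0\<close> plays no role here: both arguments are positive on the half-plane.\<close>

definition omega :: "complex \<Rightarrow> real" where
  "omega z = 1 + ln_plus (1 / Im z) + ln_plus (norm z)"

definition bloch_space :: "(complex \<Rightarrow> complex) set" where
  "bloch_space = {b. b holomorphic_on upper_half_plane \<and>
     bdd_above ((\<lambda>z. Im z * norm (deriv b z)) ` upper_half_plane)}"

definition bloch_omega_space :: "(complex \<Rightarrow> complex) set" where
  "bloch_omega_space = {b. b holomorphic_on upper_half_plane \<and>
     bdd_above ((\<lambda>z. Im z * omega z * norm (deriv b z)) ` upper_half_plane)}"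

text \<open>The integral converges absolutely for \<open>b\<close> Bloch and \<open>f\<close> in the Bergman space with \<open>p = 1\<close>.\<close>

definition bracket :: "(complex \<Rightarrow> complex) \<Rightarrow> (complex \<Rightarrow> complex) \<Rightarrow> complex" where
  "bracket b f = - 2 * \<i> *
     (LINT z:upper_half_plane|lborel. deriv b z * cnj (f z) * complex_of_real (Im z))"

definition bergman_space_annihilating ::
  "(complex \<Rightarrow> complex) \<Rightarrow> (complex \<Rightarrow> complex) set" where
  "bergman_space_annihilating b = {f \<in> bergman_space 1. bracket b f = 0}"

definition bergman_kernel :: "complex \<Rightarrow> complex \<Rightarrow> complex" where
  "bergman_kernel z \<zeta> = - 1 / (complex_of_real pi * (z - cnj \<zeta>)\<^sup>2)"

text \<open>
  The Hankel operator on the Bergman space with \<open>p = 2\<close>. The defining property determines the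
  function on the half-plane only, hence \<open>SOME\<close> rather than \<open>THE\<close>.
\<close>

definition hankel :: "(complex \<Rightarrow> complex) \<Rightarrow> (complex \<Rightarrow> complex) \<Rightarrow> complex \<Rightarrow> complex" where
  "hankel b f = (SOME h. h \<in> bergman_space 2 \<and>
     (\<forall>g\<in>bergman_space 2. L2_inner h g = bracket b (\<lambda>z. f z * g z)))"

text \<open>
  The Hankel operator on the Bergman space with \<open>p = 1\<close>. The kernel is bounded in its first
  argument when \<open>z\<close> is a fixed point of the half-plane, so the bracket is meaningful there.
\<close>

definition hankel_A1 :: "(complex \<Rightarrow> complex) \<Rightarrow> (complex \<Rightarrow> complex) \<Rightarrow> complex \<Rightarrow> complex" where
  "hankel_A1 b f z = bracket b (\<lambda>\<zeta>. f \<zeta> * bergman_kernel \<zeta> z)"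

text \<open>
  Membership in the Bergman space is stated separately because the integral defining
  \<open>L1_norm\<close> is \<open>0\<close> for non-integrable functions.
\<close>

definition hankel_bounded_A1 :: "(complex \<Rightarrow> complex) \<Rightarrow> bool" where
  "hankel_bounded_A1 b \<longleftrightarrow>
     (\<exists>C. \<forall>f \<in> bergman_space_annihilating b \<inter> bergman_space 2.
        hankel b f \<in> bergman_space 1 \<and> L1_norm (hankel b f) \<le> C * L1_norm f)"

end

theory Submission
  imports Defs "HOL-Real_Asymp.Real_Asymp"
begin

text \<open>
  Put \<open>\<phi> = -2 i b' cnj(f) Im\<close>, so that the bracket is \<open>\<integral> \<phi>\<close> and \<open>h\<^sub>b(f) = P \<phi>\<close>, where
  \<open>P \<phi>(z) = -(1/\<pi>) \<integral> \<phi>(s) / (z - cnj s)\<^sup>2 dV(s)\<close>. Up to an error whose \<open>L\<^sup>1\<close> norm is at most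
  \<open>\<integral> |\<phi>(s)| D(s, w) dV(s)\<close>, the function \<open>P \<phi>(z)\<close> is \<open>-(\<integral> \<phi>) / (\<pi> (z - cnj w)\<^sup>2)\<close>, where
  \<open>D(s, w)\<close> is the \<open>L\<^sup>1\<close> norm of \<open>z \<mapsto> 1 / (z - cnj s)\<^sup>2 - 1 / (z - cnj w)\<^sup>2\<close>.
  For fixed \<open>w\<close> the quantity \<open>D(s, w)\<close> is comparable, up to additive constants, to the
  logarithmic weight \<open>\<omega>(s)\<close>.

  If \<open>\<integral> \<phi> = 0\<close>, then \<open>w = i\<close> gives \<open>\<parallel>P \<phi>\<parallel>\<^sub>1 \<le> C \<integral> |\<phi>| \<omega>\<close>, which is bounded by
  \<open>\<parallel>f\<parallel>\<^sub>1\<close> as soon as \<open>b\<close> is in the weighted Bloch space.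
  Conversely, let \<open>f\<^sub>w(s) = Im w / (s - cnj w)\<^sup>3\<close>. A reproducing formula shows that
  \<open>\<langle>b, f\<^sub>w\<rangle>\<close> equals \<open>Im w b'(w)\<close> up to a constant, and the error above is bounded uniformly in \<open>w\<close>.
  Subtracting from \<open>f\<^sub>w\<close> the multiple of a fixed \<open>f\<^bsub>w0\<^esub>\<close> that makes the bracket vanish and applying
  the assumed bound yields \<open>|\<langle>b, f\<^sub>w\<rangle>| D(w, w0) \<le> C\<close>, and \<open>D(w, w0)\<close> is at least
  \<open>\<omega>(w) / 18 - C\<close>. Finally, \<open>y\<^sup>2 P \<phi>(i y)\<close> tends to \<open>(\<integral> \<phi>) / \<pi>\<close>, which must be \<open>0\<close> when \<open>P \<phi>\<close> is integrable.
\<close>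

section \<open>Lebesgue measure on the half-plane\<close>

text \<open>The integral of |z - cnj s|^(-2) over z diverges logarithmically at large heights, so no
  kernel can be estimated alone; differences of two kernels are integrable, and a vanishing integral
  of \<phi> is what permits the subtraction. The two logarithms in \<omega>(s) have separate
  sources: the kernel at s has mass about ln(1 / Im s) in the strip below height 1, and for large
  |s| it fails to cancel the kernel at a fixed w at heights between |w| and |s|. The reproducing
  formulas rest on the growth |g(z)| \<le> M / Im z, which holds for functions in A^2 and, by the
  Bloch condition, for b'; it makes the far edges of the contours disappear. The error belonging to
  f_w is uniform in w because the cubic decay of f_w absorbs the logarithms of D(s, w). What is
  left, as well as the norm of f_w and the boundedness of P on L^2, reduces to one integral, that of
  (Im z)^(-1/2) |z - cnj w|^(-2). Since \<open>hankel\<close> is given by a choice, its values must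
  be recovered from the defining property; this is where P on L^2 enters.\<close>

definition hpm :: "complex measure" where
  "hpm = restrict_space lborel upper_half_plane"

lemma open_upper_half_plane: "open upper_half_plane"
  unfolding upper_half_plane_def by (rule open_halfspace_Im_gt)

lemma upper_half_plane_sets [measurable]: "upper_half_plane \<in> sets borel"
  by (simp add: open_upper_half_plane)

lemma space_hpm [simp]: "space hpm = upper_half_plane"
  by (simp add: hpm_def space_restrict_space)

lemma set_integrable_hpm: "set_integrable lborel upper_half_plane f \<longleftrightarrow> integrable hpm f"
  for f :: "complex \<Rightarrow> 'a::{banach, second_countable_topology}"
  unfolding set_integrable_def hpm_def by (subst integrable_restrict_space) auto

lemma set_lebesgue_integral_hpm: "(LINT z:upper_half_plane|lborel. f z) = integral\<^sup>L hpm f"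
  for f :: "complex \<Rightarrow> 'a::{banach, second_countable_topology}"
  unfolding set_lebesgue_integral_def hpm_def by (subst integral_restrict_space) auto

interpretation hpm: sigma_finite_measure hpm
  unfolding hpm_def by (intro sigma_finite_measure_restrict_space) (auto simp: lborel.sigma_finite_measure_axioms)

interpretation hpm_pair: pair_sigma_finite hpm hpm ..

lemma measurable_hpm_borel: "f \<in> borel_measurable borel \<Longrightarrow> f \<in> borel_measurable hpm"
  unfolding hpm_def by (intro measurable_restrict_space1) simp

lemma borel_measurable_hpm_ident [measurable]: "(\<lambda>x. x) \<in> borel_measurable hpm"
  by (intro measurable_hpm_borel) simp

lemma borel_measurable_hpm_continuous:
  fixes f :: "complex \<Rightarrow> 'a::topological_space"
  assumes "continuous_on upper_half_plane f" shows "f \<in> borel_measurable hpm"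
  unfolding hpm_def using borel_measurable_continuous_on_restrict[OF assms]
  by (simp add: measurable_def sets_restrict_space space_restrict_space)

lemma borel_measurable_hpm_holomorphic:
  "f holomorphic_on upper_half_plane \<Longrightarrow> f \<in> borel_measurable hpm"
  by (intro borel_measurable_hpm_continuous holomorphic_on_imp_continuous_on)

lemma borel_measurable_Complex [measurable (raw)]:
  assumes [measurable]: "f \<in> borel_measurable M" "g \<in> borel_measurable M"
  shows "(\<lambda>x. Complex (f x) (g x)) \<in> borel_measurable M"
proof -
  have "(\<lambda>x. complex_of_real (f x) + \<i> * complex_of_real (g x)) \<in> borel_measurable M"
    by measurable
  then show ?thesis by (simp add: Complex_eq)
qed

lemma borel_measurable_cnj [measurable (raw)]:
  assumes [measurable]: "f \<in> borel_measurable M"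
  shows "(\<lambda>x. cnj (f x)) \<in> borel_measurable M"
  by (rule borel_measurable_continuous_on[OF _ assms]) (intro continuous_intros)

text \<open>The pair is ordered (y, x) so that Fubini leaves the integral over x inside: the masses
  of the kernel and Cauchy's formula are computed along horizontal lines. Lebesgue measure is
  recognised by its values on boxes.\<close>

lemma lborel_complex_eq:
  "(lborel :: complex measure) = distr (lborel \<Otimes>\<^sub>M lborel) borel (\<lambda>(y, x). Complex x y)"
proof (rule lborel_eqI)
  fix l u :: complex
  assume le: "\<And>b. b \<in> Basis \<Longrightarrow> l \<bullet> b \<le> u \<bullet> b"
  have lu: "Re l \<le> Re u" "Im l \<le> Im u"
    using le[of 1] le[of \<i>] by auto
  have "(\<lambda>(y, x). Complex x y) -` box l u = {Im l<..<Im u} \<times> {Re l<..<Re u}"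
    by (auto simp: in_box_complex_iff)
  then have "emeasure (distr (lborel \<Otimes>\<^sub>M lborel) borel (\<lambda>(y, x). Complex x y)) (box l u) =
      emeasure (lborel \<Otimes>\<^sub>M lborel) ({Im l<..<Im u} \<times> {Re l<..<Re u})"
    by (subst emeasure_distr) (simp_all add: space_pair_measure)
  also have "\<dots> = ennreal (Im u - Im l) * ennreal (Re u - Re l)"
    using lu by (subst lborel.emeasure_pair_measure_Times) simp_all
  also have "\<dots> = ennreal (\<Prod>b\<in>Basis. (u - l) \<bullet> b)"
    using lu by (simp add: Basis_complex_def ennreal_mult[symmetric] mult.commute)
  finally show "emeasure (distr (lborel \<Otimes>\<^sub>M lborel) borel (\<lambda>(y, x). Complex x y)) (box l u) =
      ennreal (\<Prod>b\<in>Basis. (u - l) \<bullet> b)" .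
qed simp

lemma nn_integral_hpm:
  assumes [measurable]: "f \<in> borel_measurable borel"
  shows "(\<integral>\<^sup>+z. f z \<partial>hpm) = (\<integral>\<^sup>+y. (\<integral>\<^sup>+x. f (Complex x y) \<partial>lborel) * indicator {0<..} y \<partial>lborel)"
proof -
  have "(\<integral>\<^sup>+z. f z \<partial>hpm) = (\<integral>\<^sup>+z. f z * indicator upper_half_plane z \<partial>lborel)"
    unfolding hpm_def by (subst nn_integral_restrict_space) auto
  also have "\<dots> = (\<integral>\<^sup>+p. (case p of (y, x) \<Rightarrow> f (Complex x y) * indicator {0<..} y) \<partial>(lborel \<Otimes>\<^sub>M lborel))"
    by (subst lborel_complex_eq, subst nn_integral_distr)
       (auto intro!: nn_integral_cong simp: upper_half_plane_def indicator_def)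
  also have "\<dots> = (\<integral>\<^sup>+y. (\<integral>\<^sup>+x. f (Complex x y) * indicator {0<..} y \<partial>lborel) \<partial>lborel)"
    by (subst lborel.nn_integral_fst [symmetric]) auto
  also have "\<dots> = (\<integral>\<^sup>+y. (\<integral>\<^sup>+x. f (Complex x y) \<partial>lborel) * indicator {0<..} y \<partial>lborel)"
    by (subst nn_integral_multc) auto
  finally show ?thesis .
qed

lemma
  fixes f :: "complex \<Rightarrow> complex"
  assumes f: "integrable hpm f"
  shows integral_hpm: "integral\<^sup>L hpm f = (LINT y:{0<..}|lborel. LINT x|lborel. f (Complex x y))"
    and set_integrable_hpm_lines: "set_integrable lborel {0<..} (\<lambda>y. LINT x|lborel. f (Complex x y))"
proof -
  let ?g = "\<lambda>(y, x). indicator upper_half_plane (Complex x y) *\<^sub>R f (Complex x y)"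
  have f': "integrable lborel (\<lambda>z. indicator upper_half_plane z *\<^sub>R f z)"
    using f unfolding set_integrable_hpm[symmetric] set_integrable_def .
  have g: "integrable (lborel \<Otimes>\<^sub>M lborel) ?g"
  proof -
    have "integrable (distr (lborel \<Otimes>\<^sub>M lborel) borel (\<lambda>(y, x). Complex x y))
        (\<lambda>z. indicator upper_half_plane z *\<^sub>R f z)"
      using f' by (subst (asm) lborel_complex_eq)
    moreover have "(\<lambda>(y, x). Complex x y) \<in> measurable (lborel \<Otimes>\<^sub>M lborel) borel"
      by measurable
    ultimately show ?thesis
      using borel_measurable_integrable[OF f'] by (simp add: integrable_distr_eq case_prod_unfold)
  qed
  have eq: "(LINT x|lborel. ?g (y, x)) = indicator {0<..} y *\<^sub>R (LINT x|lborel. f (Complex x y))" for y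
    by (auto simp: indicator_def upper_half_plane_def)
  show "set_integrable lborel {0<..} (\<lambda>y. LINT x|lborel. f (Complex x y))"
    using lborel_pair.integrable_fst'[OF g] by (simp only: set_integrable_def eq)
  have "integral\<^sup>L hpm f = (LINT z|lborel. indicator upper_half_plane z *\<^sub>R f z)"
    by (simp add: set_lebesgue_integral_hpm[symmetric] set_lebesgue_integral_def)
  also have "\<dots> = integral\<^sup>L (distr (lborel \<Otimes>\<^sub>M lborel) borel (\<lambda>(y, x). Complex x y)) (\<lambda>z. indicator upper_half_plane z *\<^sub>R f z)"
    by (subst lborel_complex_eq) simp
  also have "\<dots> = integral\<^sup>L (lborel \<Otimes>\<^sub>M lborel) ?g"
    using borel_measurable_integrable[OF f'] by (subst integral_distr) (auto simp: case_prod_unfold)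
  also have "\<dots> = (LINT y|lborel. LINT x|lborel. ?g (y, x))"
    by (rule lborel_pair.integral_fst'[OF g, symmetric])
  finally show "integral\<^sup>L hpm f = (LINT y:{0<..}|lborel. LINT x|lborel. f (Complex x y))"
    by (simp only: eq set_lebesgue_integral_def)
qed

section \<open>One-variable integrals and the mass of the kernel on horizontal lines\<close>

lemma nn_integral_FTC_einterval:
  fixes f F :: "real \<Rightarrow> real" and a b :: ereal
  assumes "a < b"
    and D: "\<And>x. a < ereal x \<Longrightarrow> ereal x < b \<Longrightarrow> (F has_real_derivative f x) (at x)"
    and f: "\<And>x. a < ereal x \<Longrightarrow> ereal x < b \<Longrightarrow> isCont f x"
    and nonneg: "\<And>x. a < ereal x \<Longrightarrow> ereal x < b \<Longrightarrow> 0 \<le> f x"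
    and A: "((F \<circ> real_of_ereal) \<longlongrightarrow> A) (at_right a)"
    and B: "((F \<circ> real_of_ereal) \<longlongrightarrow> B) (at_left b)"
  shows "(\<integral>\<^sup>+x. ennreal (f x) * indicator (einterval a b) x \<partial>lborel) = ennreal (B - A)"
proof -
  have nn: "AE x in lborel. a < ereal x \<longrightarrow> ereal x < b \<longrightarrow> 0 \<le> f x"
    using nonneg by auto
  note * = interval_integral_FTC_nonneg[of a b F f A B, OF assms(1-3) nn A B]
  have "(\<integral>\<^sup>+x. ennreal (f x) * indicator (einterval a b) x \<partial>lborel)
      = (\<integral>\<^sup>+x. ennreal (indicator (einterval a b) x *\<^sub>R f x) \<partial>lborel)"
    by (auto intro!: nn_integral_cong simp: indicator_def)
  also have "\<dots> = ennreal (LINT x|lborel. indicator (einterval a b) x *\<^sub>R f x)"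
    using *(1) nonneg unfolding set_integrable_def
    by (intro nn_integral_eq_integral) (auto simp: indicator_def einterval_def)
  also have "(LINT x|lborel. indicator (einterval a b) x *\<^sub>R f x) = B - A"
    using *(2) \<open>a < b\<close> by (simp only: interval_lebesgue_integral_def set_lebesgue_integral_def less_imp_le if_True)
  finally show ?thesis .
qed

lemma nn_integral_Cauchy_density:
  fixes u s :: real
  assumes "s > 0"
  shows "(\<integral>\<^sup>+x. ennreal (1 / ((x - u)\<^sup>2 + s\<^sup>2)) \<partial>lborel) = ennreal (pi / s)"
proof -
  let ?f = "\<lambda>x. 1 / ((x - u)\<^sup>2 + s\<^sup>2)"
  let ?F = "\<lambda>x. arctan ((x - u) / s) / s"
  have pos: "(x - u)\<^sup>2 + s\<^sup>2 > 0" for x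
    using assms by (simp add: add_nonneg_pos)
  have D: "(?F has_real_derivative ?f x) (at x)" for x
  proof -
    have "1 + ((x - u) / s)\<^sup>2 = ((x - u)\<^sup>2 + s\<^sup>2) / s\<^sup>2"
      using assms by (simp add: field_simps)
    then have "inverse (1 + ((x - u) / s)\<^sup>2) * (1 / s) / s = ?f x"
      using assms by (simp add: power2_eq_square)
    moreover have "(?F has_real_derivative inverse (1 + ((x - u) / s)\<^sup>2) * (1 / s) / s) (at x)"
      using assms by (auto intro!: derivative_eq_intros)
    ultimately show ?thesis by simp
  qed
  have 1: "(?F \<longlongrightarrow> (pi/2) / s) at_top"
  proof -
    have "filterlim (\<lambda>x. (x - u) / s) at_top at_top"
      using assms by real_asymp
    from filterlim_compose[OF tendsto_arctan_at_top this] show ?thesis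
      by (intro tendsto_divide) (use assms in auto)
  qed
  have 2: "(?F \<longlongrightarrow> (-(pi/2)) / s) at_bot"
  proof -
    have "filterlim (\<lambda>x. (x - u) / s) at_bot at_bot"
      using assms by real_asymp
    from filterlim_compose[OF tendsto_arctan_at_bot this] show ?thesis
      using assms by (intro tendsto_divide) auto
  qed
  have "(\<integral>\<^sup>+x. ennreal (?f x) * indicator (einterval (-\<infinity>) \<infinity>) x \<partial>lborel)
      = ennreal ((pi/2) / s - (-(pi/2)) / s)"
  proof (rule nn_integral_FTC_einterval[where F = ?F])
    show "isCont ?f x" for x
      using pos[of x] by (intro continuous_intros) auto
    show "((?F \<circ> real_of_ereal) \<longlongrightarrow> (-(pi/2)) / s) (at_right (-\<infinity>))"
      using 2 by (simp add: ereal_tendsto_simps)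
    show "((?F \<circ> real_of_ereal) \<longlongrightarrow> (pi/2) / s) (at_left \<infinity>)"
      using 1 by (simp add: ereal_tendsto_simps)
  qed (use D pos in \<open>auto simp: less_imp_le\<close>)
  then show ?thesis by (simp add: einterval_eq_UNIV)
qed

text \<open>The kernel 1 / (y + t) reproduces the power y^(-1/2) up to the factor pi; this is the
  one-dimensional core of Schur's test. The substitution y = t u^2 leads to the arctangent.\<close>

lemma nn_integral_Schur_line:
  fixes t :: real
  assumes "t > 0"
  shows "(\<integral>\<^sup>+y. ennreal (1 / (sqrt y * (y + t))) * indicator {0<..} y \<partial>lborel) = ennreal (pi / sqrt t)"
proof -
  let ?f = "\<lambda>y. 1 / (sqrt y * (y + t))"
  let ?F = "\<lambda>y. 2 / sqrt t * arctan (sqrt y / sqrt t)"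
  have e: "einterval 0 \<infinity> = {0<..}"
    by (auto simp: einterval_def)
  have D: "(?F has_real_derivative ?f y) (at y)" if "y > 0" for y
  proof -
    define r where "r = sqrt t"
    have r: "r > 0" "t = r * r"
      using assms by (auto simp: r_def)
    have "((\<lambda>y. 2 / r * arctan (sqrt y / r)) has_real_derivative 2 / r * (inverse (1 + (sqrt y / r)\<^sup>2)
        * (inverse (sqrt y) / 2 / r))) (at y)"
      using r that by (auto intro!: derivative_eq_intros)
    moreover have "1 + (sqrt y / r)\<^sup>2 = (y + t) / t"
      using r that by (simp add: field_simps power2_eq_square)
    moreover have "2 / r * (inverse ((y + t) / t) * (inverse (sqrt y) / 2 / r)) = t / (r * r) * ?f y"
    proof -
      have "2 / r * (inverse (k / t) * (inverse q / 2 / r)) = t / (r * r) * (1 / (q * k))"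
        if "k \<noteq> 0" "q \<noteq> 0" "t \<noteq> 0" for k q t :: real
        using that r(1) by (simp add: field_simps)
      from this[of "y + t" "sqrt y" t] show ?thesis using assms that by simp
    qed
    moreover have "t / (r * r) = 1"
      using r by simp
    ultimately show ?thesis
      unfolding r_def[symmetric] by (simp only: mult_1_left)
  qed
  have 1: "(?F \<longlongrightarrow> 2 / sqrt t * (pi/2)) at_top"
  proof -
    have "filterlim (\<lambda>x. sqrt x / sqrt t) at_top at_top"
      using assms by real_asymp
    from filterlim_compose[OF tendsto_arctan_at_top this] show ?thesis
      by (intro tendsto_mult) auto
  qed
  have 2: "(?F \<longlongrightarrow> 0) (at_right 0)"
  proof -
    have "(?F \<longlongrightarrow> 2 / sqrt t * arctan (sqrt 0 / sqrt t)) (at_right 0)"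
      using assms by (intro tendsto_intros) auto
    then show ?thesis by simp
  qed
  have "(\<integral>\<^sup>+y. ennreal (?f y) * indicator (einterval 0 \<infinity>) y \<partial>lborel)
      = ennreal (2 / sqrt t * (pi/2) - 0)"
  proof (rule nn_integral_FTC_einterval[where F = ?F])
    show "isCont ?f x" if "0 < ereal x" for x
      using that assms by (intro continuous_intros) auto
    show "((?F \<circ> real_of_ereal) \<longlongrightarrow> 0) (at_right 0)"
      unfolding zero_ereal_def using 2 by (simp add: ereal_tendsto_simps)
    show "((?F \<circ> real_of_ereal) \<longlongrightarrow> 2 / sqrt t * (pi/2)) (at_left \<infinity>)"
      using 1 by (simp add: ereal_tendsto_simps)
  qed (use D assms in auto)
  then show ?thesis by (simp add: e)
qed

lemma nn_integral_reciprocal_shift: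
  fixes t T :: real
  assumes "t > 0" "T > 0"
  shows "(\<integral>\<^sup>+y. ennreal (1 / (y + t)) * indicator {0..T} y \<partial>lborel) = ennreal (ln ((T + t) / t))"
proof -
  have "(\<integral>\<^sup>+y. ennreal (1 / (y + t)) * indicator {0..T} y \<partial>lborel) = ennreal (ln (T + t) - ln (0 + t))"
    by (rule nn_integral_FTC_Icc) (use assms in \<open>auto intro!: derivative_eq_intros\<close>)
  then show ?thesis using assms by (simp add: ln_div)
qed

lemma nn_integral_inverse_square_tail:
  fixes T :: real
  assumes "T > 0"
  shows "(\<integral>\<^sup>+y. ennreal (1 / y\<^sup>2) * indicator {T..} y \<partial>lborel) = ennreal (1 / T)"
proof -
  have "(\<integral>\<^sup>+y. ennreal (1 / y\<^sup>2) * indicator {T..} y \<partial>lborel) = ennreal (0 - (- 1 / T))"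
  proof (rule nn_integral_FTC_atLeast)
    show "((\<lambda>y. - 1 / y) has_real_derivative 1 / x\<^sup>2) (at x)" if "T \<le> x" for x
      using assms that by (auto intro!: derivative_eq_intros simp: power2_eq_square)
    show "((\<lambda>y::real. - 1 / y) \<longlongrightarrow> 0) at_top" by real_asymp
  qed auto
  then show ?thesis by simp
qed

lemma cmod_minus_cnj_squared:
  "(cmod (Complex x y - cnj w))\<^sup>2 = (x - Re w)\<^sup>2 + (y + Im w)\<^sup>2"
  by (simp add: cmod_power2)

text \<open>By \<open>cmod_minus_cnj_squared\<close> the kernel on the line at height y is a Cauchy
  density of scale \<open>y + Im w\<close>, hence of mass \<open>pi / (y + Im w)\<close>. The
  density \<open>g\<close> depends on the height only and passes through.\<close>

lemma nn_integral_hpm_kernel: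
  assumes [measurable]: "g \<in> borel_measurable borel" and g: "\<And>y. 0 < y \<Longrightarrow> g y \<ge> 0" and w: "Im w > 0"
  shows "(\<integral>\<^sup>+z. ennreal (g (Im z) / (cmod (z - cnj w))\<^sup>2) \<partial>hpm)
       = (\<integral>\<^sup>+y. ennreal (g y * (pi / (y + Im w))) * indicator {0<..} y \<partial>lborel)"
proof -
  have "(\<integral>\<^sup>+x. ennreal (g y / (cmod (Complex x y - cnj w))\<^sup>2) \<partial>lborel) = ennreal (g y * (pi / (y + Im w)))"
    if "y > 0" for y
  proof -
    have "(\<integral>\<^sup>+x. ennreal (g y / (cmod (Complex x y - cnj w))\<^sup>2) \<partial>lborel)
        = (\<integral>\<^sup>+x. ennreal (g y) * ennreal (1 / ((x - Re w)\<^sup>2 + (y + Im w)\<^sup>2)) \<partial>lborel)"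
      using g[OF that] by (simp add: cmod_minus_cnj_squared ennreal_mult'[symmetric])
    also have "\<dots> = ennreal (g y) * ennreal (pi / (y + Im w))"
      using that w by (subst nn_integral_cmult) (auto simp: nn_integral_Cauchy_density)
    finally show ?thesis using g[OF that] by (simp add: ennreal_mult'[symmetric])
  qed
  then show ?thesis
    by (subst nn_integral_hpm) (auto intro!: nn_integral_cong simp: indicator_def)
qed

text \<open>One factor pi comes from the lines, the other from
  \<open>nn_integral_Schur_line\<close>. That the weight \<open>1 / sqrt (Im z)\<close> returns as
  \<open>1 / sqrt (Im w)\<close> is the hypothesis of Schur's test.\<close>

lemma nn_integral_Schur:
  assumes w: "Im w > 0"
  shows "(\<integral>\<^sup>+z. ennreal (1 / sqrt (Im z) / (cmod (z - cnj w))\<^sup>2) \<partial>hpm) = ennreal (pi\<^sup>2 / sqrt (Im w))"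
proof -
  have "(\<integral>\<^sup>+z. ennreal (1 / sqrt (Im z) / (cmod (z - cnj w))\<^sup>2) \<partial>hpm)
       = (\<integral>\<^sup>+y. ennreal (1 / sqrt y * (pi / (y + Im w))) * indicator {0<..} y \<partial>lborel)"
    by (rule nn_integral_hpm_kernel[OF _ _ w]) auto
  also have "\<dots> = (\<integral>\<^sup>+y. ennreal pi * (ennreal (1 / (sqrt y * (y + Im w))) * indicator {0<..} y) \<partial>lborel)"
    by (intro nn_integral_cong) (auto simp: indicator_def ennreal_mult'[symmetric])
  also have "\<dots> = ennreal pi * ennreal (pi / sqrt (Im w))"
    by (subst nn_integral_cmult) (auto simp: nn_integral_Schur_line[OF w])
  finally show ?thesis using w by (simp add: ennreal_mult'[symmetric] power2_eq_square)
qed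

section \<open>The integrated kernel difference\<close>

text \<open>The D(s, w) of the overview. Values in \<open>ennreal\<close> let all estimates run
  without a preliminary proof of finiteness.\<close>

definition kernel_gap :: "complex \<Rightarrow> complex \<Rightarrow> ennreal" where
  "kernel_gap s w = (\<integral>\<^sup>+z. ennreal (cmod (1 / (z - cnj s)\<^sup>2 - 1 / (z - cnj w)\<^sup>2)) \<partial>hpm)"

lemma cmod_minus_cnj_ge:
  assumes "Im z > 0" "Im w > 0"
  shows "Im z + Im w \<le> cmod (z - cnj w)"
  using abs_Im_le_cmod[of "z - cnj w"] by simp

text \<open>Cancellation gains one power of decay: the difference is (b - a) (1 / (a^2 b) + 1 / (a
  b^2)), and the simple factor in each denominator is at least y.\<close>

lemma cmod_inverse_square_diff_le:
  fixes a b :: complex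
  assumes "y > 0" "y \<le> cmod a" "y \<le> cmod b"
  shows "cmod (1 / a\<^sup>2 - 1 / b\<^sup>2) \<le> cmod (a - b) / y / (cmod a)\<^sup>2 + cmod (a - b) / y / (cmod b)\<^sup>2"
proof -
  have nz: "a \<noteq> 0" "b \<noteq> 0" using assms by auto
  have "1 / a\<^sup>2 - 1 / b\<^sup>2 = (b - a) * (1 / (a\<^sup>2 * b) + 1 / (a * b\<^sup>2))"
    using nz by (simp add: field_simps power2_eq_square)
  then have "cmod (1 / a\<^sup>2 - 1 / b\<^sup>2) = cmod (a - b) * cmod (1 / (a\<^sup>2 * b) + 1 / (a * b\<^sup>2))"
    by (simp add: norm_mult norm_minus_commute)
  also have "\<dots> \<le> cmod (a - b) * (cmod (1 / (a\<^sup>2 * b)) + cmod (1 / (a * b\<^sup>2)))"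
    by (intro mult_left_mono norm_triangle_ineq) auto
  also have "\<dots> = cmod (a - b) * (1 / (cmod a)\<^sup>2 * (1 / cmod b) + 1 / (cmod b)\<^sup>2 * (1 / cmod a))"
    by (simp add: norm_mult norm_divide norm_power)
  also have "\<dots> \<le> cmod (a - b) * (1 / (cmod a)\<^sup>2 * (1 / y) + 1 / (cmod b)\<^sup>2 * (1 / y))"
    using assms by (intro mult_left_mono add_mono divide_left_mono mult_pos_pos) auto
  finally show ?thesis by (simp add: field_simps)
qed

text \<open>Up to height \<open>T\<close> the mass is logarithmic. Above it the gain
  \<open>d / y\<close> from cancellation makes the tail converge, because 1 / (y (y + t)) \<le> 1 /
  y^2.\<close>

lemma nn_integral_truncated_density_le:
  fixes t T d :: real
  assumes "t > 0" "T > 0" "d \<ge> 0"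
  shows "(\<integral>\<^sup>+y. ennreal ((if y \<le> T then 1 else d / y) * (pi / (y + t))) * indicator {0<..} y \<partial>lborel)
       \<le> ennreal (pi * ln ((T + t) / t) + pi * d / T)"
proof -
  have "(\<integral>\<^sup>+y. ennreal ((if y \<le> T then 1 else d / y) * (pi / (y + t))) * indicator {0<..} y \<partial>lborel)
      \<le> (\<integral>\<^sup>+y. ennreal pi * (ennreal (1 / (y + t)) * indicator {0..T} y)
            + ennreal (pi * d) * (ennreal (1 / y\<^sup>2) * indicator {T..} y) \<partial>lborel)"
  proof (intro nn_integral_mono)
    fix y :: real
    show "ennreal ((if y \<le> T then 1 else d / y) * (pi / (y + t))) * indicator {0<..} y \<le>
      ennreal pi * (ennreal (1 / (y + t)) * indicator {0..T} y)
            + ennreal (pi * d) * (ennreal (1 / y\<^sup>2) * indicator {T..} y)"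
    proof (cases "y > T")
      case True
      have "d / y * (pi / (y + t)) \<le> d / y * (pi / y)"
        using True assms by (intro mult_left_mono divide_left_mono) auto
      then show ?thesis using True assms
        by (auto simp: ennreal_mult'[symmetric] power2_eq_square mult_ac intro!: ennreal_leI)
    next
      case False
      have "ennreal (pi / (y + t)) = ennreal pi * ennreal (1 / (y + t))" if "y > 0"
        using that assms by (simp add: ennreal_mult'[symmetric])
      with False show ?thesis
        by (cases "y > 0") (auto simp: indicator_def)
    qed
  qed
  also have "\<dots> = ennreal pi * ennreal (ln ((T + t) / t)) + ennreal (pi * d) * ennreal (1 / T)"
    using assms by (simp add: nn_integral_add nn_integral_cmult nn_integral_reciprocal_shift
      nn_integral_inverse_square_tail)
  also have "\<dots> = ennreal (pi * ln ((T + t) / t) + pi * d / T)"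
    using assms by (simp add: ennreal_mult'[symmetric] ennreal_plus[symmetric] del: ennreal_plus)
  finally show ?thesis .
qed

text \<open>The two kernels are bounded separately up to height \<open>T\<close>, and jointly
  through \<open>cmod_inverse_square_diff_le\<close> above it. The cutoff stays free, as a good
  choice depends on the distance between \<open>s\<close> and \<open>w\<close>.\<close>

lemma kernel_gap_le:
  assumes s: "Im s > 0" and w: "Im w > 0" and T: "T > 0"
  shows "kernel_gap s w \<le> ennreal (pi * ln ((T + Im s) / Im s) + pi * ln ((T + Im w) / Im w)
           + 2 * pi * cmod (s - w) / T)"
proof -
  let ?d = "cmod (s - w)"
  let ?g = "\<lambda>y. if y \<le> T then 1 else ?d / y"
  have "kernel_gap s w \<le> (\<integral>\<^sup>+z. ennreal (?g (Im z) / (cmod (z - cnj s))\<^sup>2)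
          + ennreal (?g (Im z) / (cmod (z - cnj w))\<^sup>2) \<partial>hpm)"
    unfolding kernel_gap_def
  proof (intro nn_integral_mono)
    fix z assume "z \<in> space hpm"
    then have z: "Im z > 0" by (simp add: upper_half_plane_def)
    let ?a = "z - cnj s" and ?b = "z - cnj w"
    have a: "Im z \<le> cmod ?a" "Im z \<le> cmod ?b"
      using cmod_minus_cnj_ge[OF z s] cmod_minus_cnj_ge[OF z w] s w by auto
    have "cmod (1 / ?a\<^sup>2 - 1 / ?b\<^sup>2) \<le> ?g (Im z) / (cmod ?a)\<^sup>2 + ?g (Im z) / (cmod ?b)\<^sup>2"
    proof (cases "Im z \<le> T")
      case True
      then show ?thesis
        using norm_triangle_ineq4[of "1 / ?a\<^sup>2" "1 / ?b\<^sup>2"] by (simp add: norm_divide norm_power)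
    next
      case False
      have "cmod (?a - ?b) = ?d"
      proof -
        have "?a - ?b = cnj (w - s)" by simp
        then show ?thesis by (metis complex_mod_cnj norm_minus_commute)
      qed
      then show ?thesis
        using cmod_inverse_square_diff_le[OF z a] False by simp
    qed
    then show "ennreal (cmod (1 / ?a\<^sup>2 - 1 / ?b\<^sup>2)) \<le>
        ennreal (?g (Im z) / (cmod ?a)\<^sup>2) + ennreal (?g (Im z) / (cmod ?b)\<^sup>2)"
      using z by (auto intro!: ennreal_leI simp flip: ennreal_plus)
  qed
  also have "\<dots> = (\<integral>\<^sup>+z. ennreal (?g (Im z) / (cmod (z - cnj s))\<^sup>2) \<partial>hpm)
          + (\<integral>\<^sup>+z. ennreal (?g (Im z) / (cmod (z - cnj w))\<^sup>2) \<partial>hpm)"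
    by (intro nn_integral_add measurable_hpm_borel) measurable
  also have "(\<integral>\<^sup>+z. ennreal (?g (Im z) / (cmod (z - cnj s))\<^sup>2) \<partial>hpm) \<le> ennreal (pi * ln ((T + Im s) / Im s) + pi * ?d / T)"
    using nn_integral_truncated_density_le[OF s T] s T by (subst nn_integral_hpm_kernel) auto
  also have "(\<integral>\<^sup>+z. ennreal (?g (Im z) / (cmod (z - cnj w))\<^sup>2) \<partial>hpm) \<le> ennreal (pi * ln ((T + Im w) / Im w) + pi * ?d / T)"
    using nn_integral_truncated_density_le[OF w T] w T by (subst nn_integral_hpm_kernel) auto
  also have "ennreal (pi * ln ((T + Im s) / Im s) + pi * ?d / T) + ennreal (pi * ln ((T + Im w) / Im w) + pi * ?d / T)
     = ennreal (pi * ln ((T + Im s) / Im s) + pi * ln ((T + Im w) / Im w) + 2 * pi * cmod (s - w) / T)"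
    using s w T by (subst ennreal_plus[symmetric]) (auto simp: field_simps)
  finally show ?thesis by (simp add: add_mono)
qed

text \<open>In the strip \<open>Im z \<le> 1\<close> the kernel at \<open>w\<close> has mass
  \<open>pi * ln ((1 + Im w) / Im w)\<close>, whereas the kernel at \<open>w0\<close> has a mass
  that does not depend on \<open>w\<close>; the gap must supply the rest. The additive form avoids
  subtraction in \<open>ennreal\<close>.\<close>

lemma kernel_gap_ge_height:
  assumes w: "Im w > 0" and w0: "Im w0 > 0"
  shows "ennreal (pi * ln ((1 + Im w) / Im w)) \<le> kernel_gap w w0 + ennreal (pi * ln ((1 + Im w0) / Im w0))"
proof -
  let ?g = "\<lambda>y::real. if y \<le> 1 then 1 else 0 :: real"
  have eq: "(\<integral>\<^sup>+z. ennreal (?g (Im z) / (cmod (z - cnj s))\<^sup>2) \<partial>hpm) = ennreal (pi * ln ((1 + Im s) / Im s))"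
    if s: "Im s > 0" for s
  proof -
    have "(\<integral>\<^sup>+z. ennreal (?g (Im z) / (cmod (z - cnj s))\<^sup>2) \<partial>hpm)
        = (\<integral>\<^sup>+y. ennreal (?g y * (pi / (y + Im s))) * indicator {0<..} y \<partial>lborel)"
      by (rule nn_integral_hpm_kernel[OF _ _ s]) auto
    also have "\<dots> = (\<integral>\<^sup>+y. ennreal pi * (ennreal (1 / (y + Im s)) * indicator {0..1} y) \<partial>lborel)"
    \<comment> \<open>The integrands disagree at y = 0, which only the closed interval
      contains.\<close>
    proof (intro nn_integral_cong_AE)
      show "AE y in lborel. ennreal (?g y * (pi / (y + Im s))) * indicator {0<..} y =
          ennreal pi * (ennreal (1 / (y + Im s)) * indicator {0..1} y)"
        using AE_lborel_singleton[of 0]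
      proof eventually_elim
        case (elim y)
        have "ennreal (pi / (y + Im s)) = ennreal pi * ennreal (1 / (y + Im s))" if "y > 0"
          using that s by (simp add: ennreal_mult'[symmetric])
        with elim show ?case
          by (cases "y > 0") (auto simp: indicator_def)
      qed
    qed
    also have "\<dots> = ennreal pi * ennreal (ln ((1 + Im s) / Im s))"
      using s by (simp add: nn_integral_cmult nn_integral_reciprocal_shift)
    finally show ?thesis by (simp add: ennreal_mult')
  qed
  have "ennreal (pi * ln ((1 + Im w) / Im w)) = (\<integral>\<^sup>+z. ennreal (?g (Im z) / (cmod (z - cnj w))\<^sup>2) \<partial>hpm)"
    by (rule eq[OF w, symmetric])
  also have "\<dots> \<le> (\<integral>\<^sup>+z. ennreal (cmod (1 / (z - cnj w)\<^sup>2 - 1 / (z - cnj w0)\<^sup>2))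
      + ennreal (?g (Im z) / (cmod (z - cnj w0))\<^sup>2) \<partial>hpm)"
  proof (intro nn_integral_mono)
    fix z
    have "1 / (cmod (z - cnj w))\<^sup>2 \<le> cmod (1 / (z - cnj w)\<^sup>2 - 1 / (z - cnj w0)\<^sup>2) + 1 / (cmod (z - cnj w0))\<^sup>2"
      using norm_triangle_sub[of "1 / (z - cnj w)\<^sup>2" "1 / (z - cnj w0)\<^sup>2"] by (simp add: norm_divide norm_power)
    then show "ennreal (?g (Im z) / (cmod (z - cnj w))\<^sup>2) \<le> ennreal (cmod (1 / (z - cnj w)\<^sup>2 - 1 / (z - cnj w0)\<^sup>2))
      + ennreal (?g (Im z) / (cmod (z - cnj w0))\<^sup>2)"
      by (auto intro!: ennreal_leI simp flip: ennreal_plus)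
  qed
  also have "\<dots> = kernel_gap w w0 + ennreal (pi * ln ((1 + Im w0) / Im w0))"
    unfolding kernel_gap_def eq[OF w0, symmetric]
    by (intro nn_integral_add measurable_hpm_borel) measurable
  finally show ?thesis .
qed

text \<open>The slice of this sector at height y has length y, so that a density 1 / y^2 integrates
  to a logarithm.\<close>

lemma nn_integral_hpm_sector:
  assumes [measurable]: "g \<in> borel_measurable borel" and g: "\<And>y. 0 < y \<Longrightarrow> 0 \<le> g y"
  shows "(\<integral>\<^sup>+z. ennreal (g (Im z)) * indicator {z. 0 < Re z \<and> Re z < Im z} z \<partial>hpm)
       = (\<integral>\<^sup>+y. ennreal (g y * y) * indicator {0<..} y \<partial>lborel)"
proof -
  have [measurable]: "{z. 0 < Re z \<and> Re z < Im z} \<in> sets borel" by measurable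
  have "(\<integral>\<^sup>+x. ennreal (g y) * indicator {z. 0 < Re z \<and> Re z < Im z} (Complex x y) \<partial>lborel) = ennreal (g y * y)"
    if "y > 0" for y
  proof -
    have "(\<integral>\<^sup>+x. ennreal (g y) * indicator {z. 0 < Re z \<and> Re z < Im z} (Complex x y) \<partial>lborel)
       = (\<integral>\<^sup>+x. ennreal (g y) * indicator {0<..<y} x \<partial>lborel)"
      by (intro nn_integral_cong) (auto simp: indicator_def)
    also have "\<dots> = ennreal (g y) * ennreal y"
      using that by (simp add: nn_integral_cmult_indicator)
    finally show ?thesis using that g[OF that] by (simp add: ennreal_mult')
  qed
  then show ?thesis
    by (subst nn_integral_hpm) (auto intro!: nn_integral_cong simp: indicator_def)
qed

text \<open>Let A = |w0| and R = |w| / 4. In the sector, at heights y between A and R, the kernel at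
  \<open>w0\<close> is at least 1 / (9 y^2) and the kernel at \<open>w\<close> is at most 1 / (4
  R^2). Over slices of length y the former contributes ln (R / A) / 9 and the latter at most 1 /
  4.\<close>

lemma kernel_gap_ge_modulus:
  assumes w: "Im w > 0" and w0: "Im w0 > 0" and big: "4 * cmod w0 < cmod w"
  shows "ennreal (ln (cmod w / (4 * cmod w0)) / 9) \<le> kernel_gap w w0 + ennreal (1 / 4)"
proof -
  define A where "A = cmod w0"
  define R where "R = cmod w / 4"
  have A: "A > 0" using w0 unfolding A_def by auto
  have AR: "A < R" using big by (simp add: A_def R_def)
  let ?S = "{z. 0 < Re z \<and> Re z < Im z}"
  let ?g = "\<lambda>c y. if A \<le> y \<and> y \<le> R then c y else 0 :: real"
  have [measurable]: "?S \<in> sets borel" by measurable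
  have "ln (cmod w / (4 * cmod w0)) / 9 = (ln R - ln A) / 9"
  proof -
    have "cmod w / (4 * cmod w0) = R / A" by (simp add: R_def A_def)
    then show ?thesis using A AR by (simp add: ln_div)
  qed
  also have "ennreal \<dots> = ennreal (ln R / 9 - ln A / 9)"
    by (simp add: diff_divide_distrib)
  also have "\<dots> = (\<integral>\<^sup>+y. ennreal (1 / (9 * y)) * indicator {A..R} y \<partial>lborel)"
    by (rule nn_integral_FTC_Icc[symmetric, where F = "\<lambda>y. ln y / 9"])
       (use A AR in \<open>auto intro!: derivative_eq_intros simp: divide_simps\<close>)
  also have "\<dots> = (\<integral>\<^sup>+y. ennreal (?g (\<lambda>y. 1 / (9 * y\<^sup>2)) y * y) * indicator {0<..} y \<partial>lborel)"
    using A by (intro nn_integral_cong) (auto simp: indicator_def power2_eq_square)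
  also have "\<dots> = (\<integral>\<^sup>+z. ennreal (?g (\<lambda>y. 1 / (9 * y\<^sup>2)) (Im z)) * indicator ?S z \<partial>hpm)"
    by (rule nn_integral_hpm_sector[symmetric]) auto
  also have "\<dots> \<le> (\<integral>\<^sup>+z. ennreal (cmod (1 / (z - cnj w)\<^sup>2 - 1 / (z - cnj w0)\<^sup>2))
      + ennreal (?g (\<lambda>y. 1 / (4 * R\<^sup>2)) (Im z)) * indicator ?S z \<partial>hpm)"
  proof (intro nn_integral_mono)
    fix z
    show "ennreal (?g (\<lambda>y. 1 / (9 * y\<^sup>2)) (Im z)) * indicator ?S z \<le> ennreal (cmod (1 / (z - cnj w)\<^sup>2 - 1 / (z - cnj w0)\<^sup>2))
      + ennreal (?g (\<lambda>y. 1 / (4 * R\<^sup>2)) (Im z)) * indicator ?S z"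
    proof (cases "z \<in> ?S \<and> A \<le> Im z \<and> Im z \<le> R")
      case True
      have z2: "cmod z \<le> 2 * Im z"
        using cmod_le[of z] True by auto
      \<comment> \<open>Two heights come from the sector, the third from
        \<open>cmod w0 = A \<le> Im z\<close>.\<close>
      have "cmod (z - cnj w0) \<le> 3 * Im z"
        using norm_triangle_ineq4[of z "cnj w0"] z2 True by (simp add: A_def)
      moreover have "cmod (z - cnj w0) > 0"
        using w0 True A by (auto simp: complex_eq_iff)
      ultimately have 1: "1 / (9 * (Im z)\<^sup>2) \<le> 1 / (cmod (z - cnj w0))\<^sup>2"
        using power_mono[of "cmod (z - cnj w0)" "3 * Im z" 2] True A
        by (intro divide_left_mono) (auto simp: power_mult_distrib)
      \<comment> \<open>Here |w| = 4 R, while |z| \<le> 2 Im z \<le> 2 R.\<close>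
      have "2 * R \<le> cmod (z - cnj w)"
        using norm_triangle_ineq2[of "cnj w" z] z2 True by (simp add: R_def norm_minus_commute)
      then have 2: "1 / (cmod (z - cnj w))\<^sup>2 \<le> 1 / (4 * R\<^sup>2)"
        using power_mono[of "2 * R" "cmod (z - cnj w)" 2] A AR
        by (intro divide_left_mono mult_pos_pos zero_less_power) (auto simp: power_mult_distrib)
      have "1 / (cmod (z - cnj w0))\<^sup>2 \<le> cmod (1 / (z - cnj w)\<^sup>2 - 1 / (z - cnj w0)\<^sup>2) + 1 / (cmod (z - cnj w))\<^sup>2"
        using norm_triangle_sub[of "1 / (z - cnj w0)\<^sup>2" "1 / (z - cnj w)\<^sup>2"]
        by (simp add: norm_divide norm_power norm_minus_commute)
      then have "1 / (9 * (Im z)\<^sup>2) \<le> cmod (1 / (z - cnj w)\<^sup>2 - 1 / (z - cnj w0)\<^sup>2) + 1 / (4 * R\<^sup>2)"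
        using 1 2 by linarith
      then show ?thesis
        using True by (simp flip: ennreal_plus add: ennreal_leI)
    qed (auto simp: indicator_def)
  qed
  also have "\<dots> = kernel_gap w w0 + (\<integral>\<^sup>+z. ennreal (?g (\<lambda>y. 1 / (4 * R\<^sup>2)) (Im z)) * indicator ?S z \<partial>hpm)"
    unfolding kernel_gap_def
    by (intro nn_integral_add measurable_hpm_borel) measurable
  also have "(\<integral>\<^sup>+z. ennreal (?g (\<lambda>y. 1 / (4 * R\<^sup>2)) (Im z)) * indicator ?S z \<partial>hpm)
     = (\<integral>\<^sup>+y. ennreal (?g (\<lambda>y. 1 / (4 * R\<^sup>2)) y * y) * indicator {0<..} y \<partial>lborel)"
    by (rule nn_integral_hpm_sector) auto
  also have "\<dots> \<le> (\<integral>\<^sup>+y. ennreal (1 / (4 * R)) * indicator {0..R} y \<partial>lborel)"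
  proof (intro nn_integral_mono)
    fix y :: real
    have "1 / (4 * R\<^sup>2) * y \<le> 1 / (4 * R\<^sup>2) * R" if "y \<le> R"
      using that by (intro mult_left_mono) auto
    then show "ennreal (?g (\<lambda>y. 1 / (4 * R\<^sup>2)) y * y) * indicator {0<..} y \<le> ennreal (1 / (4 * R)) * indicator {0..R} y"
      using A AR by (auto simp: indicator_def power2_eq_square intro!: ennreal_leI)
  qed
  also have "\<dots> = ennreal (1 / 4)"
    using A AR by (simp add: nn_integral_cmult_indicator ennreal_mult'[symmetric])
  finally show ?thesis by (simp add: add_left_mono)
qed

section \<open>Comparison of the integrated kernel difference with the logarithmic weight\<close>

lemma ln_plus_nonneg [simp]: "ln_plus t \<ge> 0"
  by (simp add: ln_plus_def)

lemma omega_ge_1: "omega z \<ge> 1"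
  by (simp add: omega_def)

text \<open>The strip detects the first logarithm of \<open>omega\<close> and the sector the second,
  the latter with the factor 1 / 9. Taking the sector bound with weight 1 / 2 and the strip bound
  with weight 1 / 18 counts the gap at most once, whence 1 / 18. An infinite gap needs no
  argument.\<close>

lemma kernel_gap_ge_omega:
  assumes w0: "Im w0 > 0"
  obtains C where "C \<ge> 0" "\<And>w. Im w > 0 \<Longrightarrow> ennreal (omega w / 18) \<le> kernel_gap w w0 + ennreal C"
proof -
  define C1 where "C1 = pi * ln ((1 + Im w0) / Im w0)"
  define C2 where "C2 = 1 / 4 + ln_plus (4 * cmod w0)"
  have C1: "C1 \<ge> 0" using w0 by (auto simp: C1_def)
  have C2: "C2 \<ge> 0" by (auto simp: C2_def)
  have main: "ennreal (omega w / 18) \<le> kernel_gap w w0 + ennreal (1 + C1 + C2)" if w: "Im w > 0" for w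
  proof (cases "kernel_gap w w0")
    case (real d)
    have 1: "ln_plus (1 / Im w) \<le> d + C1"
    proof -
      have "pi * ln ((1 + Im w) / Im w) \<le> d + C1"
        using kernel_gap_ge_height[OF w w0] real C1 unfolding C1_def
        by (simp add: ennreal_plus[symmetric] del: ennreal_plus)
      moreover have "ln_plus (1 / Im w) \<le> ln ((1 + Im w) / Im w)"
      proof -
        have "ln (1 / Im w) \<le> ln ((1 + Im w) / Im w)"
          using w by (subst ln_le_cancel_iff) (auto simp: field_simps)
        moreover have "0 \<le> ln ((1 + Im w) / Im w)"
          using w by (auto simp: field_simps)
        ultimately show ?thesis by (simp add: ln_plus_def)
      qed
      moreover have "1 * ln ((1 + Im w) / Im w) \<le> pi * ln ((1 + Im w) / Im w)"
        using pi_gt3 w by (intro mult_right_mono) (auto simp: field_simps)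
      ultimately show ?thesis by linarith
    qed
    have 2: "ln_plus (cmod w) / 9 \<le> d + C2"
    proof (cases "4 * cmod w0 < cmod w")
      case True
      have pos: "cmod w0 > 0" using w0 by auto
      have "ln (cmod w / (4 * cmod w0)) / 9 \<le> d + 1 / 4"
        using kernel_gap_ge_modulus[OF w w0 True] real
        by (simp add: ennreal_plus[symmetric] del: ennreal_plus)
      moreover have "ln (cmod w / (4 * cmod w0)) = ln (cmod w) - ln (4 * cmod w0)"
        using True pos by (subst ln_div) auto
      ultimately show ?thesis using real by (auto simp: C2_def ln_plus_def)
    next
      case False
      have "cmod w > 0" using w by auto
      then have "ln (cmod w) \<le> ln (4 * cmod w0)"
        using False by (subst ln_le_cancel_iff) linarith+
      then show ?thesis using real by (auto simp: C2_def ln_plus_def)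
    qed
    have "omega w / 18 \<le> d + (1 + C1 + C2)"
      using 1 2 C1 C2 real by (simp add: omega_def)
    then show ?thesis using real C1 C2
      by (simp add: ennreal_plus[symmetric] del: ennreal_plus)
  qed simp
  show thesis
    by (rule that[of "1 + C1 + C2"]) (use main C1 C2 in auto)
qed

text \<open>The cutoff \<open>T = Im w + cmod (s - w)\<close> dominates both heights and the
  distance. Replacing \<open>T + y\<close> by \<open>T\<close> therefore costs at most ln 2 \<le> 1
  in each logarithm, and the tail is at most 2 pi: this is 4 = 1 + 1 + 2.\<close>

lemma kernel_gap_le_log:
  assumes s: "Im s > 0" and w: "Im w > 0"
  shows "kernel_gap s w \<le> ennreal (pi * (4 + ln ((Im w + cmod (s - w)) / Im s) + ln ((Im w + cmod (s - w)) / Im w)))"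
proof -
  define T where "T = Im w + cmod (s - w)"
  have T: "T > 0" "Im w \<le> T" "Im s \<le> T" "cmod (s - w) \<le> T"
    using w abs_Im_le_cmod[of "s - w"] by (auto simp: T_def intro: add_pos_nonneg)
  have ln2: "ln (2::real) \<le> 1"
    using ln_add_one_self_le_self[of "1::real"] by simp
  have *: "ln ((T + y) / y) \<le> 1 + ln (T / y)" if "y > 0" "y \<le> T" for y
  proof -
    have "ln ((T + y) / y) \<le> ln (2 * (T / y))"
      using that by (subst ln_le_cancel_iff) (auto simp: field_simps)
    also have "\<dots> = ln 2 + ln (T / y)"
      using that by (subst ln_mult) auto
    finally show ?thesis using ln2 by linarith
  qed
  have "pi * ln ((T + Im s) / Im s) + pi * ln ((T + Im w) / Im w) + 2 * pi * cmod (s - w) / T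
      \<le> pi * (1 + ln (T / Im s)) + pi * (1 + ln (T / Im w)) + 2 * pi * 1"
    using T s w *[of "Im s"] *[of "Im w"]
    by (intro add_mono mult_left_mono) (auto simp: field_simps)
  then show ?thesis
    using kernel_gap_le[OF s w T(1)] unfolding T_def[symmetric]
    by (elim order_trans) (auto intro!: ennreal_leI simp: algebra_simps)
qed

text \<open>At the base point \<i> the cutoff is at most 2 + |s|, whose logarithm is at most 2 +
  \<open>ln_plus (cmod s)\<close>. It enters twice, so the constants add up to 4 + 2 * 2 =
  8.\<close>

lemma kernel_gap_le_omega:
  assumes s: "Im s > 0"
  shows "kernel_gap s \<i> \<le> ennreal (8 * pi * omega s)"
proof -
  define T where "T = 1 + cmod (s - \<i>)"
  have T: "T \<ge> 1" "T \<le> 2 + cmod s"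
    using norm_triangle_ineq4[of s \<i>] by (auto simp: T_def)
  have "ln (1 + 2) \<le> (2::real)"
    by (rule ln_add_one_self_le_self) auto
  then have ln3: "ln 3 \<le> (2::real)" by simp
  have lnT: "ln T \<le> 2 + ln_plus (cmod s)"
  proof (cases "cmod s \<ge> 1")
    case True
    have "ln T \<le> ln (3 * cmod s)"
      using T True by (subst ln_le_cancel_iff) linarith+
    also have "\<dots> = ln 3 + ln (cmod s)"
      using True by (subst ln_mult) auto
    finally show ?thesis using ln3 by (simp add: ln_plus_def)
  next
    case False
    then have "ln T \<le> ln 3"
      using T by simp
    then show ?thesis using ln3 ln_plus_nonneg[of "cmod s"] by linarith
  qed
  have "ln (T / Im s) = ln T + ln (1 / Im s)"
    using T s by (simp add: ln_div)
  then have "4 + ln (T / Im s) + ln T \<le> 8 * omega s"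
    using lnT ln_plus_nonneg[of "cmod s"] ln_plus_nonneg[of "1 / Im s"]
    by (simp add: omega_def) (simp add: ln_plus_def)
  then have "pi * (4 + ln (T / Im s) + ln T) \<le> pi * (8 * omega s)"
    by (intro mult_left_mono) auto
  then show ?thesis
    using kernel_gap_le_log[OF s, of \<i>] 
    by (simp add: T_def[symmetric]) (erule order_trans, auto intro!: ennreal_leI simp: mult_ac)
qed

text \<open>The first factor is the modulus of the function \<open>test_fun w\<close> introduced
  below. Compared with 1 / r^2, where r = |s - cnj w|, it carries an additional v / r \<le> 1 with v
  = Im w, which suffices to absorb the logarithms of the gap once they are bounded by square roots.
  The right-hand side is a multiple of the integrand of \<open>nn_integral_Schur\<close>, so that
  the product has an integral bounded uniformly in \<open>w\<close>.\<close>

lemma kernel_gap_mult_test_le: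
  assumes s: "Im s > 0" and w: "Im w > 0"
  shows "ennreal (Im w / cmod (s - cnj w) ^ 3) * kernel_gap s w
       \<le> ennreal (14 * pi * sqrt (Im w) * (1 / sqrt (Im s) / (cmod (s - cnj w))\<^sup>2))"
proof -
  define r v e where "r = cmod (s - cnj w)" and "v = Im w" and "e = Im s"
  define T where "T = v + cmod (s - w)"
  have pos: "v > 0" "e > 0" using s w by (auto simp: v_def e_def)
  have r: "v \<le> r" "e \<le> r" 
    using cmod_minus_cnj_ge[OF s w] s w by (auto simp: r_def v_def e_def)
  have rpos: "r > 0" using r pos by auto
  have "(Im (s - w))\<^sup>2 \<le> (Im (s - cnj w))\<^sup>2"
    using s w by (subst abs_le_square_iff[symmetric]) auto
  then have "cmod (s - w) \<le> r"
    unfolding r_def cmod_def by simp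
  then have T: "T > 0" "T \<le> 2 * r"
    using r pos by (auto simp: T_def intro: add_pos_nonneg)
  have ln_sqrt_le: "ln x \<le> 2 * sqrt x" if "x > 0" for x :: real
    using ln_le_minus_one[of "sqrt x"] that by (simp add: ln_sqrt)
  have a: "ln (T / v) \<le> 4 * sqrt (r / v)"
  proof -
    have "ln (T / v) \<le> 2 * sqrt (T / v)"
      using T pos by (intro ln_sqrt_le) auto
    also have "\<dots> \<le> 2 * sqrt (4 * (r / v))"
      using T pos rpos by (intro mult_left_mono real_sqrt_le_mono) (auto simp: field_simps)
    also have "sqrt (4 * (r / v)) = 2 * sqrt (r / v)"
      unfolding real_sqrt_mult by simp
    finally show ?thesis by simp
  qed
  have b: "ln (v / e) \<le> 2 * sqrt (v / e)"
    using pos by (intro ln_sqrt_le) auto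
  have c: "ln (T / e) = ln (T / v) + ln (v / e)"
    using T pos by (simp add: ln_div)
  have d: "1 \<le> sqrt (r / v)"
    using r pos by simp
  \<comment> \<open>By \<open>c\<close>, \<open>ln (T / v)\<close> occurs twice and gives 8;
    \<open>d\<close> absorbs the 4, which makes 12. The 2 of \<open>b\<close> completes the later
    14.\<close>
  have "pi * (4 + ln (T / e) + ln (T / v)) \<le> pi * (12 * sqrt (r / v) + 2 * sqrt (v / e))"
  proof (intro mult_left_mono)
    show "4 + ln (T / e) + ln (T / v) \<le> 12 * sqrt (r / v) + 2 * sqrt (v / e)"
      using a b c d by linarith
  qed simp
  then have gap: "kernel_gap s w \<le> ennreal (pi * (12 * sqrt (r / v) + 2 * sqrt (v / e)))"
    using kernel_gap_le_log[OF s w] unfolding T_def v_def e_def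
    by (elim order_trans) (auto intro!: ennreal_leI)
  have "ennreal (v / r ^ 3) * kernel_gap s w \<le> ennreal (v / r ^ 3) * ennreal (pi * (12 * sqrt (r / v) + 2 * sqrt (v / e)))"
    by (intro mult_left_mono gap) auto
  also have "\<dots> = ennreal (v / r ^ 3 * (pi * (12 * sqrt (r / v) + 2 * sqrt (v / e))))"
    using pos rpos by (intro ennreal_mult'[symmetric]) auto
  also have "\<dots> \<le> ennreal (14 * pi * sqrt v * (1 / sqrt e / r\<^sup>2))"
  proof (intro ennreal_leI)
    have 1: "v / r ^ 3 * sqrt (r / v) \<le> sqrt v * (1 / sqrt e / r\<^sup>2)"
    proof -
      have "sqrt e \<le> sqrt r" using r by simp
      moreover have "v / r ^ 3 * sqrt (r / v) = sqrt v * (1 / sqrt r / r\<^sup>2)"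
      proof -
        define p q where "p = sqrt v" and "q = sqrt r"
        have "v = p\<^sup>2" "r = q\<^sup>2" "p > 0" "q > 0"
          using pos rpos by (auto simp: p_def q_def)
        then show ?thesis
          by (simp add: real_sqrt_divide field_simps power2_eq_square power3_eq_cube)
      qed
      ultimately show ?thesis
        using pos rpos by (auto intro!: mult_left_mono divide_right_mono divide_left_mono)
    qed
    have 2: "v / r ^ 3 * sqrt (v / e) \<le> sqrt v * (1 / sqrt e / r\<^sup>2)"
    proof -
      have "v / r ^ 3 * sqrt (v / e) = (v / r) * (sqrt v * (1 / sqrt e / r\<^sup>2))"
        by (simp add: real_sqrt_divide power2_eq_square power3_eq_cube)
      also have "\<dots> \<le> 1 * (sqrt v * (1 / sqrt e / r\<^sup>2))"
        using r pos rpos by (intro mult_right_mono) auto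
      finally show ?thesis by simp
    qed
    have "v / r ^ 3 * (pi * (12 * sqrt (r / v) + 2 * sqrt (v / e)))
       = pi * (12 * (v / r ^ 3 * sqrt (r / v)) + 2 * (v / r ^ 3 * sqrt (v / e)))"
      by (simp add: algebra_simps)
    also have "\<dots> \<le> pi * (12 * (sqrt v * (1 / sqrt e / r\<^sup>2)) + 2 * (sqrt v * (1 / sqrt e / r\<^sup>2)))"
      using 1 2 by (intro mult_left_mono add_mono) auto
    finally show "v / r ^ 3 * (pi * (12 * sqrt (r / v) + 2 * sqrt (v / e))) \<le> 14 * pi * sqrt v * (1 / sqrt e / r\<^sup>2)"
      by (simp add: algebra_simps)
  qed
  finally show ?thesis unfolding r_def v_def e_def .
qed

section \<open>Cauchy's formula on rectangles and on horizontal lines\<close>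

lemma contour_integral_linepath_same_Im:
  assumes "a < b"
  shows "contour_integral (linepath (Complex a c) (Complex b c)) f = integral {a..b} (\<lambda>x. f (Complex x c))"
proof -
  have "contour_integral (linepath (Complex a c) (Complex b c)) f =
         (Complex b c - Complex a c) * integral {0..1} (\<lambda>x. f (linepath (Complex a c) (Complex b c) x))"
    by (simp add: contour_integral_integral)
  also have "Complex b c - Complex a c = of_real (b - a)"
    by (simp add: complex_eq_iff)
  also have "integral {0..1} (\<lambda>x. f (linepath (Complex a c) (Complex b c) x)) =
             integral {0..1} (\<lambda>x. f (Complex (linepath a b x) c))"
    by (simp add: linepath_def Complex_eq scaleR_conv_of_real algebra_simps)
  also have "\<dots> = integral {0..(b - a) / (b - a)} (\<lambda>x. f (Complex (a + (b - a) * x) c))"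
    using \<open>a < b\<close> by (simp add: algebra_simps linepath_def)
  also have "{0..(b - a) / (b - a)} = (\<lambda>x. x / (b - a)) ` {0..b - a}"
    using \<open>a < b\<close> by simp
  also have "integral \<dots> (\<lambda>x. f (Complex (a + (b - a) * x) c)) =
             integral {a-a..b-a} (\<lambda>x. f (Complex (x + a) c)) / of_real (b - a)"
    using \<open>a < b\<close> by (subst integral_stretch_real) (auto simp: scaleR_conv_of_real add_ac)
  also have "\<dots> = integral {a..b} (\<lambda>x. f (Complex x c)) / of_real (b - a)"
    by (subst integral_shift_real_ivl) (rule refl)
  finally show ?thesis
    using \<open>a < b\<close> by simp
qed

lemma contour_integral_rectpath:
  assumes f: "continuous_on (path_image (rectpath (Complex a c) (Complex b d))) f" and "a < b" "c < d"
  shows "contour_integral (rectpath (Complex a c) (Complex b d)) f =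
    integral {a..b} (\<lambda>x. f (Complex x c)) + \<i> * integral {c..d} (\<lambda>y. f (Complex b y))
    - integral {a..b} (\<lambda>x. f (Complex x d)) - \<i> * integral {c..d} (\<lambda>y. f (Complex a y))"
proof -
  let ?p1 = "Complex a c" and ?p2 = "Complex b c" and ?p3 = "Complex b d" and ?p4 = "Complex a d"
  have im: "path_image (rectpath ?p1 ?p3) = closed_segment ?p1 ?p2 \<union> closed_segment ?p2 ?p3
      \<union> closed_segment ?p3 ?p4 \<union> closed_segment ?p4 ?p1"
    by (simp add: rectpath_def Let_def path_image_join Un_assoc)
  have c: "continuous_on (closed_segment ?p1 ?p2) f" "continuous_on (closed_segment ?p2 ?p3) f"
      "continuous_on (closed_segment ?p3 ?p4) f" "continuous_on (closed_segment ?p4 ?p1) f"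
    by (rule continuous_on_subset[OF f], use im in blast)+
  have "contour_integral (rectpath ?p1 ?p3) f = contour_integral (linepath ?p1 ?p2) f
    + contour_integral (linepath ?p2 ?p3) f + contour_integral (linepath ?p3 ?p4) f
    + contour_integral (linepath ?p4 ?p1) f"
    using c by (simp add: rectpath_def Let_def contour_integrable_continuous_linepath)
  also have "contour_integral (linepath ?p3 ?p4) f = - contour_integral (linepath ?p4 ?p3) f"
    by (rule contour_integral_reverse_linepath) (rule c)
  also have "contour_integral (linepath ?p4 ?p1) f = - contour_integral (linepath ?p1 ?p4) f"
    by (rule contour_integral_reverse_linepath) (rule c)
  finally show ?thesis
    using assms by (simp add: contour_integral_linepath_same_Im contour_integral_linepath_same_Re)
qed

lemma Cauchy_rectpath:
  assumes g: "g holomorphic_on upper_half_plane" and p: "p \<in> box a c" and a: "Im a > 0"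
  shows "contour_integral (rectpath a c) (\<lambda>s. g s / (s - p) ^ Suc n)
       = 2 * pi * \<i> * ((deriv ^^ n) g p / fact n)"
proof -
  have less: "Re a < Re c" "Im a < Im c"
    using p by (auto simp: in_box_complex_iff)
  have sub: "cbox a c \<subseteq> upper_half_plane"
    using a by (auto simp: in_cbox_complex_iff upper_half_plane_def)
  have pU: "p \<in> upper_half_plane"
    using p sub box_subset_cbox by blast
  have "contour_integral (rectpath a c) (\<lambda>s. g s / (s - p) ^ Suc n)
      = 2 * pi * \<i> * (\<Sum>q\<in>{p}. winding_number (rectpath a c) q * residue (\<lambda>s. g s / (s - p) ^ Suc n) q)"
  proof (rule Residue_theorem)
    show "open upper_half_plane" by (rule open_upper_half_plane)
    show "connected upper_half_plane"
      unfolding upper_half_plane_def by (intro convex_connected convex_halfspace_Im_gt)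
    show "(\<lambda>s. g s / (s - p) ^ Suc n) holomorphic_on upper_half_plane - {p}"
      by (intro holomorphic_intros holomorphic_on_subset[OF g]) auto
    show "path_image (rectpath a c) \<subseteq> upper_half_plane - {p}"
      using path_image_rectpath_cbox_minus_box[of a c] less sub p by auto
    show "\<forall>z. z \<notin> upper_half_plane \<longrightarrow> winding_number (rectpath a c) z = 0"
      using winding_number_rectpath_outside[of a c] less sub by auto
  qed auto
  then show ?thesis
    using residue_holomorphic_over_power[OF open_upper_half_plane pU g, of n] winding_number_rectpath[OF p]
    by simp
qed

lemma continuous_on_Complex [continuous_intros]:
  "continuous_on A f \<Longrightarrow> continuous_on A g \<Longrightarrow> continuous_on A (\<lambda>x. Complex (f x) (g x))"
  unfolding Complex_eq by (intro continuous_intros)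

text \<open>The majorant is integrated over the whole line and may be infinite, so edges of varying
  length get one common bound.\<close>

lemma norm_integral_le_nn_integral:
  fixes f :: "real \<Rightarrow> complex"
  assumes f: "continuous_on {a..b} f" and h: "\<And>x. x \<in> {a..b} \<Longrightarrow> ennreal (cmod (f x)) \<le> h x"
  shows "ennreal (cmod (integral {a..b} f)) \<le> (\<integral>\<^sup>+x. h x \<partial>lborel)"
proof -
  have i: "set_integrable lborel {a..b} f"
    by (rule borel_integrable_atLeastAtMost'[OF f])
  have "integral {a..b} f = (LINT x:{a..b}|lborel. f x)"
    by (rule set_borel_integral_eq_integral(2)[symmetric, OF i])
  then have "ennreal (cmod (integral {a..b} f)) \<le> (\<integral>\<^sup>+x. ennreal (cmod (indicator {a..b} x *\<^sub>R f x)) \<partial>lborel)"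
    using integral_norm_bound_ennreal[OF i[unfolded set_integrable_def]] by (simp add: set_lebesgue_integral_def)
  also have "\<dots> \<le> (\<integral>\<^sup>+x. h x \<partial>lborel)"
    using h by (intro nn_integral_mono) (auto simp: indicator_def)
  finally show ?thesis .
qed

text \<open>The signs and the factors \<i> are those of the four edges in
  \<open>contour_integral_rectpath\<close>.\<close>

lemma ennreal_cmod_diff_sum_le:
  assumes "ennreal (cmod a) \<le> A" "ennreal (cmod b) \<le> B" "ennreal (cmod c) \<le> C" "ennreal (cmod d) \<le> D"
  shows "ennreal (cmod (a + \<i> * b - c - \<i> * d)) \<le> A + B + C + D"
proof -
  have "cmod (a + \<i> * b - c - \<i> * d) \<le> cmod a + cmod b + cmod c + cmod d"
    using norm_triangle_ineq4[of "a + \<i> * b - c" "\<i> * d"] norm_triangle_ineq4[of "a + \<i> * b" c]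
      norm_triangle_ineq[of a "\<i> * b"] by (simp add: norm_mult)
  then have "ennreal (cmod (a + \<i> * b - c - \<i> * d)) \<le> ennreal (cmod a) + ennreal (cmod b) + ennreal (cmod c) + ennreal (cmod d)"
    by (simp add: ennreal_leI flip: ennreal_plus)
  also have "\<dots> \<le> A + B + C + D"
    by (intro add_mono assms)
  finally show ?thesis .
qed

text \<open>Cauchy's formula is averaged over the boundaries of the concentric squares of half side
  \<open>s\<close> with \<open>r / 2 \<le> s \<le> r\<close>; this replaces the mean value property on discs.\<close>

lemma square_mean_bound:
  assumes g: "g holomorphic_on upper_half_plane" and r: "0 < r" "r < Im z"
  shows "ennreal (cmod (g z) * r\<^sup>2) \<le> 3 * (\<integral>\<^sup>+s. ennreal (cmod (g s)) *
      indicator (cbox (z - Complex r r) (z + Complex r r)) s \<partial>hpm)"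
proof -
  define x0 y0 where "x0 = Re z" and "y0 = Im z"
  have z: "z = Complex x0 y0" by (simp add: x0_def y0_def)
  have yr: "r < y0" using r by (simp add: y0_def)
  define Q where "Q = cbox (z - Complex r r) (z + Complex r r)"
  have Q: "Complex x y \<in> Q \<longleftrightarrow> \<bar>x - x0\<bar> \<le> r \<and> \<bar>y - y0\<bar> \<le> r" for x y
    by (auto simp: Q_def in_cbox_complex_iff z)
  have Qsub: "Q \<subseteq> upper_half_plane"
    using r by (auto simp: Q_def in_cbox_complex_iff upper_half_plane_def)
  have contg: "continuous_on Q g"
    using holomorphic_on_imp_continuous_on[OF holomorphic_on_subset[OF g Qsub]] .
  define G where "G = (\<lambda>s. ennreal (indicator Q s *\<^sub>R cmod (g s)))"
  have G_eq: "G s = ennreal (cmod (g s)) * indicator Q s" for s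
    by (auto simp: G_def indicator_def)
  have G[measurable]: "G \<in> borel_measurable borel"
    unfolding G_def
    by (intro measurable_compose[OF _ measurable_ennreal] borel_measurable_continuous_on_indicator)
       (auto simp: Q_def intro!: continuous_intros contg[unfolded Q_def])
  \<comment> \<open>Row and column integrals of |g| over the square; integrating either once more
    gives \<open>I\<close>.\<close>
  define H V where "H = (\<lambda>y. \<integral>\<^sup>+x. G (Complex x y) \<partial>lborel)" and "V = (\<lambda>x. \<integral>\<^sup>+y. G (Complex x y) \<partial>lborel)"
  have [measurable]: "H \<in> borel_measurable borel" "V \<in> borel_measurable borel"
    unfolding H_def V_def by measurable
  define I where "I = (\<integral>\<^sup>+s. G s \<partial>hpm)"
  have IH: "(\<integral>\<^sup>+y. H y \<partial>lborel) = I"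
  proof -
    have "H y * indicator {0<..} y = H y" for y
    proof (cases "y > 0")
      case False
      then have "G (Complex x y) = 0" for x
        using Qsub by (auto simp: G_def indicator_def upper_half_plane_def)
      then show ?thesis by (simp add: H_def)
    qed simp
    then show ?thesis
      unfolding I_def by (subst nn_integral_hpm) (simp_all add: H_def)
  qed
  have IV: "(\<integral>\<^sup>+x. V x \<partial>lborel) = I"
    unfolding IH[symmetric] H_def V_def
    by (rule lborel_pair.Fubini') measurable
  \<comment> \<open>As s \<ge> r / 2, the Cauchy kernel is at most 2 / r on the boundary, and each
    edge is controlled by a full row or column of the large square.\<close>
  have edge: "ennreal (pi * r * cmod (g z)) \<le> H (y0 - s) + V (x0 + s) + H (y0 + s) + V (x0 - s)"
    if s: "r / 2 \<le> s" "s \<le> r" for s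
  proof -
    let ?f = "\<lambda>\<zeta>. g \<zeta> / (\<zeta> - z) ^ Suc 0"
    let ?p = "rectpath (Complex (x0 - s) (y0 - s)) (Complex (x0 + s) (y0 + s))"
    have s0: "s > 0" using s r by linarith
    have pim: "path_image ?p \<subseteq> Q - {z}"
      using s s0 by (subst path_image_rectpath_cbox_minus_box)
        (auto simp: in_cbox_complex_iff in_box_complex_iff Q_def z)
    have contf: "continuous_on (Q - {z}) ?f"
      by (intro continuous_intros continuous_on_subset[OF contg]) auto
    have bound: "ennreal (cmod (?f (Complex x y))) \<le> ennreal (2 / r) * G (Complex x y)"
      if "Complex x y \<in> Q" "\<bar>x - x0\<bar> = s \<or> \<bar>y - y0\<bar> = s" for x y
    proof -
      have "s \<le> cmod (Complex x y - z)"
        using that(2) abs_Re_le_cmod[of "Complex x y - z"] abs_Im_le_cmod[of "Complex x y - z"]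
        by (auto simp: z)
      then have "r / 2 \<le> cmod (Complex x y - z)" using s by linarith
      then have "cmod (g (Complex x y)) / cmod (Complex x y - z) \<le> cmod (g (Complex x y)) / (r / 2)"
        using r s0 by (intro divide_left_mono mult_pos_pos) auto
      then show ?thesis
        using that(1) r by (auto simp: G_def norm_divide ennreal_mult'[symmetric] mult.commute intro!: ennreal_leI)
    qed
    have hor: "ennreal (cmod (integral {x0 - s..x0 + s} (\<lambda>x. ?f (Complex x y)))) \<le> ennreal (2 / r) * H y"
      if "\<bar>y - y0\<bar> = s" for y
    proof -
      have "ennreal (cmod (integral {x0 - s..x0 + s} (\<lambda>x. ?f (Complex x y)))) \<le> (\<integral>\<^sup>+x. ennreal (2 / r) * G (Complex x y) \<partial>lborel)"
      proof (rule norm_integral_le_nn_integral)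
        show "continuous_on {x0 - s..x0 + s} (\<lambda>x. ?f (Complex x y))"
          by (rule continuous_on_compose2[OF contf])
             (use that s s0 in \<open>auto simp: Q z abs_le_iff complex_eq_iff intro!: continuous_intros\<close>)
      qed (rule bound, use that s in \<open>auto simp: Q\<close>)
      then show ?thesis by (subst (asm) nn_integral_cmult) (auto simp: H_def)
    qed
    have ver: "ennreal (cmod (integral {y0 - s..y0 + s} (\<lambda>y. ?f (Complex x y)))) \<le> ennreal (2 / r) * V x"
      if "\<bar>x - x0\<bar> = s" for x
    proof -
      have "ennreal (cmod (integral {y0 - s..y0 + s} (\<lambda>y. ?f (Complex x y)))) \<le> (\<integral>\<^sup>+y. ennreal (2 / r) * G (Complex x y) \<partial>lborel)"
      proof (rule norm_integral_le_nn_integral)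
        show "continuous_on {y0 - s..y0 + s} (\<lambda>y. ?f (Complex x y))"
          by (rule continuous_on_compose2[OF contf])
             (use that s s0 in \<open>auto simp: Q z abs_le_iff complex_eq_iff intro!: continuous_intros\<close>)
      qed (rule bound, use that s in \<open>auto simp: Q\<close>)
      then show ?thesis by (subst (asm) nn_integral_cmult) (auto simp: V_def)
    qed
    have "contour_integral ?p ?f = 2 * pi * \<i> * ((deriv ^^ 0) g z / fact 0)"
      by (rule Cauchy_rectpath[OF g]) (use s s0 yr in \<open>auto simp: in_box_complex_iff z\<close>)
    then have "2 * pi * cmod (g z) = cmod (contour_integral ?p ?f)"
      by (simp add: norm_mult)
    also have "ennreal \<dots> \<le> ennreal (2 / r) * H (y0 - s) + ennreal (2 / r) * V (x0 + s)
        + ennreal (2 / r) * H (y0 + s) + ennreal (2 / r) * V (x0 - s)"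
      by (subst contour_integral_rectpath)
         (use s0 in \<open>auto intro!: ennreal_cmod_diff_sum_le hor[simplified] ver[simplified] continuous_on_subset[OF contf[simplified] pim]\<close>)
    also have "\<dots> = ennreal (2 / r) * (H (y0 - s) + V (x0 + s) + H (y0 + s) + V (x0 - s))"
      by (simp add: distrib_left)
    finally have "ennreal (r / 2) * ennreal (2 * pi * cmod (g z))
       \<le> ennreal (r / 2) * (ennreal (2 / r) * (H (y0 - s) + V (x0 + s) + H (y0 + s) + V (x0 - s)))"
      by (intro mult_left_mono) auto
    also have "\<dots> = H (y0 - s) + V (x0 + s) + H (y0 + s) + V (x0 - s)"
      using r by (simp add: mult.assoc[symmetric] ennreal_mult'[symmetric])
    finally show ?thesis
      using r by (simp add: ennreal_mult'[symmetric] mult_ac)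
  qed
  have shift: "(\<integral>\<^sup>+s. h (c + s) \<partial>lborel) = (\<integral>\<^sup>+y. h y \<partial>lborel)" "(\<integral>\<^sup>+s. h (c - s) \<partial>lborel) = (\<integral>\<^sup>+y. h y \<partial>lborel)"
    if [measurable]: "h \<in> borel_measurable borel" for h :: "real \<Rightarrow> ennreal" and c
    using nn_integral_real_affine[of h 1 c] nn_integral_real_affine[of h "-1" c] by simp_all
  \<comment> \<open>The interval of admissible s has length r / 2. By nonnegativity the right-hand
    side may be integrated over all real s, which turns each of its four terms into
    \<open>I\<close>. The outcome is |g(z)| r^2 \<le> (8 / pi) I, and 8 / pi < 3.\<close>
  have "ennreal (pi * r * cmod (g z)) * ennreal (r / 2)
      = (\<integral>\<^sup>+s. ennreal (pi * r * cmod (g z)) * indicator {r/2..r} s \<partial>lborel)"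
    using r by (simp add: nn_integral_cmult_indicator)
  also have "\<dots> \<le> (\<integral>\<^sup>+s. H (y0 - s) + V (x0 + s) + H (y0 + s) + V (x0 - s) \<partial>lborel)"
    using edge by (intro nn_integral_mono) (auto simp: indicator_def)
  also have "\<dots> = 4 * I"
  proof -
    have "I + I + I + I = (1 + 1 + 1 + 1) * I"
      by (simp only: distrib_right mult_1_left)
    then have "4 * I = I + I + I + I"
      by simp
    then show ?thesis by (simp add: nn_integral_cmult nn_integral_add shift IH IV)
  qed
  finally have "ennreal (pi * (cmod (g z) * r\<^sup>2) / 2) \<le> 4 * I"
    using r by (simp add: ennreal_mult'[symmetric] power2_eq_square mult_ac)
  then have "ennreal (2 / pi) * ennreal (pi * (cmod (g z) * r\<^sup>2) / 2) \<le> ennreal (2 / pi) * (4 * I)"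
    by (rule mult_left_mono) simp
  also have "\<dots> = ennreal (8 / pi) * I"
    by (simp add: mult.assoc[symmetric] ennreal_mult'[symmetric] flip: ennreal_numeral)
  also have "\<dots> \<le> ennreal 3 * I"
    using pi_gt3 by (intro mult_right_mono ennreal_leI) (auto simp: divide_simps)
  finally show ?thesis
    by (simp add: I_def G_eq Q_def ennreal_mult'[symmetric])
qed

section \<open>Reproducing formulas from Cauchy's formula on horizontal lines\<close>

lemma set_integral_FTC_Ioi:
  fixes F f :: "real \<Rightarrow> complex"
  assumes D: "\<And>y. y > 0 \<Longrightarrow> (F has_vector_derivative f y) (at y)"
    and c: "\<And>y. y > 0 \<Longrightarrow> isCont f y"
    and i: "set_integrable lborel {0<..} f"
    and A: "(F \<longlongrightarrow> A) (at_right 0)" and B: "(F \<longlongrightarrow> B) at_top"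
  shows "(LINT y:{0<..}|lborel. f y) = B - A"
proof -
  have e: "einterval 0 \<infinity> = {0<..}"
    by (auto simp: einterval_def)
  have "(LBINT y=0..\<infinity>. f y) = B - A"
  proof (rule interval_integral_FTC_integrable[where F = F])
    show "((F \<circ> real_of_ereal) \<longlongrightarrow> A) (at_right 0)"
      unfolding zero_ereal_def using A by (simp add: ereal_tendsto_simps)
    show "((F \<circ> real_of_ereal) \<longlongrightarrow> B) (at_left \<infinity>)"
      using B by (simp add: ereal_tendsto_simps)
  qed (use D c i in \<open>auto simp: e\<close>)
  then show ?thesis
    by (simp add: interval_lebesgue_integral_def e)
qed

lemma integrable_Cauchy_density:
  fixes u s :: real
  assumes "s > 0"
  shows "integrable lborel (\<lambda>x. 1 / ((x - u)\<^sup>2 + s\<^sup>2))"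
  using nn_integral_Cauchy_density[OF assms, of u] by (intro integrableI_nonneg) auto

text \<open>The contour is closed upwards, where g is bounded by \<open>M / y\<close>. For n \<ge> 1
  the kernel decays at least quadratically, so on rectangles of width 2 m and height m the vertical
  edges and the top edge contribute O(1 / m).\<close>

lemma line_Cauchy:
  assumes g: "g holomorphic_on upper_half_plane" and M: "\<And>z. Im z > 0 \<Longrightarrow> cmod (g z) \<le> M / Im z"
    and y: "0 < y" "y < Im p" and n: "n \<ge> 1"
  shows "(LINT x|lborel. g (Complex x y) / (Complex x y - p) ^ Suc n) = 2 * pi * \<i> * ((deriv ^^ n) g p / fact n)"
proof -
  define u d B where "u = Re p" and "d = Im p - y" and "B = M / y"
  have d: "d > 0" using y by (simp add: d_def)
  have M0: "M \<ge> 0"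
    using order_trans[OF norm_ge_zero M[of \<i>]] by simp
  have B0: "B \<ge> 0" using M0 y by (simp add: B_def)
  have B: "cmod (g (Complex x t)) \<le> B" if "t \<ge> y" for x t
  proof -
    have "cmod (g (Complex x t)) \<le> M / t"
      using M[of "Complex x t"] that y by simp
    also have "\<dots> \<le> M / y"
      using that y M0 by (intro divide_left_mono) auto
    finally show ?thesis by (simp add: B_def)
  qed
  let ?h = "\<lambda>s. g s / (s - p) ^ Suc n"
  let ?f = "\<lambda>x. ?h (Complex x y)"
  let ?c = "2 * pi * \<i> * ((deriv ^^ n) g p / fact n)"
  have conth: "continuous_on (upper_half_plane - {p}) ?h"
    by (intro holomorphic_on_imp_continuous_on holomorphic_intros holomorphic_on_subset[OF g]) auto
  have contf: "continuous_on UNIV ?f"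
    by (rule continuous_on_compose2[OF conth])
       (use y in \<open>auto simp: upper_half_plane_def complex_eq_iff intro!: continuous_intros\<close>)
  \<comment> \<open>The condition \<open>r \<ge> 1\<close> reduces every exponent
    \<open>Suc n\<close> to 2.\<close>
  have hbound: "cmod (?h (Complex x t)) \<le> B / r\<^sup>2" if "t \<ge> y" "r \<ge> 1" "r \<le> cmod (Complex x t - p)" for x t r
  proof -
    have "r\<^sup>2 \<le> r ^ Suc n"
      using that n by (intro power_increasing) auto
    also have "\<dots> \<le> cmod (Complex x t - p) ^ Suc n"
      using that by (intro power_mono) auto
    finally have "r\<^sup>2 \<le> cmod (Complex x t - p) ^ Suc n" .
    then have "cmod (g (Complex x t)) / cmod (Complex x t - p) ^ Suc n \<le> B / r\<^sup>2"
      using B[OF that(1), of x] that B0 by (intro frac_le) auto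
    then show ?thesis by (simp add: norm_divide norm_power norm_mult)
  qed
  have fint: "integrable lborel ?f"
  proof (rule Bochner_Integration.integrable_bound)
    show "integrable lborel (\<lambda>x. B / d ^ (n - 1) * (1 / ((x - u)\<^sup>2 + d\<^sup>2)))"
      by (intro integrable_mult_right integrable_Cauchy_density d)
    show "?f \<in> borel_measurable lborel"
      using contf by (simp add: borel_measurable_continuous_onI)
    show "AE x in lborel. norm (?f x) \<le> norm (B / d ^ (n - 1) * (1 / ((x - u)\<^sup>2 + d\<^sup>2)))"
    proof (intro AE_I2)
      fix x
      let ?q = "Complex x y - p"
      have q: "(cmod ?q)\<^sup>2 = (x - u)\<^sup>2 + d\<^sup>2"
        by (simp add: cmod_power2 u_def d_def power2_commute)
      have dq: "d \<le> cmod ?q"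
        using abs_Im_le_cmod[of ?q] y by (simp add: d_def)
      have "d ^ (n - 1) * ((x - u)\<^sup>2 + d\<^sup>2) \<le> cmod ?q ^ (n - 1) * (cmod ?q)\<^sup>2"
        unfolding q using dq d by (intro mult_right_mono power_mono) auto
      also have "\<dots> = cmod ?q ^ Suc n"
        using n by (simp add: power_add[symmetric])
      finally have "cmod (g (Complex x y)) / cmod ?q ^ Suc n \<le> B / (d ^ (n - 1) * ((x - u)\<^sup>2 + d\<^sup>2))"
        using B[of y x] B0 d by (intro frac_le mult_pos_pos add_nonneg_pos) auto
      then show "norm (?f x) \<le> norm (B / d ^ (n - 1) * (1 / ((x - u)\<^sup>2 + d\<^sup>2)))"
        using B0 d by (simp add: norm_divide norm_power norm_mult)
    qed
  qed
  let ?I = "\<lambda>m::nat. integral {u - real m..u + real m} ?f"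
  have lim1: "?I \<longlonglongrightarrow> (LINT x|lborel. ?f x)"
  proof -
    have eq: "?I m = (LINT x|lborel. indicator {u - real m..u + real m} x *\<^sub>R ?f x)" for m
      unfolding set_lebesgue_integral_def[symmetric]
      by (rule set_borel_integral_eq_integral(2)[symmetric], rule borel_integrable_atLeastAtMost')
         (rule continuous_on_subset[OF contf], simp)
    show ?thesis
      unfolding eq
    proof (rule integral_dominated_convergence[where w = "\<lambda>x. norm (?f x)"])
      show "AE x in lborel. (\<lambda>m. indicator {u - real m..u + real m} x *\<^sub>R ?f x) \<longlonglongrightarrow> ?f x"
      proof (intro AE_I2 tendsto_eventually)
        fix x
        obtain N where N: "\<bar>x - u\<bar> \<le> real N" using real_arch_simple by blast
        show "\<forall>\<^sub>F m in sequentially. indicator {u - real m..u + real m} x *\<^sub>R ?f x = ?f x"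
          using eventually_ge_at_top[of N]
        proof eventually_elim
          case (elim m)
          then have "\<bar>x - u\<bar> \<le> real m" using N by linarith
          then show ?case by (auto simp: indicator_def)
        qed
      qed
    qed (use fint in \<open>auto simp: indicator_def\<close>)
  qed
  have lim2: "?I \<longlonglongrightarrow> ?c"
  proof (rule LIM_zero_cancel, rule Lim_null_comparison)
    show "(\<lambda>m. 2 * B / real m + 2 * real m * B / (real m - d)\<^sup>2) \<longlonglongrightarrow> 0"
      by real_asymp
    \<comment> \<open>For m \<ge> N the pole is inside the rectangle and the top edge lies m - d
      \<ge> 1 above it, as \<open>hbound\<close> requires.\<close>
    obtain N where N: "d + 1 < real N" using reals_Archimedean2 by blast
    show "\<forall>\<^sub>F m in sequentially. norm (?I m - ?c) \<le> 2 * B / real m + 2 * real m * B / (real m - d)\<^sup>2"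
      using eventually_ge_at_top[of N]
    proof eventually_elim
      case (elim m)
      define R where "R = real m"
      have R: "R \<ge> 1" "R - d \<ge> 1" "R > 0" using elim N d by (auto simp: R_def)
      let ?p = "rectpath (Complex (u - R) y) (Complex (u + R) (y + R))"
      have pim: "path_image ?p \<subseteq> upper_half_plane - {p}"
        using R d y by (subst path_image_rectpath_cbox_minus_box)
          (auto simp: in_cbox_complex_iff in_box_complex_iff upper_half_plane_def u_def d_def)
      have vert: "norm (integral {y..y + R} (\<lambda>t. ?h (Complex x t))) \<le> B / R"
        if "\<bar>x - u\<bar> = R" for x
      proof -
        have "norm (integral {y..y + R} (\<lambda>t. ?h (Complex x t))) \<le> B / R\<^sup>2 * (y + R - y)"
        proof (rule integral_bound)
          show "continuous_on {y..y + R} (\<lambda>t. ?h (Complex x t))"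
            by (rule continuous_on_compose2[OF conth])
               (use that R y in \<open>auto simp: upper_half_plane_def complex_eq_iff u_def intro!: continuous_intros\<close>)
          show "norm (?h (Complex x t)) \<le> B / R\<^sup>2" if "t \<in> {y..y + R}" for t
            using that R \<open>\<bar>x - u\<bar> = R\<close> abs_Re_le_cmod[of "Complex x t - p"] by (intro hbound) (auto simp: u_def)
        qed (use R in auto)
        then show ?thesis using R by (simp add: power2_eq_square)
      qed
      have top: "norm (integral {u - R..u + R} (\<lambda>x. ?h (Complex x (y + R)))) \<le> 2 * R * B / (R - d)\<^sup>2"
      proof -
        have "norm (integral {u - R..u + R} (\<lambda>x. ?h (Complex x (y + R)))) \<le> B / (R - d)\<^sup>2 * (u + R - (u - R))"
        proof (rule integral_bound)
          show "continuous_on {u - R..u + R} (\<lambda>x. ?h (Complex x (y + R)))"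
            by (rule continuous_on_compose2[OF conth])
               (use R y in \<open>auto simp: upper_half_plane_def complex_eq_iff d_def intro!: continuous_intros\<close>)
          show "norm (?h (Complex x (y + R))) \<le> B / (R - d)\<^sup>2" if "x \<in> {u - R..u + R}" for x
            using that R abs_Im_le_cmod[of "Complex x (y + R) - p"] by (intro hbound) (auto simp: d_def)
        qed (use R in auto)
        then show ?thesis by (simp add: mult_ac)
      qed
      have "contour_integral ?p ?h = ?c"
        by (rule Cauchy_rectpath[OF g]) (use R d y in \<open>auto simp: in_box_complex_iff u_def d_def\<close>)
      moreover have "contour_integral ?p ?h = integral {u - R..u + R} ?f
          + \<i> * integral {y..y + R} (\<lambda>t. ?h (Complex (u + R) t))
          - integral {u - R..u + R} (\<lambda>x. ?h (Complex x (y + R)))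
          - \<i> * integral {y..y + R} (\<lambda>t. ?h (Complex (u - R) t))"
        by (rule contour_integral_rectpath[OF continuous_on_subset[OF conth pim]]) (use R in auto)
      ultimately have "?I m - ?c = integral {u - R..u + R} (\<lambda>x. ?h (Complex x (y + R)))
          + \<i> * integral {y..y + R} (\<lambda>t. ?h (Complex (u - R) t)) - \<i> * integral {y..y + R} (\<lambda>t. ?h (Complex (u + R) t))"
        by (simp add: R_def algebra_simps)
      also have "norm \<dots> \<le> 2 * R * B / (R - d)\<^sup>2 + B / R + B / R"
        by (rule order_trans[OF norm_triangle_ineq4] order_trans[OF norm_triangle_ineq] add_mono)+
           (use R top vert in \<open>auto simp: norm_mult\<close>)
      finally show ?case by (simp add: R_def add_ac)
    qed
  qed
  show ?thesis by (rule LIMSEQ_unique[OF lim1 lim2])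
qed

text \<open>On the line at height y one has cnj s = s - 2 \<i> y. The antiholomorphic kernel thus
  becomes holomorphic in s, with its pole at z + 2 \<i> y, above the line.\<close>

lemma line_Cauchy_cnj:
  assumes g: "g holomorphic_on upper_half_plane" and M: "\<And>z. Im z > 0 \<Longrightarrow> cmod (g z) \<le> M / Im z"
    and y: "0 < y" and z: "0 < Im z" and n: "n \<ge> 1"
  shows "(LINT x|lborel. g (Complex x y) / (cnj (Complex x y) - z) ^ Suc n)
       = 2 * pi * \<i> * ((deriv ^^ n) g (z + of_real (2 * y) * \<i>) / fact n)"
proof -
  have eq: "cnj (Complex x y) - z = Complex x y - (z + of_real (2 * y) * \<i>)" for x
    by (simp add: complex_eq_iff)
  show ?thesis
    unfolding eq by (rule line_Cauchy[OF g M y _ n]) (use y z in auto)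
qed

text \<open>Cauchy's inequality on the disc of radius \<open>Im z / 2\<close>, where |g| is at most
  \<open>2 * M / Im z\<close>.\<close>

lemma deriv_bound_half_plane:
  assumes g: "g holomorphic_on upper_half_plane" and M: "\<And>z. Im z > 0 \<Longrightarrow> cmod (g z) \<le> M / Im z"
    and z: "Im z > 0"
  shows "cmod (deriv g z) \<le> 4 * M / (Im z)\<^sup>2"
proof -
  have M0: "M \<ge> 0"
    using order_trans[OF norm_ge_zero M[of \<i>]] by simp
  have sub: "Im w \<ge> Im z / 2" if "dist z w \<le> Im z / 2" for w
    using that abs_Im_le_cmod[of "z - w"] by (simp add: dist_norm)
  have U: "cball z (Im z / 2) \<subseteq> upper_half_plane"
    using sub z by (fastforce simp: upper_half_plane_def)
  have "cmod ((deriv ^^ 1) g z) \<le> fact 1 * (2 * M / Im z) / (Im z / 2) ^ 1"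
  proof (rule Cauchy_inequality)
    show "g holomorphic_on ball z (Im z / 2)"
      using U by (intro holomorphic_on_subset[OF g]) auto
    show "continuous_on (cball z (Im z / 2)) g"
      using U by (intro holomorphic_on_imp_continuous_on holomorphic_on_subset[OF g])
    fix x assume "cmod (z - x) = Im z / 2"
    then have x: "Im x \<ge> Im z / 2" using sub[of x] by (simp add: dist_norm)
    then have "cmod (g x) \<le> M / Im x" using z by (intro M) linarith
    also have "\<dots> \<le> M / (Im z / 2)"
      using x z M0 by (intro divide_left_mono) auto
    finally show "cmod (g x) \<le> 2 * M / Im z" by (simp add: mult.commute)
  qed (use z in auto)
  then show ?thesis by (simp add: power2_eq_square)
qed

lemma tendsto_0_vertical:
  assumes M: "\<And>z. Im z > 0 \<Longrightarrow> cmod (g z) \<le> M / Im z" and z: "Im z > 0"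
  shows "((\<lambda>y. g (z + of_real (2 * y) * \<i>)) \<longlongrightarrow> 0) at_top"
proof (rule Lim_null_comparison)
  show "\<forall>\<^sub>F y in at_top. norm (g (z + of_real (2 * y) * \<i>)) \<le> M / (Im z + 2 * y)"
    using eventually_ge_at_top[of 0]
    by eventually_elim (use M[of "z + of_real (2 * _) * \<i>"] z in simp)
  show "((\<lambda>y. M / (Im z + 2 * y)) \<longlongrightarrow> 0) at_top" by real_asymp
qed

lemma has_vector_derivative_vertical:
  assumes g: "g holomorphic_on upper_half_plane" and z: "Im (z + of_real (2 * y) * \<i>) > 0"
  shows "((\<lambda>y. g (z + of_real (2 * y) * \<i>)) has_vector_derivative (2 * \<i> * deriv g (z + of_real (2 * y) * \<i>))) (at y)"
proof -
  have "((\<lambda>y. z + of_real (2 * y) * \<i>) has_vector_derivative (2 * \<i>)) (at y)"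
    by (auto intro!: derivative_eq_intros)
  moreover have "(g has_field_derivative deriv g (z + of_real (2 * y) * \<i>)) (at (z + of_real (2 * y) * \<i>))"
    by (rule holomorphic_derivI[OF g open_upper_half_plane]) (use z in \<open>auto simp: upper_half_plane_def\<close>)
  ultimately show ?thesis
    using field_vector_diff_chain_at[of "\<lambda>y. z + of_real (2 * y) * \<i>" "2 * \<i>" y g] by (simp add: o_def)
qed

lemma isCont_vertical:
  assumes g: "g holomorphic_on upper_half_plane" and z: "Im (z + of_real (2 * y) * \<i>) > 0"
  shows "isCont (\<lambda>y. g (z + of_real (2 * y) * \<i>)) y"
  using has_vector_derivative_vertical[OF assms] by (rule has_vector_derivative_continuous)

text \<open>The line at height y contributes 2 pi \<i> g'(z + 2 \<i> y), which is the y-derivative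
  of pi g(z + 2 \<i> y). Integration over y leaves the boundary values: 0 at infinity, by the growth
  of g, and pi g(z) at y = 0.\<close>

lemma Bergman_reproducing:
  fixes g :: "complex \<Rightarrow> complex"
  assumes g: "g holomorphic_on upper_half_plane" and M: "\<And>z. Im z > 0 \<Longrightarrow> cmod (g z) \<le> M / Im z"
    and z: "Im z > 0" and int: "integrable hpm (\<lambda>s. g s / (cnj s - z)\<^sup>2)"
  shows "(LINT s|hpm. g s / (cnj s - z)\<^sup>2) = - pi * g z"
proof -
  let ?f = "\<lambda>y. 2 * pi * \<i> * deriv g (z + of_real (2 * y) * \<i>)"
  have line: "(LINT x|lborel. g (Complex x y) / (cnj (Complex x y) - z)\<^sup>2) = ?f y" if "y > 0" for y
    using line_Cauchy_cnj[OF g M that z, of 1] by (simp add: numeral_2_eq_2)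
  have g': "deriv g holomorphic_on upper_half_plane"
    by (intro holomorphic_deriv g open_upper_half_plane)
  have pos: "Im (z + of_real (2 * y) * \<i>) > 0" if "y \<ge> 0" for y
    using that z by simp
  have "(LINT s|hpm. g s / (cnj s - z)\<^sup>2) = (LINT y:{0<..}|lborel. ?f y)"
    unfolding integral_hpm[OF int]
    by (intro set_lebesgue_integral_cong) (auto simp: line[unfolded Complex_eq] line)
  also have "\<dots> = 0 - pi * g z"
  proof (rule set_integral_FTC_Ioi[where F = "\<lambda>y. pi * g (z + of_real (2 * y) * \<i>)"])
    show "((\<lambda>y. pi * g (z + of_real (2 * y) * \<i>)) has_vector_derivative ?f y) (at y)" if "y > 0" for y
    proof -
      have "((\<lambda>y. pi * g (z + of_real (2 * y) * \<i>)) has_vector_derivative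
          pi * (2 * \<i> * deriv g (z + of_real (2 * y) * \<i>))) (at y)"
        using that by (intro has_vector_derivative_mult_right has_vector_derivative_vertical[OF g pos]) auto
      then show ?thesis by (simp add: mult_ac)
    qed
    show "isCont ?f y" if "y > 0" for y
      using that by (intro continuous_intros isCont_vertical[OF g' pos]) auto
    show "set_integrable lborel {0<..} ?f"
      by (rule iffD1[OF set_integrable_cong[OF refl refl] set_integrable_hpm_lines[OF int]])
         (rule line, simp)
    show "((\<lambda>y. pi * g (z + of_real (2 * y) * \<i>)) \<longlongrightarrow> pi * g z) (at_right 0)"
    proof -
      have "isCont (\<lambda>y. pi * g (z + of_real (2 * y) * \<i>)) 0"
        by (intro continuous_intros isCont_vertical[OF g pos]) auto
      then show ?thesis
        by (auto simp: isCont_def intro: tendsto_mono[OF at_le, of "{0<..}"])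
    qed
    show "((\<lambda>y. pi * g (z + of_real (2 * y) * \<i>)) \<longlongrightarrow> 0) at_top"
      by (rule tendsto_mult_right_zero[OF tendsto_0_vertical[OF M z]])
  qed
  finally show ?thesis by simp
qed

text \<open>The weight is the constant y on each line, so the line contributes pi \<i> y g''(z + 2
  \<i> y). Integration by parts yields the primitive \<open>?F\<close>; at infinity y g' vanishes by
  \<open>deriv_bound_half_plane\<close>, and at 0 only g(z) / 4 survives. With g = b' this evaluates
  the bracket of a test function.\<close>

lemma weighted_reproducing:
  fixes g :: "complex \<Rightarrow> complex"
  assumes g: "g holomorphic_on upper_half_plane" and M: "\<And>z. Im z > 0 \<Longrightarrow> cmod (g z) \<le> M / Im z"
    and z: "Im z > 0" and int: "integrable hpm (\<lambda>s. g s * of_real (Im s) / (cnj s - z) ^ 3)"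
  shows "(LINT s|hpm. g s * of_real (Im s) / (cnj s - z) ^ 3) = - \<i> * pi / 4 * g z"
proof -
  let ?p = "\<lambda>y. z + of_real (2 * y) * \<i>"
  let ?f = "\<lambda>y. pi * \<i> * of_real y * deriv (deriv g) (?p y)"
  let ?F = "\<lambda>y. pi * \<i> * (of_real y * deriv g (?p y) / (2 * \<i>) + g (?p y) / 4)"
  have g': "deriv g holomorphic_on upper_half_plane" "deriv (deriv g) holomorphic_on upper_half_plane"
    by (intro holomorphic_deriv g open_upper_half_plane)+
  have pos: "Im (?p y) > 0" if "y \<ge> 0" for y
    using that z by simp
  have line: "(LINT x|lborel. g (Complex x y) * of_real (Im (Complex x y)) / (cnj (Complex x y) - z) ^ 3) = ?f y"
    if "y > 0" for y
  proof -
    have "(LINT x|lborel. g (Complex x y) * of_real (Im (Complex x y)) / (cnj (Complex x y) - z) ^ 3)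
        = (LINT x|lborel. of_real y * (g (Complex x y) / (cnj (Complex x y) - z) ^ Suc 2))"
      by (simp add: numeral_3_eq_3 mult_ac numeral_2_eq_2)
    also have "\<dots> = of_real y * (2 * pi * \<i> * ((deriv ^^ 2) g (?p y) / fact 2))"
      by (subst integral_mult_right_zero, subst line_Cauchy_cnj[OF g M that z]) auto
    finally show ?thesis by (simp add: numeral_2_eq_2 mult_ac)
  qed
  have "(LINT s|hpm. g s * of_real (Im s) / (cnj s - z) ^ 3) = (LINT y:{0<..}|lborel. ?f y)"
    unfolding integral_hpm[OF int]
    by (intro set_lebesgue_integral_cong) (use line in auto)
  also have "\<dots> = 0 - pi * \<i> * (g z / 4)"
  proof (rule set_integral_FTC_Ioi[where F = ?F])
    show "(?F has_vector_derivative ?f y) (at y)" if "y > 0" for y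
    proof -
      have "(?F has_vector_derivative pi * \<i> * ((of_real y * (2 * \<i> * deriv (deriv g) (?p y)) + of_real 1 * deriv g (?p y)) / (2 * \<i>)
          + (2 * \<i> * deriv g (?p y)) / 4)) (at y)"
        using that
        by (intro has_vector_derivative_mult_right has_vector_derivative_add has_vector_derivative_divide has_vector_derivative_mult
            has_vector_derivative_vertical[OF g pos] has_vector_derivative_vertical[OF g'(1) pos]
            has_vector_derivative_of_real DERIV_ident) auto
      then show ?thesis by (simp add: field_simps)
    qed
    show "isCont ?f y" if "y > 0" for y
      using that by (intro continuous_intros isCont_vertical[OF g'(2) pos]) auto
    show "set_integrable lborel {0<..} ?f"
      by (rule iffD1[OF set_integrable_cong[OF refl refl] set_integrable_hpm_lines[OF int]])
         (rule line, simp)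
    show "(?F \<longlongrightarrow> pi * \<i> * (g z / 4)) (at_right 0)"
    proof -
      have "isCont ?F 0"
        by (intro continuous_intros isCont_vertical[OF g pos] isCont_vertical[OF g'(1) pos]) auto
      then show ?thesis
        by (auto simp: isCont_def intro: tendsto_mono[OF at_le, of "{0<..}"])
    qed
    have "((\<lambda>y. of_real y * deriv g (?p y)) \<longlongrightarrow> 0) at_top"
    proof (rule Lim_null_comparison)
      show "\<forall>\<^sub>F y in at_top. norm (of_real y * deriv g (?p y)) \<le> y * (4 * M / (Im z + 2 * y)\<^sup>2)"
        using eventually_ge_at_top[of 0]
      proof eventually_elim
        case (elim y)
        then show ?case
          using mult_left_mono[OF deriv_bound_half_plane[OF g M pos[OF elim]] elim] by (simp add: norm_mult)
      qed
      show "((\<lambda>y. y * (4 * M / (Im z + 2 * y)\<^sup>2)) \<longlongrightarrow> 0) at_top" by real_asymp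
    qed
    then have "(?F \<longlongrightarrow> pi * \<i> * (0 / (2 * \<i>) + 0 / 4)) at_top"
      by (intro tendsto_intros tendsto_0_vertical[OF M z]) auto
    then show "(?F \<longlongrightarrow> 0) at_top" by simp
  qed
  finally show ?thesis by simp
qed

section \<open>The Bergman projection\<close>

lemma bergman_space_2_iff:
  "f \<in> bergman_space 2 \<longleftrightarrow> f holomorphic_on upper_half_plane \<and> integrable hpm (\<lambda>z. (cmod (f z))\<^sup>2)"
  by (simp add: bergman_space_def set_integrable_hpm)

lemma bergman_space_1_iff:
  "f \<in> bergman_space 1 \<longleftrightarrow> f holomorphic_on upper_half_plane \<and> integrable hpm f"
proof -
  have "integrable hpm (\<lambda>z. cmod (f z)) \<longleftrightarrow> integrable hpm f" if "f holomorphic_on upper_half_plane"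
    using integrable_norm_iff[OF borel_measurable_hpm_holomorphic[OF that]] .
  then show ?thesis
    by (auto simp: bergman_space_def set_integrable_hpm)
qed

lemma integrable_hpm_bound:
  fixes f :: "complex \<Rightarrow> 'a::{banach, second_countable_topology}" and g :: "complex \<Rightarrow> real"
  assumes "integrable hpm g" "f \<in> borel_measurable hpm" "\<And>z. Im z > 0 \<Longrightarrow> norm (f z) \<le> g z"
  shows "integrable hpm f"
  by (rule Bochner_Integration.integrable_bound[OF assms(1,2)], rule AE_I2)
     (use assms(3) in \<open>force simp: upper_half_plane_def\<close>)

lemma cmod_cnj_minus: "cmod (cnj s - z) = cmod (s - cnj z)"
  by (metis complex_cnj_cnj complex_cnj_diff complex_mod_cnj)

lemma cmod_cnj_minus': "cmod (cnj s - z) = cmod (z - cnj s)"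
  by (rule norm_minus_commute)

lemma cmod_cnj_minus_ge:
  assumes "Im s > 0" "Im z > 0"
  shows "Im s + Im z \<le> cmod (cnj s - z)" "cnj s - z \<noteq> 0"
  using cmod_minus_cnj_ge[OF assms(2,1)] assms by (auto simp: cmod_cnj_minus' complex_eq_iff)

text \<open>Take r = Im z / 2 in \<open>square_mean_bound\<close> and apply Cauchy-Schwarz on the
  square, whose area is 4 r^2: |f(z)| r^2 \<le> 3 * 2 r sqrt N. This supplies the growth hypothesis
  of \<open>Bergman_reproducing\<close>.\<close>

lemma bergman_space_2_growth:
  assumes f: "f \<in> bergman_space 2"
  obtains M where "\<And>z. Im z > 0 \<Longrightarrow> cmod (f z) \<le> M / Im z"
proof -
  have hol: "f holomorphic_on upper_half_plane" and int: "integrable hpm (\<lambda>z. (cmod (f z))\<^sup>2)"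
    using f by (auto simp: bergman_space_2_iff)
  note [measurable] = borel_measurable_hpm_holomorphic[OF hol]
  define N where "N = (LINT z|hpm. (cmod (f z))\<^sup>2)"
  have N: "(\<integral>\<^sup>+z. (ennreal (cmod (f z)))\<^sup>2 \<partial>hpm) = ennreal N"
    unfolding N_def using nn_integral_eq_integral[OF int] by (simp add: ennreal_power)
  have N0: "N \<ge> 0" by (simp add: N_def)
  have "cmod (f z) \<le> 12 * sqrt N / Im z" if z: "Im z > 0" for z
  proof -
    define r where "r = Im z / 2"
    have r: "0 < r" "r < Im z" using z by (auto simp: r_def)
    let ?Q = "cbox (z - Complex r r) (z + Complex r r)"
    have Q[measurable]: "(indicator ?Q :: complex \<Rightarrow> ennreal) \<in> borel_measurable hpm"
      by (intro measurable_hpm_borel) auto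
    have area: "(\<integral>\<^sup>+s. (indicator ?Q s)\<^sup>2 \<partial>hpm) \<le> ennreal (4 * r\<^sup>2)"
    proof -
      have "(\<integral>\<^sup>+s. (indicator ?Q s)\<^sup>2 \<partial>hpm) = (\<integral>\<^sup>+s. indicator ?Q s * indicator upper_half_plane s \<partial>lborel)"
        unfolding hpm_def by (subst nn_integral_restrict_space) (auto simp: indicator_def intro!: nn_integral_cong)
      also have "\<dots> \<le> (\<integral>\<^sup>+s. indicator ?Q s \<partial>lborel)"
        by (intro nn_integral_mono) (auto simp: indicator_def)
      also have "\<dots> = emeasure lborel ?Q" by simp
      also have "\<dots> = ennreal (4 * r\<^sup>2)"
        using r by (subst emeasure_lborel_cbox) (auto simp: Basis_complex_def power2_eq_square)
      finally show ?thesis .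
    qed
    define X where "X = (\<integral>\<^sup>+s. ennreal (cmod (f s)) * indicator ?Q s \<partial>hpm)"
    have "X\<^sup>2 \<le> (\<integral>\<^sup>+s. (ennreal (cmod (f s)))\<^sup>2 \<partial>hpm) * (\<integral>\<^sup>+s. (indicator ?Q s)\<^sup>2 \<partial>hpm)"
      unfolding X_def by (rule Cauchy_Schwarz_nn_integral) auto
    also have "\<dots> \<le> ennreal N * ennreal (4 * r\<^sup>2)"
      unfolding N by (intro mult_left_mono area) auto
    finally have X: "X\<^sup>2 \<le> ennreal (N * (4 * r\<^sup>2))"
      using N0 by (simp add: ennreal_mult')
    have "(ennreal (cmod (f z) * r\<^sup>2))\<^sup>2 \<le> (3 * X)\<^sup>2"
      using square_mean_bound[OF hol r] unfolding X_def by (intro power_mono) auto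
    also have "\<dots> = 9 * X\<^sup>2" by (simp add: power_mult_distrib)
    also have "\<dots> \<le> ennreal 9 * ennreal (N * (4 * r\<^sup>2))"
      using X by (simp add: mult_left_mono)
    also have "\<dots> = ennreal ((6 * sqrt N * r)\<^sup>2)"
      using N0 by (subst ennreal_mult'[symmetric]) (auto simp: power_mult_distrib)
    finally have "(cmod (f z) * r\<^sup>2)\<^sup>2 \<le> (6 * sqrt N * r)\<^sup>2"
      by (simp add: ennreal_power)
    then have "cmod (f z) * r\<^sup>2 \<le> 6 * sqrt N * r"
      by (rule power2_le_imp_le) (use N0 r in auto)
    then have "cmod (f z) * r \<le> 6 * sqrt N"
      using r by (simp add: power2_eq_square)
    then show ?thesis using z by (simp add: r_def field_simps)
  qed
  then show thesis by (rule that)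
qed

text \<open>As r = |cnj s - z| dominates both heights, r^4 \<ge> (Im z)^(3/2) (Im s)^(1/2) r^2, and
  \<open>nn_integral_Schur\<close> applies.\<close>

lemma integrable_kernel_square:
  assumes z: "Im z > 0"
  shows "integrable hpm (\<lambda>s. 1 / (cmod (cnj s - z)) ^ 4)"
proof -
  have "(\<integral>\<^sup>+s. ennreal (1 / sqrt (Im s) / (cmod (s - cnj z))\<^sup>2) \<partial>hpm) < \<infinity>"
    using nn_integral_Schur[OF z] by simp
  then have "integrable hpm (\<lambda>s. 1 / sqrt (Im s) / (cmod (s - cnj z))\<^sup>2)"
    by (intro integrableI_nonneg AE_I2) (auto simp: upper_half_plane_def intro!: measurable_hpm_borel)
  then have "integrable hpm (\<lambda>s. 1 / (Im z * sqrt (Im z)) * (1 / sqrt (Im s) / (cmod (s - cnj z))\<^sup>2))"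
    by (rule integrable_mult_right)
  then show ?thesis
  proof (rule integrable_hpm_bound)
    fix s assume s: "Im s > 0"
    define r where "r = cmod (s - cnj z)"
    have r: "Im s \<le> r" "Im z \<le> r" "r > 0"
      using cmod_minus_cnj_ge[OF s z] s z by (auto simp: r_def)
    have "Im z * (sqrt (Im z) * sqrt (Im s)) \<le> r * (sqrt r * sqrt r)"
      using r s z by (intro mult_mono) auto
    then have "Im z * sqrt (Im z) * sqrt (Im s) * r\<^sup>2 \<le> r * r * r\<^sup>2"
      using r by (intro mult_right_mono) auto
    moreover have "1 / r ^ 4 = 1 / (r * r * r\<^sup>2)"
      by (simp add: power2_eq_square eval_nat_numeral mult_ac)
    ultimately have "1 / r ^ 4 \<le> 1 / (Im z * sqrt (Im z) * sqrt (Im s) * r\<^sup>2)"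
      using r s z by (auto intro!: divide_left_mono mult_pos_pos)
    then show "norm (1 / (cmod (cnj s - z)) ^ 4) \<le> 1 / (Im z * sqrt (Im z)) * (1 / sqrt (Im s) / (cmod (s - cnj z))\<^sup>2)"
      by (simp add: cmod_cnj_minus r_def mult_ac)
  qed (intro measurable_hpm_borel, measurable)
qed

lemma integrable_kernel_L2:
  assumes [measurable]: "\<phi> \<in> borel_measurable hpm" and \<phi>: "integrable hpm (\<lambda>s. (cmod (\<phi> s))\<^sup>2)" and z: "Im z > 0"
  shows "integrable hpm (\<lambda>s. \<phi> s / (cnj s - z)\<^sup>2)"
proof (rule integrable_hpm_bound)
  show "integrable hpm (\<lambda>s. (cmod (\<phi> s))\<^sup>2 + 1 / (cmod (cnj s - z)) ^ 4)"
    by (intro Bochner_Integration.integrable_add \<phi> integrable_kernel_square z)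
  show "norm (\<phi> s / (cnj s - z)\<^sup>2) \<le> (cmod (\<phi> s))\<^sup>2 + 1 / (cmod (cnj s - z)) ^ 4" for s
  proof -
    define a c where "a = cmod (\<phi> s)" and "c = 1 / (cmod (cnj s - z))\<^sup>2"
    have "0 \<le> a * c" by (simp add: a_def c_def)
    then have "a * c \<le> a\<^sup>2 + c\<^sup>2"
      using sum_squares_bound[of a c] by linarith
    then show ?thesis
      by (simp add: a_def c_def norm_divide norm_power power_divide flip: power_mult)
  qed
qed measurable

lemma integrable_kernel_L1:
  assumes \<phi>: "integrable hpm \<phi>" and z: "Im z > 0"
  shows "integrable hpm (\<lambda>s. \<phi> s / (cnj s - z)\<^sup>2)"
proof (rule integrable_hpm_bound)
  note [measurable] = borel_measurable_integrable[OF \<phi>]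
  show "(\<lambda>s. \<phi> s / (cnj s - z)\<^sup>2) \<in> borel_measurable hpm" by measurable
  show "integrable hpm (\<lambda>s. cmod (\<phi> s) * (1 / (Im z)\<^sup>2))"
    using \<phi> by (intro integrable_mult_left integrable_norm)
  fix s assume s: "Im s > 0"
  have "(Im z)\<^sup>2 \<le> (cmod (cnj s - z))\<^sup>2"
    using cmod_cnj_minus_ge(1)[OF s z] s z by (intro power_mono) auto
  then have "cmod (\<phi> s) / (cmod (cnj s - z))\<^sup>2 \<le> cmod (\<phi> s) / (Im z)\<^sup>2"
    using cmod_cnj_minus_ge(2)[OF s z] z by (intro divide_left_mono mult_pos_pos) auto
  then show "norm (\<phi> s / (cnj s - z)\<^sup>2) \<le> cmod (\<phi> s) * (1 / (Im z)\<^sup>2)"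
    by (simp add: norm_divide norm_power)
qed

text \<open>An integral formula, because it has to make sense for integrable densities as well. The
  base \<open>cnj s - z\<close> agrees with the line formulas, and the square removes the difference
  in sign.\<close>

definition bergman_proj :: "(complex \<Rightarrow> complex) \<Rightarrow> complex \<Rightarrow> complex" where
  "bergman_proj \<phi> z = - 1 / of_real pi * (LINT s|hpm. \<phi> s / (cnj s - z)\<^sup>2)"

text \<open>The remainder is exactly h^2 (3 d - 2 h) / (d^3 (d - h)^2). The bounds |3 d - 2 h| \<le>
  4 |d| and |d - h| \<ge> |d| / 2 give 4 * 4 = 16.\<close>

lemma inverse_square_taylor_bound:
  fixes d h :: complex
  assumes "d \<noteq> 0" "2 * cmod h \<le> cmod d"
  shows "cmod (1 / (d - h)\<^sup>2 - 1 / d\<^sup>2 - 2 * h / d ^ 3) \<le> 16 * (cmod h)\<^sup>2 / cmod d ^ 4"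
proof -
  have dh: "cmod d / 2 \<le> cmod (d - h)"
    using norm_triangle_ineq2[of d h] assms by linarith
  then have nz: "d - h \<noteq> 0" using assms(1) by auto
  have "(1 / (d - h)\<^sup>2 - 1 / d\<^sup>2 - 2 * h / d ^ 3) * (d ^ 3 * (d - h)\<^sup>2)
      = d ^ 3 * ((d - h)\<^sup>2 / (d - h)\<^sup>2) - (d - h)\<^sup>2 * (d ^ 3 / d\<^sup>2) - 2 * h * (d - h)\<^sup>2 * (d ^ 3 / d ^ 3)"
    by (simp add: algebra_simps)
  also have "\<dots> = d ^ 3 - (d - h)\<^sup>2 * d - 2 * h * (d - h)\<^sup>2"
    using nz assms(1) by (simp add: power3_eq_cube power2_eq_square)
  also have "\<dots> = h\<^sup>2 * (3 * d - 2 * h)"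
    by (simp add: power2_eq_square power3_eq_cube algebra_simps)
  finally have eq: "1 / (d - h)\<^sup>2 - 1 / d\<^sup>2 - 2 * h / d ^ 3 = h\<^sup>2 * (3 * d - 2 * h) / (d ^ 3 * (d - h)\<^sup>2)"
    using nz assms(1) by (simp add: eq_divide_eq)
  have "cmod (3 * d - 2 * h) \<le> 4 * cmod d"
    using norm_triangle_ineq4[of "3 * d" "2 * h"] assms(2) by (simp add: norm_mult)
  moreover have "cmod d ^ 3 * (cmod d / 2)\<^sup>2 \<le> cmod d ^ 3 * (cmod (d - h))\<^sup>2"
    using dh by (intro mult_left_mono power_mono) auto
  ultimately have "(cmod h)\<^sup>2 * cmod (3 * d - 2 * h) / (cmod d ^ 3 * (cmod (d - h))\<^sup>2)
      \<le> (cmod h)\<^sup>2 * (4 * cmod d) / (cmod d ^ 3 * (cmod d / 2)\<^sup>2)"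
    using assms(1) by (intro frac_le mult_left_mono mult_nonneg_nonneg mult_pos_pos) auto
  also have "\<dots> = 16 * (cmod h)\<^sup>2 / cmod d ^ 4"
    using assms(1) by (simp add: field_simps eval_nat_numeral)
  finally show ?thesis
    unfolding eq by (simp add: norm_mult norm_divide norm_power)
qed

text \<open>Differentiation under the integral with an explicit remainder of order |h|^2 / |d|^4,
  where d = cnj s - z. Since |d| \<ge> Im z, two of the four powers become a constant, so the
  integrability of the integrand at z itself controls the remainder. The pointwise hypothesis
  \<open>int\<close> covers densities in L^1 and in L^2.\<close>

lemma bergman_proj_holomorphic:
  assumes [measurable]: "\<phi> \<in> borel_measurable hpm"
    and int: "\<And>z. Im z > 0 \<Longrightarrow> integrable hpm (\<lambda>s. \<phi> s / (cnj s - z)\<^sup>2)"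
  shows "bergman_proj \<phi> holomorphic_on upper_half_plane"
proof -
  let ?F = "\<lambda>z. LINT s|hpm. \<phi> s / (cnj s - z)\<^sup>2"
  have "\<exists>D. (?F has_field_derivative D) (at z)" if z: "Im z > 0" for z
  proof -
    have dom: "integrable hpm (\<lambda>s. cmod (\<phi> s) / (cmod (cnj s - z))\<^sup>2)"
      using integrable_norm[OF int[OF z]] by (simp add: norm_divide norm_power)
    have int3: "integrable hpm (\<lambda>s. \<phi> s * 2 / (cnj s - z) ^ 3)"
    proof (rule integrable_hpm_bound)
      show "integrable hpm (\<lambda>s. 2 / Im z * (cmod (\<phi> s) / (cmod (cnj s - z))\<^sup>2))"
        by (intro integrable_mult_right dom)
      fix s assume s: "Im s > 0"
      define r where "r = cmod (cnj s - z)"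
      have r: "Im z \<le> r" "r > 0" using cmod_cnj_minus_ge(1)[OF s z] s z by (auto simp: r_def)
      then have "Im z * r\<^sup>2 \<le> r ^ 3"
        by (auto simp: power3_eq_cube power2_eq_square intro!: mult_right_mono)
      then have "cmod (\<phi> s) * 2 / r ^ 3 \<le> cmod (\<phi> s) * 2 / (Im z * r\<^sup>2)"
        using r z by (intro divide_left_mono mult_pos_pos) auto
      then show "norm (\<phi> s * 2 / (cnj s - z) ^ 3) \<le> 2 / Im z * (cmod (\<phi> s) / (cmod (cnj s - z))\<^sup>2)"
        by (simp add: norm_divide norm_mult norm_power r_def mult_ac)
    qed measurable
    define D where "D = (LINT s|hpm. \<phi> s * 2 / (cnj s - z) ^ 3)"
    define C where "C = (LINT s|hpm. 16 / (Im z)\<^sup>2 * (cmod (\<phi> s) / (cmod (cnj s - z))\<^sup>2))"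
    have bound: "cmod (?F (z + h) - ?F z - h * D) \<le> (cmod h)\<^sup>2 * C" if h: "cmod h \<le> Im z / 2" for h
    proof -
      have zh: "Im (z + h) > 0"
        using abs_Im_le_cmod[of h] h z by simp
      let ?G = "\<lambda>s. \<phi> s / (cnj s - (z + h))\<^sup>2 - \<phi> s / (cnj s - z)\<^sup>2 - h * (\<phi> s * 2 / (cnj s - z) ^ 3)"
      have intG: "integrable hpm ?G"
        by (intro Bochner_Integration.integrable_diff int z zh integrable_mult_right int3)
      have eqF: "?F (z + h) - ?F z - h * D = (LINT s|hpm. ?G s)"
        unfolding D_def
        by (simp only: Bochner_Integration.integral_diff[OF Bochner_Integration.integrable_diff[OF
              int[OF zh] int[OF z]] integrable_mult_right[OF int3]]
            Bochner_Integration.integral_diff[OF int[OF zh] int[OF z]] integral_mult_right_zero)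
      have "cmod (?F (z + h) - ?F z - h * D) \<le> (LINT s|hpm. cmod (?G s))"
        unfolding eqF by (rule integral_norm_bound)
      also have "\<dots> \<le> (LINT s|hpm. (cmod h)\<^sup>2 * (16 / (Im z)\<^sup>2 * (cmod (\<phi> s) / (cmod (cnj s - z))\<^sup>2)))"
      proof (rule integral_mono)
        show "integrable hpm (\<lambda>s. (cmod h)\<^sup>2 * (16 / (Im z)\<^sup>2 * (cmod (\<phi> s) / (cmod (cnj s - z))\<^sup>2)))"
          by (intro integrable_mult_right dom)
        fix s assume "s \<in> space hpm"
        then have s: "Im s > 0" by (simp add: upper_half_plane_def)
        define d where "d = cnj s - z"
        have d: "Im z \<le> cmod d" "d \<noteq> 0"
          using cmod_cnj_minus_ge[OF s z] s by (auto simp: d_def)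
        have eq: "?G s = \<phi> s * (1 / (d - h)\<^sup>2 - 1 / d\<^sup>2 - 2 * h / d ^ 3)"
        proof -
          have dh: "cnj s - (z + h) = d - h" by (simp add: d_def)
          show ?thesis
            unfolding dh d_def[symmetric] by (simp add: right_diff_distrib mult_ac)
        qed
        have "cmod (?G s) \<le> cmod (\<phi> s) * (16 * (cmod h)\<^sup>2 / cmod d ^ 4)"
          unfolding eq norm_mult using d h by (intro mult_left_mono inverse_square_taylor_bound) auto
        also have "\<dots> \<le> cmod (\<phi> s) * (16 * (cmod h)\<^sup>2 / ((Im z)\<^sup>2 * (cmod d)\<^sup>2))"
        proof -
          have "(Im z)\<^sup>2 * (cmod d)\<^sup>2 \<le> (cmod d)\<^sup>2 * (cmod d)\<^sup>2"
            using d z by (intro mult_right_mono power_mono) auto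
          then have "(Im z)\<^sup>2 * (cmod d)\<^sup>2 \<le> cmod d ^ 4"
            by (simp flip: power_add)
          then show ?thesis using d z by (intro mult_left_mono divide_left_mono mult_pos_pos) auto
        qed
        finally show "cmod (?G s) \<le> (cmod h)\<^sup>2 * (16 / (Im z)\<^sup>2 * (cmod (\<phi> s) / (cmod (cnj s - z))\<^sup>2))"
          by (simp add: d_def mult_ac)
      qed (intro integrable_norm intG)
      also have "\<dots> = (cmod h)\<^sup>2 * C"
        unfolding C_def by (rule integral_mult_right_zero)
      finally show ?thesis .
    qed
    have "((\<lambda>h. (?F (z + h) - ?F z) / h - D) \<longlongrightarrow> 0) (at 0)"
    proof (rule Lim_null_comparison)
      show "((\<lambda>h::complex. cmod h * C) \<longlongrightarrow> 0) (at 0)"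
        by (auto intro!: tendsto_eq_intros)
      show "\<forall>\<^sub>F h in at 0. norm ((?F (z + h) - ?F z) / h - D) \<le> cmod h * C"
        unfolding eventually_at
      proof (intro exI[of _ "Im z / 2"] conjI ballI impI)
        fix h :: complex assume h: "h \<noteq> 0 \<and> dist h 0 < Im z / 2"
        then have "(?F (z + h) - ?F z) / h - D = (?F (z + h) - ?F z - h * D) / h"
          by (simp add: field_simps)
        also have "cmod \<dots> \<le> (cmod h)\<^sup>2 * C / cmod h"
          using bound[of h] h by (simp add: norm_divide divide_right_mono)
        finally show "norm ((?F (z + h) - ?F z) / h - D) \<le> cmod h * C"
          using h by (simp add: power2_eq_square)
      qed (use z in auto)
    qed
    then have "(?F has_field_derivative D) (at z)"
      unfolding DERIV_def by (rule LIM_zero_cancel)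
    then show ?thesis by blast
  qed
  then have "?F holomorphic_on upper_half_plane"
    unfolding holomorphic_on_open[OF open_upper_half_plane] by (auto simp: upper_half_plane_def)
  then have "(\<lambda>z. - 1 / of_real pi * ?F z) holomorphic_on upper_half_plane"
    by (intro holomorphic_on_mult holomorphic_on_const)
  then show ?thesis
    by (simp add: bergman_proj_def[abs_def])
qed

section \<open>Schur's test and the projection on L^2\<close>

lemma nn_integral_Schur_weighted:
  assumes [measurable]: "\<phi> \<in> borel_measurable hpm"
  shows "(\<integral>\<^sup>+z. (\<integral>\<^sup>+s. ennreal ((cmod (\<phi> s))\<^sup>2 * sqrt (Im s) / (cmod (cnj s - z))\<^sup>2) \<partial>hpm) * ennreal (1 / sqrt (Im z)) \<partial>hpm)
       = ennreal (pi\<^sup>2) * (\<integral>\<^sup>+s. ennreal ((cmod (\<phi> s))\<^sup>2) \<partial>hpm)"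
proof -
  have "(\<integral>\<^sup>+z. (\<integral>\<^sup>+s. ennreal ((cmod (\<phi> s))\<^sup>2 * sqrt (Im s) / (cmod (cnj s - z))\<^sup>2) \<partial>hpm) * ennreal (1 / sqrt (Im z)) \<partial>hpm)
     = (\<integral>\<^sup>+z. (\<integral>\<^sup>+s. ennreal ((cmod (\<phi> s))\<^sup>2 * sqrt (Im s)) * ennreal (1 / sqrt (Im z) / (cmod (z - cnj s))\<^sup>2) \<partial>hpm) \<partial>hpm)"
  proof (intro nn_integral_cong)
    fix z assume "z \<in> space hpm"
    then have z: "Im z > 0" by (simp add: upper_half_plane_def)
    have "(\<integral>\<^sup>+s. ennreal ((cmod (\<phi> s))\<^sup>2 * sqrt (Im s) / (cmod (cnj s - z))\<^sup>2) \<partial>hpm) * ennreal (1 / sqrt (Im z))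
      = (\<integral>\<^sup>+s. ennreal ((cmod (\<phi> s))\<^sup>2 * sqrt (Im s) / (cmod (cnj s - z))\<^sup>2) * ennreal (1 / sqrt (Im z)) \<partial>hpm)"
      by (rule nn_integral_multc[symmetric]) measurable
    also have "\<dots> = (\<integral>\<^sup>+s. ennreal ((cmod (\<phi> s))\<^sup>2 * sqrt (Im s)) * ennreal (1 / sqrt (Im z) / (cmod (z - cnj s))\<^sup>2) \<partial>hpm)"
      using z by (intro nn_integral_cong) (simp add: cmod_cnj_minus' upper_half_plane_def ennreal_mult'[symmetric] mult_ac)
    finally show "(\<integral>\<^sup>+s. ennreal ((cmod (\<phi> s))\<^sup>2 * sqrt (Im s) / (cmod (cnj s - z))\<^sup>2) \<partial>hpm) * ennreal (1 / sqrt (Im z))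
      = (\<integral>\<^sup>+s. ennreal ((cmod (\<phi> s))\<^sup>2 * sqrt (Im s)) * ennreal (1 / sqrt (Im z) / (cmod (z - cnj s))\<^sup>2) \<partial>hpm)" .
  qed
  also have "\<dots> = (\<integral>\<^sup>+s. (\<integral>\<^sup>+z. ennreal ((cmod (\<phi> s))\<^sup>2 * sqrt (Im s)) * ennreal (1 / sqrt (Im z) / (cmod (z - cnj s))\<^sup>2) \<partial>hpm) \<partial>hpm)"
    by (rule hpm_pair.Fubini') measurable
  also have "\<dots> = (\<integral>\<^sup>+s. ennreal (pi\<^sup>2) * ennreal ((cmod (\<phi> s))\<^sup>2) \<partial>hpm)"
  proof (intro nn_integral_cong)
    fix s assume "s \<in> space hpm"
    then have s: "Im s > 0" by (simp add: upper_half_plane_def)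
    have "(\<integral>\<^sup>+z. ennreal ((cmod (\<phi> s))\<^sup>2 * sqrt (Im s)) * ennreal (1 / sqrt (Im z) / (cmod (z - cnj s))\<^sup>2) \<partial>hpm)
       = ennreal ((cmod (\<phi> s))\<^sup>2 * sqrt (Im s)) * ennreal (pi\<^sup>2 / sqrt (Im s))"
      unfolding nn_integral_Schur[OF s, symmetric]
      by (intro nn_integral_cmult measurable_hpm_borel) measurable
    also have "\<dots> = ennreal (pi\<^sup>2) * ennreal ((cmod (\<phi> s))\<^sup>2)"
      using s by (simp add: ennreal_mult'[symmetric] mult_ac)
    finally show "(\<integral>\<^sup>+z. ennreal ((cmod (\<phi> s))\<^sup>2 * sqrt (Im s)) * ennreal (1 / sqrt (Im z) / (cmod (z - cnj s))\<^sup>2) \<partial>hpm)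
       = ennreal (pi\<^sup>2) * ennreal ((cmod (\<phi> s))\<^sup>2)" .
  qed
  also have "\<dots> = ennreal (pi\<^sup>2) * (\<integral>\<^sup>+s. ennreal ((cmod (\<phi> s))\<^sup>2) \<partial>hpm)"
    by (rule nn_integral_cmult) measurable
  finally show ?thesis .
qed

text \<open>Cauchy-Schwarz after splitting the integrand with the factors (Im s)^(1/4) and (Im
  s)^(-1/4); the second half is evaluated by \<open>nn_integral_Schur\<close>. In
  \<open>nn_integral_Schur_weighted\<close> the integration over z removes the weight again.\<close>

lemma Schur_pointwise:
  assumes [measurable]: "\<phi> \<in> borel_measurable hpm" and z: "Im z > 0"
  shows "(\<integral>\<^sup>+s. ennreal (cmod (\<phi> s / (cnj s - z)\<^sup>2)) \<partial>hpm)\<^sup>2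
    \<le> ennreal (pi\<^sup>2) * ((\<integral>\<^sup>+s. ennreal ((cmod (\<phi> s))\<^sup>2 * sqrt (Im s) / (cmod (cnj s - z))\<^sup>2) \<partial>hpm) * ennreal (1 / sqrt (Im z)))"
proof -
  let ?a = "\<lambda>s. ennreal (cmod (\<phi> s) * sqrt (sqrt (Im s)) / cmod (cnj s - z))"
  let ?c = "\<lambda>s. ennreal (1 / sqrt (sqrt (Im s)) / cmod (cnj s - z))"
  have "(\<integral>\<^sup>+s. ennreal (cmod (\<phi> s / (cnj s - z)\<^sup>2)) \<partial>hpm) = (\<integral>\<^sup>+s. ?a s * ?c s \<partial>hpm)"
    by (intro nn_integral_cong)
       (auto simp: upper_half_plane_def ennreal_mult'[symmetric] norm_divide norm_mult power2_eq_square)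
  also have "\<dots>\<^sup>2 \<le> (\<integral>\<^sup>+s. (?a s)\<^sup>2 \<partial>hpm) * (\<integral>\<^sup>+s. (?c s)\<^sup>2 \<partial>hpm)"
    by (rule Cauchy_Schwarz_nn_integral) measurable
  also have "(\<integral>\<^sup>+s. (?a s)\<^sup>2 \<partial>hpm) = (\<integral>\<^sup>+s. ennreal ((cmod (\<phi> s))\<^sup>2 * sqrt (Im s) / (cmod (cnj s - z))\<^sup>2) \<partial>hpm)"
    by (intro nn_integral_cong)
       (auto simp: upper_half_plane_def ennreal_power power_mult_distrib power_divide)
  also have "(\<integral>\<^sup>+s. (?c s)\<^sup>2 \<partial>hpm) = (\<integral>\<^sup>+s. ennreal (1 / sqrt (Im s) / (cmod (s - cnj z))\<^sup>2) \<partial>hpm)"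
    by (intro nn_integral_cong)
       (auto simp: upper_half_plane_def ennreal_power power_mult_distrib power_divide cmod_cnj_minus)
  also have "\<dots> = ennreal (pi\<^sup>2) * ennreal (1 / sqrt (Im z))"
    unfolding nn_integral_Schur[OF z] by (simp add: ennreal_mult'[symmetric])
  finally show ?thesis by (simp add: mult_ac)
qed

lemma bergman_proj_L2:
  assumes [measurable]: "\<phi> \<in> borel_measurable hpm" and \<phi>: "integrable hpm (\<lambda>s. (cmod (\<phi> s))\<^sup>2)"
  shows "bergman_proj \<phi> \<in> bergman_space 2"
proof -
  have hol: "bergman_proj \<phi> holomorphic_on upper_half_plane"
    by (intro bergman_proj_holomorphic integrable_kernel_L2 assms)
  note [measurable] = borel_measurable_hpm_holomorphic[OF hol]
  have "(\<integral>\<^sup>+z. ennreal ((cmod (bergman_proj \<phi> z))\<^sup>2) \<partial>hpm)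
     \<le> (\<integral>\<^sup>+z. ennreal (pi\<^sup>2) * ((\<integral>\<^sup>+s. ennreal ((cmod (\<phi> s))\<^sup>2 * sqrt (Im s) / (cmod (cnj s - z))\<^sup>2) \<partial>hpm)
          * ennreal (1 / sqrt (Im z))) \<partial>hpm)"
  proof (intro nn_integral_mono)
    fix z assume "z \<in> space hpm"
    then have z: "Im z > 0" by (simp add: upper_half_plane_def)
    have "cmod (bergman_proj \<phi> z) = cmod (LINT s|hpm. \<phi> s / (cnj s - z)\<^sup>2) / pi"
      by (simp add: bergman_proj_def norm_mult norm_divide)
    also have "\<dots> \<le> cmod (LINT s|hpm. \<phi> s / (cnj s - z)\<^sup>2) / 1"
      using pi_gt3 by (intro divide_left_mono) auto
    finally have "ennreal (cmod (bergman_proj \<phi> z)) \<le> ennreal (cmod (LINT s|hpm. \<phi> s / (cnj s - z)\<^sup>2))"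
      by (simp add: ennreal_leI)
    also have "\<dots> \<le> (\<integral>\<^sup>+s. ennreal (cmod (\<phi> s / (cnj s - z)\<^sup>2)) \<partial>hpm)"
      by (intro integral_norm_bound_ennreal integrable_kernel_L2 assms z)
    finally have "(ennreal (cmod (bergman_proj \<phi> z)))\<^sup>2 \<le> (\<integral>\<^sup>+s. ennreal (cmod (\<phi> s / (cnj s - z)\<^sup>2)) \<partial>hpm)\<^sup>2"
      by (intro power_mono) auto
    also note Schur_pointwise[OF assms(1) z]
    finally show "ennreal ((cmod (bergman_proj \<phi> z))\<^sup>2) \<le> ennreal (pi\<^sup>2) *
        ((\<integral>\<^sup>+s. ennreal ((cmod (\<phi> s))\<^sup>2 * sqrt (Im s) / (cmod (cnj s - z))\<^sup>2) \<partial>hpm) * ennreal (1 / sqrt (Im z)))"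
      by (simp add: ennreal_power)
  qed
  also have "\<dots> = ennreal (pi\<^sup>2) * (ennreal (pi\<^sup>2) * (\<integral>\<^sup>+s. ennreal ((cmod (\<phi> s))\<^sup>2) \<partial>hpm))"
    by (subst nn_integral_cmult) (simp_all add: nn_integral_Schur_weighted)
  also have "\<dots> < \<infinity>"
    using nn_integral_eq_integral[OF \<phi>] by (simp add: ennreal_mult_less_top)
  finally have "integrable hpm (\<lambda>z. (cmod (bergman_proj \<phi> z))\<^sup>2)"
    by (intro integrableI_nonneg) auto
  then show ?thesis using hol by (simp add: bergman_space_2_iff)
qed

lemma Bergman_reproducing_A2:
  assumes g: "g \<in> bergman_space 2" and z: "Im z > 0"
  shows "(LINT s|hpm. g s / (cnj s - z)\<^sup>2) = - of_real pi * g z"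
proof -
  have hol: "g holomorphic_on upper_half_plane" and int: "integrable hpm (\<lambda>z. (cmod (g z))\<^sup>2)"
    using g by (auto simp: bergman_space_2_iff)
  obtain M where M: "\<And>z. Im z > 0 \<Longrightarrow> cmod (g z) \<le> M / Im z"
    using bergman_space_2_growth[OF g] by blast
  show ?thesis
    using Bergman_reproducing[OF hol _ z integrable_kernel_L2[OF borel_measurable_hpm_holomorphic[OF hol] int z], of M] M
    by simp
qed

text \<open>Justifies the interchange of integrals in \<open>L2_inner_bergman_proj\<close>. With X
  the inner integral, X |\<psi>| \<le> X^2 + |\<psi>|^2 reduces the claim to Schur's test.\<close>

lemma integrable_Schur_bilinear:
  assumes [measurable]: "\<phi> \<in> borel_measurable hpm" "\<psi> \<in> borel_measurable hpm"
    and \<phi>: "integrable hpm (\<lambda>s. (cmod (\<phi> s))\<^sup>2)" and \<psi>: "integrable hpm (\<lambda>s. (cmod (\<psi> s))\<^sup>2)"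
  shows "integrable (hpm \<Otimes>\<^sub>M hpm) (\<lambda>(z, s). \<phi> s / (cnj s - z)\<^sup>2 * \<psi> z)"
proof (rule integrableI_bounded)
  show "(\<lambda>(z, s). \<phi> s / (cnj s - z)\<^sup>2 * \<psi> z) \<in> borel_measurable (hpm \<Otimes>\<^sub>M hpm)"
    by measurable
  have "(\<integral>\<^sup>+p. ennreal (norm (case p of (z, s) \<Rightarrow> \<phi> s / (cnj s - z)\<^sup>2 * \<psi> z)) \<partial>(hpm \<Otimes>\<^sub>M hpm))
     = (\<integral>\<^sup>+z. (\<integral>\<^sup>+s. ennreal (cmod (\<phi> s / (cnj s - z)\<^sup>2 * \<psi> z)) \<partial>hpm) \<partial>hpm)"
    by (subst hpm.nn_integral_fst[symmetric]) auto
  also have "\<dots> \<le> (\<integral>\<^sup>+z. (ennreal (pi\<^sup>2) * ((\<integral>\<^sup>+s. ennreal ((cmod (\<phi> s))\<^sup>2 * sqrt (Im s) / (cmod (cnj s - z))\<^sup>2) \<partial>hpm)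
          * ennreal (1 / sqrt (Im z)))) + ennreal ((cmod (\<psi> z))\<^sup>2) \<partial>hpm)"
  proof (intro nn_integral_mono)
    fix z assume "z \<in> space hpm"
    then have z: "Im z > 0" by (simp add: upper_half_plane_def)
    define X where "X = (\<integral>\<^sup>+s. ennreal (cmod (\<phi> s / (cnj s - z)\<^sup>2)) \<partial>hpm)"
    have "(\<integral>\<^sup>+s. ennreal (cmod (\<phi> s / (cnj s - z)\<^sup>2 * \<psi> z)) \<partial>hpm) = X * ennreal (cmod (\<psi> z))"
      unfolding X_def norm_mult by (subst nn_integral_multc[symmetric]) (auto simp: ennreal_mult')
    also have "\<dots> \<le> X\<^sup>2 + ennreal ((cmod (\<psi> z))\<^sup>2)"
    proof (cases X)
      case (real x)
      have "0 \<le> x * cmod (\<psi> z)" using real by simp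
      then have "x * cmod (\<psi> z) \<le> x\<^sup>2 + (cmod (\<psi> z))\<^sup>2"
        using sum_squares_bound[of x "cmod (\<psi> z)"] by linarith
      then show ?thesis using real
        by (simp add: ennreal_power ennreal_mult'[symmetric] ennreal_leI flip: ennreal_plus)
    qed (simp add: power2_eq_square)
    also have "X\<^sup>2 \<le> ennreal (pi\<^sup>2) * ((\<integral>\<^sup>+s. ennreal ((cmod (\<phi> s))\<^sup>2 * sqrt (Im s) / (cmod (cnj s - z))\<^sup>2) \<partial>hpm)
          * ennreal (1 / sqrt (Im z)))"
      unfolding X_def by (rule Schur_pointwise[OF assms(1) z])
    finally show "(\<integral>\<^sup>+s. ennreal (cmod (\<phi> s / (cnj s - z)\<^sup>2 * \<psi> z)) \<partial>hpm) \<le>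
      (ennreal (pi\<^sup>2) * ((\<integral>\<^sup>+s. ennreal ((cmod (\<phi> s))\<^sup>2 * sqrt (Im s) / (cmod (cnj s - z))\<^sup>2) \<partial>hpm)
          * ennreal (1 / sqrt (Im z)))) + ennreal ((cmod (\<psi> z))\<^sup>2)"
      by (simp add: add_right_mono)
  qed
  also have "\<dots> = ennreal (pi\<^sup>2) * (ennreal (pi\<^sup>2) * (\<integral>\<^sup>+s. ennreal ((cmod (\<phi> s))\<^sup>2) \<partial>hpm))
      + (\<integral>\<^sup>+z. ennreal ((cmod (\<psi> z))\<^sup>2) \<partial>hpm)"
    by (subst nn_integral_add, measurable, subst nn_integral_cmult, measurable)
       (simp add: nn_integral_Schur_weighted)
  also have "\<dots> < \<infinity>"
    using nn_integral_eq_integral[OF \<phi>] nn_integral_eq_integral[OF \<psi>] by (simp add: ennreal_mult_less_top)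
  finally show "(\<integral>\<^sup>+p. ennreal (norm (case p of (z, s) \<Rightarrow> \<phi> s / (cnj s - z)\<^sup>2 * \<psi> z)) \<partial>(hpm \<Otimes>\<^sub>M hpm)) < \<infinity>" .
qed

text \<open>The kernel is Hermitian, (cnj s - z)^2 being the conjugate of (cnj z - s)^2, so the
  projection can be moved to \<open>g\<close>, which it reproduces.\<close>

lemma L2_inner_bergman_proj:
  assumes [measurable]: "\<phi> \<in> borel_measurable hpm" and \<phi>: "integrable hpm (\<lambda>s. (cmod (\<phi> s))\<^sup>2)"
    and g: "g \<in> bergman_space 2"
  shows "L2_inner (bergman_proj \<phi>) g = (LINT s|hpm. \<phi> s * cnj (g s))"
proof -
  have hol: "g holomorphic_on upper_half_plane" and int: "integrable hpm (\<lambda>z. (cmod (g z))\<^sup>2)"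
    using g by (auto simp: bergman_space_2_iff)
  note [measurable] = borel_measurable_hpm_holomorphic[OF hol]
  have I: "integrable (hpm \<Otimes>\<^sub>M hpm) (\<lambda>(z, s). \<phi> s / (cnj s - z)\<^sup>2 * cnj (g z))"
    by (intro integrable_Schur_bilinear \<phi>) (use int in auto)
  have "L2_inner (bergman_proj \<phi>) g = (LINT z|hpm. - 1 / of_real pi * (LINT s|hpm. \<phi> s / (cnj s - z)\<^sup>2 * cnj (g z)))"
    by (simp only: L2_inner_def set_lebesgue_integral_hpm bergman_proj_def mult.assoc integral_mult_left_zero)
  also have "\<dots> = - 1 / of_real pi * (LINT z|hpm. LINT s|hpm. \<phi> s / (cnj s - z)\<^sup>2 * cnj (g z))"
    by (rule integral_mult_right_zero)
  also have "(LINT z|hpm. LINT s|hpm. \<phi> s / (cnj s - z)\<^sup>2 * cnj (g z))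
      = (LINT s|hpm. LINT z|hpm. \<phi> s / (cnj s - z)\<^sup>2 * cnj (g z))"
    using hpm_pair.Fubini_integral[of "\<lambda>s z. \<phi> s / (cnj s - z)\<^sup>2 * cnj (g z)"] hpm_pair.integrable_product_swap[OF I]
    by (simp add: case_prod_unfold)
  also have "\<dots> = (LINT s|hpm. - of_real pi * (\<phi> s * cnj (g s)))"
  proof (intro Bochner_Integration.integral_cong refl)
    fix s assume "s \<in> space hpm"
    then have s: "Im s > 0" by (simp add: upper_half_plane_def)
    have "(LINT z|hpm. \<phi> s / (cnj s - z)\<^sup>2 * cnj (g z)) = (LINT z|hpm. \<phi> s * cnj (g z / (cnj z - s)\<^sup>2))"
      by (simp add: power2_commute[of "cnj s"])
    also have "\<dots> = \<phi> s * cnj (LINT z|hpm. g z / (cnj z - s)\<^sup>2)"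
      by (subst integral_mult_right_zero, subst integral_bounded_linear'[OF bounded_linear_cnj bounded_linear_cnj]) simp_all
    also have "\<dots> = - of_real pi * (\<phi> s * cnj (g s))"
      by (simp add: Bergman_reproducing_A2[OF g s])
    finally show "(LINT z|hpm. \<phi> s / (cnj s - z)\<^sup>2 * cnj (g z)) = - of_real pi * (\<phi> s * cnj (g s))" .
  qed
  finally show ?thesis by simp
qed

section \<open>The Hankel operator as the projection of a density\<close>

definition hankel_density :: "(complex \<Rightarrow> complex) \<Rightarrow> (complex \<Rightarrow> complex) \<Rightarrow> complex \<Rightarrow> complex" where
  "hankel_density b f s = - 2 * \<i> * (deriv b s * cnj (f s) * of_real (Im s))"

lemma bracket_eq: "bracket b f = (LINT s|hpm. hankel_density b f s)"
  unfolding bracket_def hankel_density_def set_lebesgue_integral_hpm by (rule integral_mult_right_zero[symmetric])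

text \<open>This turns the defining property of the Hankel operator into an L^2 pairing of the
  density with \<open>g\<close>; the choice of a kernel for \<open>g\<close> gives the projection
  formula.\<close>

lemma hankel_density_mult: "hankel_density b (\<lambda>s. f s * g s) s = hankel_density b f s * cnj (g s)"
  by (simp add: hankel_density_def mult_ac)

lemma hankel_A1_eq: "hankel_A1 b f = bergman_proj (hankel_density b f)"
proof
  fix z
  have "hankel_A1 b f z = (LINT s|hpm. - 1 / of_real pi * (hankel_density b f s / (cnj s - z)\<^sup>2))"
    unfolding hankel_A1_def bracket_eq hankel_density_mult
    by (intro Bochner_Integration.integral_cong refl) (simp add: bergman_kernel_def)
  then show "hankel_A1 b f z = bergman_proj (hankel_density b f) z"
    unfolding bergman_proj_def integral_mult_right_zero .
qed

lemma hankel_density_measurable: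
  assumes "b holomorphic_on upper_half_plane" "f holomorphic_on upper_half_plane"
  shows "hankel_density b f \<in> borel_measurable hpm"
proof -
  have [measurable]: "deriv b \<in> borel_measurable hpm" "f \<in> borel_measurable hpm"
    using assms by (auto intro!: borel_measurable_hpm_holomorphic holomorphic_deriv open_upper_half_plane)
  show ?thesis unfolding hankel_density_def[abs_def] by measurable
qed

lemma bloch_spaceD:
  assumes "b \<in> bloch_space"
  obtains B where "B \<ge> 0" "\<And>z. Im z > 0 \<Longrightarrow> Im z * cmod (deriv b z) \<le> B"
proof -
  from assms obtain B where B: "\<And>z. Im z > 0 \<Longrightarrow> Im z * cmod (deriv b z) \<le> B"
    by (auto simp: bloch_space_def bdd_above_def upper_half_plane_def)
  moreover have "B \<ge> 0" using order_trans[OF _ B[of \<i>], of 0] by simp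
  ultimately show thesis using that by blast
qed

lemma cmod_hankel_density_le:
  assumes "Im s > 0" "Im s * cmod (deriv b s) \<le> B"
  shows "cmod (hankel_density b f s) \<le> 2 * B * cmod (f s)"
proof -
  have "cmod (hankel_density b f s) = 2 * (Im s * cmod (deriv b s)) * cmod (f s)"
    using assms by (simp add: hankel_density_def norm_mult)
  also have "\<dots> \<le> 2 * B * cmod (f s)"
    using assms by (intro mult_right_mono) auto
  finally show ?thesis .
qed

lemma hankel_density_L2:
  assumes b: "b \<in> bloch_space" and f: "f \<in> bergman_space 2"
  shows "integrable hpm (\<lambda>s. (cmod (hankel_density b f s))\<^sup>2)"
proof -
  obtain B where B: "B \<ge> 0" "\<And>z. Im z > 0 \<Longrightarrow> Im z * cmod (deriv b z) \<le> B"
    using bloch_spaceD[OF b] by blast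
  have fint: "integrable hpm (\<lambda>z. (cmod (f z))\<^sup>2)" and [measurable]: "hankel_density b f \<in> borel_measurable hpm"
    using b f hankel_density_measurable by (auto simp: bergman_space_2_iff bloch_space_def)
  show ?thesis
  proof (rule integrable_hpm_bound)
    show "integrable hpm (\<lambda>s. (2 * B)\<^sup>2 * (cmod (f s))\<^sup>2)"
      by (intro integrable_mult_right fint)
    fix s assume s: "Im s > 0"
    have "(cmod (hankel_density b f s))\<^sup>2 \<le> (2 * B * cmod (f s))\<^sup>2"
      using cmod_hankel_density_le[OF s B(2)[OF s]] by (intro power_mono) auto
    then show "norm ((cmod (hankel_density b f s))\<^sup>2) \<le> (2 * B)\<^sup>2 * (cmod (f s))\<^sup>2"
      by (simp add: power_mult_distrib)
  qed measurable
qed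

lemma hankel_density_L1:
  assumes b: "b \<in> bloch_space" and f: "f \<in> bergman_space 1"
  shows "integrable hpm (hankel_density b f)"
proof -
  obtain B where B: "B \<ge> 0" "\<And>z. Im z > 0 \<Longrightarrow> Im z * cmod (deriv b z) \<le> B"
    using bloch_spaceD[OF b] by blast
  have fint: "integrable hpm f" and m: "hankel_density b f \<in> borel_measurable hpm"
    using b f hankel_density_measurable by (auto simp: bergman_space_1_iff bloch_space_def)
  show ?thesis
    by (rule integrable_hpm_bound[OF _ m cmod_hankel_density_le[OF _ B(2)]])
       (use fint in auto)
qed

lemma bergman_kernel_in_A2:
  assumes z: "Im z > 0"
  shows "(\<lambda>s. bergman_kernel s z) \<in> bergman_space 2"
proof -
  have "integrable hpm (\<lambda>s. 1 / pi\<^sup>2 * (1 / (cmod (cnj s - z)) ^ 4))"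
    by (intro integrable_mult_right integrable_kernel_square z)
  moreover have "(cmod (bergman_kernel s z))\<^sup>2 = 1 / pi\<^sup>2 * (1 / (cmod (cnj s - z)) ^ 4)" for s
    by (simp add: bergman_kernel_def norm_divide norm_mult norm_power cmod_cnj_minus power_mult_distrib power_divide
        flip: power_mult)
  moreover have "s - cnj z \<noteq> 0" if "s \<in> upper_half_plane" for s
    using that z by (auto simp: complex_eq_iff upper_half_plane_def)
  then have "(\<lambda>s. bergman_kernel s z) holomorphic_on upper_half_plane"
    unfolding bergman_kernel_def by (intro holomorphic_intros) auto
  ultimately show ?thesis by (simp add: bergman_space_2_iff)
qed

text \<open>The projection of the density has the defining property, so \<open>SOME\<close> does
  return a function with it. Testing that function against the kernel at z and using the reproducing
  formula determines its value at z.\<close>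

lemma hankel_characterization:
  assumes b: "b \<in> bloch_space" and f: "f \<in> bergman_space 2"
  shows "hankel b f \<in> bergman_space 2" and "\<And>z. Im z > 0 \<Longrightarrow> hankel b f z = hankel_A1 b f z"
proof -
  let ?P = "\<lambda>h. h \<in> bergman_space 2 \<and> (\<forall>g\<in>bergman_space 2. L2_inner h g = bracket b (\<lambda>z. f z * g z))"
  have m: "hankel_density b f \<in> borel_measurable hpm"
    using b f hankel_density_measurable by (auto simp: bergman_space_2_iff bloch_space_def)
  have "?P (bergman_proj (hankel_density b f))"
    using bergman_proj_L2[OF m hankel_density_L2[OF b f]]
    by (auto simp: L2_inner_bergman_proj[OF m hankel_density_L2[OF b f]] bracket_eq hankel_density_mult)
  then have P: "?P (hankel b f)"
    unfolding hankel_def by (rule someI[of ?P])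
  then show A2: "hankel b f \<in> bergman_space 2" by blast
  fix z assume z: "Im z > 0"
  have "hankel_A1 b f z = L2_inner (hankel b f) (\<lambda>s. bergman_kernel s z)"
    using P bergman_kernel_in_A2[OF z] by (auto simp: hankel_A1_def)
  also have "\<dots> = (LINT s|hpm. - 1 / of_real pi * (hankel b f s / (cnj s - z)\<^sup>2))"
    unfolding L2_inner_def set_lebesgue_integral_hpm
    by (intro Bochner_Integration.integral_cong refl) (simp add: bergman_kernel_def)
  also have "\<dots> = - 1 / of_real pi * (LINT s|hpm. hankel b f s / (cnj s - z)\<^sup>2)"
    by (rule integral_mult_right_zero)
  also have "\<dots> = hankel b f z"
    by (simp add: Bergman_reproducing_A2[OF A2 z])
  finally show "hankel b f z = hankel_A1 b f z" ..
qed

section \<open>Bounds for the Hankel operator\<close>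

text \<open>On the imaginary axis \<open>y\<^sup>2 P \<phi>\<close> tends to \<open>(\<integral> \<phi>) / \<pi>\<close>,
  whereas \<open>y\<^sup>2 h\<close> tends to 0 for every integrable holomorphic \<open>h\<close>.\<close>

lemma integral_eq_0_if_bergman_proj_integrable:
  assumes \<phi>: "integrable hpm \<phi>" and P: "integrable hpm (bergman_proj \<phi>)"
  shows "(LINT s|hpm. \<phi> s) = 0"
proof -
  note [measurable] = borel_measurable_integrable[OF \<phi>] borel_measurable_integrable[OF P]
  let ?h = "bergman_proj \<phi>" and ?z = "\<lambda>n::nat. Complex 0 (real (Suc n))"
  have hol: "?h holomorphic_on upper_half_plane"
    by (intro bergman_proj_holomorphic integrable_kernel_L1 \<phi>) measurable
  let ?a = "\<lambda>n. (of_nat (Suc n))\<^sup>2 * ?h (?z n)"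
  have lim1: "?a \<longlonglongrightarrow> 1 / of_real pi * (LINT s|hpm. \<phi> s)"
  proof -
    have eq: "?a n = 1 / of_real pi * (LINT s|hpm. \<phi> s * (- ((of_nat (Suc n))\<^sup>2 / (cnj s - ?z n)\<^sup>2)))" for n
    proof -
      have "(LINT s|hpm. \<phi> s * (- ((of_nat (Suc n))\<^sup>2 / (cnj s - ?z n)\<^sup>2)))
          = (LINT s|hpm. - ((of_nat (Suc n))\<^sup>2) * (\<phi> s / (cnj s - ?z n)\<^sup>2))"
        by (intro Bochner_Integration.integral_cong) auto
      also have "\<dots> = - ((of_nat (Suc n))\<^sup>2) * (LINT s|hpm. \<phi> s / (cnj s - ?z n)\<^sup>2)"
        by (rule integral_mult_right_zero)
      finally show ?thesis by (simp add: bergman_proj_def)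
    qed
    have "(\<lambda>n. LINT s|hpm. \<phi> s * (- ((of_nat (Suc n))\<^sup>2 / (cnj s - ?z n)\<^sup>2))) \<longlonglongrightarrow> (LINT s|hpm. \<phi> s)"
    proof (rule integral_dominated_convergence[where w = "\<lambda>s. norm (\<phi> s)"])
      show "AE s in hpm. (\<lambda>n. \<phi> s * (- ((of_nat (Suc n))\<^sup>2 / (cnj s - ?z n)\<^sup>2))) \<longlonglongrightarrow> \<phi> s"
      proof (intro AE_I2)
        fix s
        \<comment> \<open>The kernel scaled by (n + 1)^2 is 1 / (cnj s / (n + 1) - \<i>)^2 and tends
          to 1 / (-\<i>)^2 = -1, which the minus sign in the integrand offsets.\<close>
        have t: "(\<lambda>n. cnj s * (1 / of_nat (Suc n)) - \<i>) \<longlonglongrightarrow> cnj s * 0 - \<i>"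
          by (intro tendsto_intros LIMSEQ_Suc[OF lim_1_over_n])
        have "(\<lambda>n. \<phi> s * (- (1 / (cnj s * (1 / of_nat (Suc n)) - \<i>)\<^sup>2))) \<longlonglongrightarrow> \<phi> s * (- (1 / (cnj s * 0 - \<i>)\<^sup>2))"
          by (intro tendsto_mult tendsto_minus tendsto_divide tendsto_power tendsto_const t) simp
        moreover have "1 / (cnj s * (1 / of_nat (Suc n)) - \<i>)\<^sup>2 = (of_nat (Suc n))\<^sup>2 / (cnj s - ?z n)\<^sup>2" for n
        proof -
          have "cnj s * (1 / of_nat (Suc n)) - \<i> = (cnj s - ?z n) / of_nat (Suc n)"
            by (simp add: Complex_eq field_simps del: of_nat_Suc)
          then show ?thesis by (simp add: power_divide del: of_nat_Suc)
        qed
        moreover have "\<phi> s * (- (1 / (cnj s * 0 - \<i>)\<^sup>2)) = \<phi> s"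
          by simp
        ultimately show "(\<lambda>n. \<phi> s * (- ((of_nat (Suc n))\<^sup>2 / (cnj s - ?z n)\<^sup>2))) \<longlonglongrightarrow> \<phi> s"
          by (simp only:)
      qed
      show "AE s in hpm. norm (\<phi> s * (- ((of_nat (Suc n))\<^sup>2 / (cnj s - ?z n)\<^sup>2))) \<le> norm (\<phi> s)" for n
      proof (intro AE_I2)
        fix s assume "s \<in> space hpm"
        then have s: "Im s > 0" by (simp add: upper_half_plane_def)
        have "real (Suc n) \<le> cmod (cnj s - ?z n)"
          using cmod_cnj_minus_ge(1)[OF s, of "?z n"] s by simp
        then have "(real (Suc n))\<^sup>2 / (cmod (cnj s - ?z n))\<^sup>2 \<le> 1"
          by (intro divide_le_eq_1[THEN iffD2] disjI1 conjI power_mono) (auto intro: zero_less_power le_less_trans)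
        then have "cmod (\<phi> s) * ((real (Suc n))\<^sup>2 / (cmod (cnj s - ?z n))\<^sup>2) \<le> cmod (\<phi> s) * 1"
          by (intro mult_left_mono) auto
        then show "norm (\<phi> s * (- ((of_nat (Suc n))\<^sup>2 / (cnj s - ?z n)\<^sup>2))) \<le> norm (\<phi> s)"
          by (simp add: norm_mult norm_divide norm_power del: of_nat_Suc)
      qed
    qed (use \<phi> in auto)
    then show ?thesis unfolding eq by (intro tendsto_intros)
  qed
  have lim2: "?a \<longlonglongrightarrow> 0"
  proof (rule Lim_null_comparison)
    \<comment> \<open>The square of half side r = (n + 1) / 2 around \<open>?z n\<close> stays above
      height (n + 1) / 2, where the mass of an integrable function tends to 0. The factor 12 below
      is 3 from \<open>square_mean_bound\<close> times 4 from r^2 = (n + 1)^2 / 4.\<close>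
    let ?w = "\<lambda>n s. indicator {s. real (Suc n) / 2 \<le> Im s} s * cmod (?h s)"
    have [measurable]: "(indicator {s. c \<le> Im s} :: complex \<Rightarrow> real) \<in> borel_measurable hpm" for c
      by (intro measurable_hpm_borel borel_measurable_indicator) measurable
    have int: "integrable hpm (?w n)" for n
      by (rule Bochner_Integration.integrable_bound[OF integrable_norm[OF P]]) (auto simp: indicator_def)
    show "(\<lambda>n. 12 * (LINT s|hpm. ?w n s)) \<longlonglongrightarrow> 0"
    proof -
      have "(\<lambda>n. LINT s|hpm. ?w n s) \<longlonglongrightarrow> (LINT s|hpm. 0)"
      proof (rule integral_dominated_convergence[where w = "\<lambda>s. norm (?h s)"])
        show "AE s in hpm. (\<lambda>n. ?w n s) \<longlonglongrightarrow> 0"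
        proof (intro AE_I2 tendsto_eventually)
          fix s
          obtain N where N: "2 * Im s < real N" using reals_Archimedean2 by blast
          show "\<forall>\<^sub>F n in sequentially. ?w n s = 0"
            using eventually_ge_at_top[of N] by eventually_elim (use N in \<open>auto simp: indicator_def\<close>)
        qed
      qed (use P in \<open>auto simp: indicator_def\<close>)
      then show ?thesis using tendsto_mult_right_zero by fastforce
    qed
    show "\<forall>\<^sub>F n in sequentially. norm (?a n) \<le> 12 * (LINT s|hpm. ?w n s)"
    proof (intro always_eventually allI)
      fix n
      define r where "r = real (Suc n) / 2"
      have r: "0 < r" "r < Im (?z n)" by (auto simp: r_def)
      have "ennreal (cmod (?h (?z n)) * r\<^sup>2) \<le> 3 * (\<integral>\<^sup>+s. ennreal (cmod (?h s)) *
          indicator (cbox (?z n - Complex r r) (?z n + Complex r r)) s \<partial>hpm)"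
        by (rule square_mean_bound[OF hol r])
      also have "\<dots> \<le> 3 * (\<integral>\<^sup>+s. ennreal (?w n s) \<partial>hpm)"
        by (intro mult_left_mono nn_integral_mono) (auto simp: indicator_def in_cbox_complex_iff r_def field_simps)
      also have "\<dots> = 3 * ennreal (LINT s|hpm. ?w n s)"
        using int by (subst nn_integral_eq_integral) auto
      also have "\<dots> = ennreal (3 * (LINT s|hpm. ?w n s))"
        by (simp add: ennreal_mult')
      finally have "cmod (?h (?z n)) * r\<^sup>2 \<le> 3 * (LINT s|hpm. ?w n s)"
        by (subst (asm) ennreal_le_iff) (auto intro!: integral_nonneg_AE)
      then show "norm (?a n) \<le> 12 * (LINT s|hpm. ?w n s)"
        by (simp add: norm_mult norm_power r_def power_divide mult_ac del: of_nat_Suc)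
    qed
  qed
  show ?thesis
    using LIMSEQ_unique[OF lim1 lim2] by simp
qed

text \<open>Adding the second term subtracts the kernel at \<open>w\<close> under the integral that
  defines the projection; Tonelli then leaves the gap as inner integral, and 1 / pi is estimated by
  1.\<close>

lemma bergman_proj_gap:
  assumes \<phi>: "integrable hpm \<phi>" and w: "Im w > 0"
  shows "(\<integral>\<^sup>+z. ennreal (cmod (bergman_proj \<phi> z + (LINT s|hpm. \<phi> s) / of_real pi / (z - cnj w)\<^sup>2)) \<partial>hpm)
      \<le> (\<integral>\<^sup>+s. ennreal (cmod (\<phi> s)) * kernel_gap s w \<partial>hpm)"
proof -
  note [measurable] = borel_measurable_integrable[OF \<phi>]
  let ?k = "\<lambda>z s. 1 / (z - cnj s)\<^sup>2 - 1 / (z - cnj w)\<^sup>2"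
  have "(\<integral>\<^sup>+z. ennreal (cmod (bergman_proj \<phi> z + (LINT s|hpm. \<phi> s) / of_real pi / (z - cnj w)\<^sup>2)) \<partial>hpm)
      \<le> (\<integral>\<^sup>+z. (\<integral>\<^sup>+s. ennreal (cmod (\<phi> s) * cmod (?k z s)) \<partial>hpm) \<partial>hpm)"
  proof (intro nn_integral_mono)
    fix z assume "z \<in> space hpm"
    then have z: "Im z > 0" by (simp add: upper_half_plane_def)
    have i1: "integrable hpm (\<lambda>s. \<phi> s / (z - cnj s)\<^sup>2)"
      using integrable_kernel_L1[OF \<phi> z] by (simp add: power2_commute)
    have i2: "integrable hpm (\<lambda>s. \<phi> s / (z - cnj w)\<^sup>2)"
      using \<phi> by simp
    have i: "integrable hpm (\<lambda>s. \<phi> s * ?k z s)"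
      using Bochner_Integration.integrable_diff[OF i1 i2] by (simp add: right_diff_distrib)
    have "(LINT s|hpm. \<phi> s * ?k z s) = (LINT s|hpm. \<phi> s / (z - cnj s)\<^sup>2) - (LINT s|hpm. \<phi> s) / (z - cnj w)\<^sup>2"
      using Bochner_Integration.integral_diff[OF i1 i2] by (simp add: right_diff_distrib)
    moreover have "bergman_proj \<phi> z = - 1 / of_real pi * (LINT s|hpm. \<phi> s / (z - cnj s)\<^sup>2)"
      unfolding bergman_proj_def by (simp add: power2_commute[of z])
    ultimately have eq: "bergman_proj \<phi> z + (LINT s|hpm. \<phi> s) / of_real pi / (z - cnj w)\<^sup>2
        = - 1 / of_real pi * (LINT s|hpm. \<phi> s * ?k z s)"
      by (simp add: right_diff_distrib)
    have "cmod (- 1 / of_real pi * (LINT s|hpm. \<phi> s * ?k z s)) = 1 / pi * cmod (LINT s|hpm. \<phi> s * ?k z s)"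
      by (simp add: norm_mult norm_divide)
    also have "\<dots> \<le> 1 * cmod (LINT s|hpm. \<phi> s * ?k z s)"
      using pi_gt3 by (intro mult_right_mono) auto
    finally have "ennreal (cmod (- 1 / of_real pi * (LINT s|hpm. \<phi> s * ?k z s))) \<le> ennreal (cmod (LINT s|hpm. \<phi> s * ?k z s))"
      by (simp add: ennreal_leI)
    also have "\<dots> \<le> (\<integral>\<^sup>+s. ennreal (cmod (\<phi> s * ?k z s)) \<partial>hpm)"
      by (rule integral_norm_bound_ennreal[OF i])
    finally show "ennreal (cmod (bergman_proj \<phi> z + (LINT s|hpm. \<phi> s) / of_real pi / (z - cnj w)\<^sup>2))
      \<le> (\<integral>\<^sup>+s. ennreal (cmod (\<phi> s) * cmod (?k z s)) \<partial>hpm)"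
      unfolding eq by (simp add: norm_mult)
  qed
  also have "\<dots> = (\<integral>\<^sup>+s. (\<integral>\<^sup>+z. ennreal (cmod (\<phi> s) * cmod (?k z s)) \<partial>hpm) \<partial>hpm)"
    by (rule hpm_pair.Fubini') measurable
  also have "\<dots> = (\<integral>\<^sup>+s. ennreal (cmod (\<phi> s)) * kernel_gap s w \<partial>hpm)"
    unfolding kernel_gap_def
    by (intro nn_integral_cong)
       (subst nn_integral_cmult[symmetric], auto simp: ennreal_mult' intro!: measurable_hpm_borel)
  finally show ?thesis .
qed

lemma L1_norm_hpm: "L1_norm f = (LINT z|hpm. cmod (f z))"
  by (simp add: L1_norm_def set_lebesgue_integral_hpm)

lemma nn_integral_L1_norm: "integrable hpm f \<Longrightarrow> (\<integral>\<^sup>+z. ennreal (cmod (f z)) \<partial>hpm) = ennreal (L1_norm f)"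
  unfolding L1_norm_hpm by (intro nn_integral_eq_integral) auto

lemma bloch_omega_imp_hankel_bounded:
  assumes b: "b \<in> bloch_space" and bo: "b \<in> bloch_omega_space"
  shows "hankel_bounded_A1 b"
proof -
  from bo obtain B where B: "\<And>z. Im z > 0 \<Longrightarrow> Im z * omega z * cmod (deriv b z) \<le> B"
    by (auto simp: bloch_omega_space_def bdd_above_def upper_half_plane_def)
  have om: "omega \<i> \<ge> 0" using omega_ge_1[of \<i>] by linarith
  have B0: "B \<ge> 0" using order_trans[OF _ B[of \<i>], of 0] om by simp
  show ?thesis
    unfolding hankel_bounded_A1_def
  \<comment> \<open>2 from the density times 8 pi from \<open>kernel_gap_le_omega\<close>.\<close>
  proof (intro exI[of _ "16 * pi * B"] ballI)
    fix f assume f: "f \<in> bergman_space_annihilating b \<inter> bergman_space 2"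
    then have f1: "f \<in> bergman_space 1" and f2: "f \<in> bergman_space 2" and f0: "bracket b f = 0"
      by (auto simp: bergman_space_annihilating_def)
    have fint: "integrable hpm f" using f1 by (simp add: bergman_space_1_iff)
    note [measurable] = borel_measurable_integrable[OF fint]
    let ?\<phi> = "hankel_density b f"
    have hol: "hankel b f holomorphic_on upper_half_plane"
      using hankel_characterization(1)[OF b f2] by (simp add: bergman_space_2_iff)
    \<comment> \<open>The bracket vanishes, so the term to be compared with may be added
      freely.\<close>
    have "(\<integral>\<^sup>+z. ennreal (cmod (hankel b f z)) \<partial>hpm)
       = (\<integral>\<^sup>+z. ennreal (cmod (bergman_proj ?\<phi> z + (LINT s|hpm. ?\<phi> s) / of_real pi / (z - cnj \<i>)\<^sup>2)) \<partial>hpm)"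
      using f0 hankel_characterization(2)[OF b f2]
      by (intro nn_integral_cong) (simp add: bracket_eq hankel_A1_eq upper_half_plane_def)
    also have "\<dots> \<le> (\<integral>\<^sup>+s. ennreal (cmod (?\<phi> s)) * kernel_gap s \<i> \<partial>hpm)"
      by (rule bergman_proj_gap[OF hankel_density_L1[OF b f1]]) simp
    also have "\<dots> \<le> (\<integral>\<^sup>+s. ennreal (16 * pi * B) * ennreal (cmod (f s)) \<partial>hpm)"
    proof (intro nn_integral_mono)
      fix s assume "s \<in> space hpm"
      then have s: "Im s > 0" by (simp add: upper_half_plane_def)
      have om0: "omega s \<ge> 0" using omega_ge_1[of s] by linarith
      have "cmod (?\<phi> s) * (8 * pi * omega s) = 16 * pi * (Im s * omega s * cmod (deriv b s)) * cmod (f s)"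
        using s by (simp add: hankel_density_def norm_mult mult_ac)
      also have "\<dots> \<le> 16 * pi * B * cmod (f s)"
        using B[OF s] by (intro mult_right_mono mult_left_mono) auto
      finally have le: "cmod (?\<phi> s) * (8 * pi * omega s) \<le> 16 * pi * B * cmod (f s)" .
      have "ennreal (cmod (?\<phi> s)) * kernel_gap s \<i> \<le> ennreal (cmod (?\<phi> s)) * ennreal (8 * pi * omega s)"
        by (intro mult_left_mono kernel_gap_le_omega s) auto
      also have "\<dots> = ennreal (cmod (?\<phi> s) * (8 * pi * omega s))"
        by (simp add: ennreal_mult')
      also have "\<dots> \<le> ennreal (16 * pi * B * cmod (f s))"
        by (rule ennreal_leI[OF le])
      also have "\<dots> = ennreal (16 * pi * B) * ennreal (cmod (f s))"
        using B0 by (intro ennreal_mult') auto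
      finally show "ennreal (cmod (?\<phi> s)) * kernel_gap s \<i> \<le> ennreal (16 * pi * B) * ennreal (cmod (f s))" .
    qed
    also have "\<dots> = ennreal (16 * pi * B) * ennreal (L1_norm f)"
      by (subst nn_integral_cmult) (auto simp: nn_integral_L1_norm[OF fint])
    also have "\<dots> = ennreal (16 * pi * B * L1_norm f)"
      using B0 by (intro ennreal_mult'[symmetric]) auto
    finally have le: "(\<integral>\<^sup>+z. ennreal (cmod (hankel b f z)) \<partial>hpm) \<le> ennreal (16 * pi * B * L1_norm f)" .
    then have int: "integrable hpm (hankel b f)"
      using borel_measurable_hpm_holomorphic[OF hol]
      by (intro integrableI_bounded) (auto simp: le_less_trans[OF _ ennreal_less_top])
    have "L1_norm f \<ge> 0" by (simp add: L1_norm_hpm)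
    then have "L1_norm (hankel b f) \<le> 16 * pi * B * L1_norm f"
      using le B0 unfolding nn_integral_L1_norm[OF int] by (subst (asm) ennreal_le_iff) auto
    then show "hankel b f \<in> bergman_space 1 \<and> L1_norm (hankel b f) \<le> 16 * pi * B * L1_norm f"
      using int hol by (simp add: bergman_space_1_iff)
  qed
qed

text \<open>Up to a constant, \<open>Im w\<close> times the s-derivative of
  \<open>bergman_kernel s w\<close>. The kernel itself is not integrable, its derivative is, and the
  factor \<open>Im w\<close> is the scaling that keeps the L^1 norm bounded in
  \<open>w\<close>.\<close>

definition test_fun :: "complex \<Rightarrow> complex \<Rightarrow> complex" where
  "test_fun w s = of_real (Im w) / (s - cnj w) ^ 3"

lemma cmod_test_fun: "Im w > 0 \<Longrightarrow> cmod (test_fun w s) = Im w / cmod (s - cnj w) ^ 3"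
  by (simp add: test_fun_def norm_divide norm_power)

lemma test_fun_holomorphic:
  assumes "Im w > 0" shows "test_fun w holomorphic_on upper_half_plane"
proof -
  have "s - cnj w \<noteq> 0" if "s \<in> upper_half_plane" for s
    using that assms by (auto simp: complex_eq_iff upper_half_plane_def)
  then show ?thesis
    unfolding test_fun_def[abs_def] by (intro holomorphic_intros) auto
qed

lemma test_fun_A2:
  assumes w: "Im w > 0" shows "test_fun w \<in> bergman_space 2"
proof -
  note hol = test_fun_holomorphic[OF w]
  have [measurable]: "test_fun w \<in> borel_measurable hpm"
    by (rule borel_measurable_hpm_holomorphic[OF hol])
  have "integrable hpm (\<lambda>s. (cmod (test_fun w s))\<^sup>2)"
  proof (rule integrable_hpm_bound[OF integrable_kernel_square[OF w]])
    fix s assume s: "Im s > 0"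
    define r where "r = cmod (s - cnj w)"
    have r: "Im w \<le> r" "r > 0"
      using cmod_minus_cnj_ge[OF s w] s w by (auto simp: r_def)
    have "(Im w / r ^ 3)\<^sup>2 \<le> (r / r ^ 3)\<^sup>2"
      using r w by (intro power_mono divide_right_mono) auto
    also have "\<dots> = 1 / r ^ 4"
      using r by (simp add: power2_eq_square eval_nat_numeral)
    finally show "norm ((cmod (test_fun w s))\<^sup>2) \<le> 1 / (cmod (cnj s - w)) ^ 4"
      by (simp add: cmod_test_fun[OF w] r_def cmod_cnj_minus)
  qed measurable
  then show ?thesis using hol by (simp add: bergman_space_2_iff)
qed

text \<open>From sqrt (Im w) sqrt (Im s) \<le> |s - cnj w| one power of decay is traded for the
  weight 1 / sqrt (Im s); \<open>nn_integral_Schur\<close> then cancels the remaining sqrt (Im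
  w).\<close>

lemma test_fun_A1:
  assumes w: "Im w > 0" shows "test_fun w \<in> bergman_space 1" "L1_norm (test_fun w) \<le> pi\<^sup>2"
proof -
  note hol = test_fun_holomorphic[OF w]
  have m[measurable]: "test_fun w \<in> borel_measurable hpm"
    by (rule borel_measurable_hpm_holomorphic[OF hol])
  have "(\<integral>\<^sup>+s. ennreal (cmod (test_fun w s)) \<partial>hpm)
     \<le> (\<integral>\<^sup>+s. ennreal (sqrt (Im w)) * ennreal (1 / sqrt (Im s) / (cmod (s - cnj w))\<^sup>2) \<partial>hpm)"
  proof (intro nn_integral_mono)
    fix s assume "s \<in> space hpm"
    then have s: "Im s > 0" by (simp add: upper_half_plane_def)
    define r where "r = cmod (s - cnj w)"
    have r: "Im w \<le> r" "Im s \<le> r" "r > 0"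
      using cmod_minus_cnj_ge[OF s w] s w by (auto simp: r_def)
    have "sqrt (Im w) * sqrt (Im s) \<le> sqrt r * sqrt r"
      using r s w by (intro mult_mono) auto
    then have "sqrt (Im w) * (1 / r) \<le> 1 / sqrt (Im s)"
      using r s by (simp add: field_simps)
    then have "(sqrt (Im w) * (1 / r\<^sup>2)) * (sqrt (Im w) * (1 / r)) \<le> (sqrt (Im w) * (1 / r\<^sup>2)) * (1 / sqrt (Im s))"
      using w by (intro mult_left_mono) auto
    moreover have "(sqrt (Im w) * (1 / r\<^sup>2)) * (sqrt (Im w) * (1 / r)) = Im w / r ^ 3"
      using w by (simp add: power2_eq_square power3_eq_cube)
    ultimately have "Im w / r ^ 3 \<le> sqrt (Im w) * (1 / sqrt (Im s) / r\<^sup>2)"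
      by (simp add: mult_ac)
    then show "ennreal (cmod (test_fun w s)) \<le> ennreal (sqrt (Im w)) * ennreal (1 / sqrt (Im s) / (cmod (s - cnj w))\<^sup>2)"
      using w by (simp add: cmod_test_fun[OF w] r_def ennreal_mult'[symmetric] ennreal_leI)
  qed
  also have "\<dots> = ennreal (sqrt (Im w)) * ennreal (pi\<^sup>2 / sqrt (Im w))"
    unfolding nn_integral_Schur[OF w, symmetric]
    by (intro nn_integral_cmult measurable_hpm_borel) measurable
  also have "\<dots> = ennreal (pi\<^sup>2)"
    using w by (simp add: ennreal_mult'[symmetric])
  finally have le: "(\<integral>\<^sup>+s. ennreal (cmod (test_fun w s)) \<partial>hpm) \<le> ennreal (pi\<^sup>2)" .
  then have int: "integrable hpm (test_fun w)"
    by (intro integrableI_bounded m) (auto simp: le_less_trans[OF _ ennreal_less_top])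
  then show "test_fun w \<in> bergman_space 1" using hol by (simp add: bergman_space_1_iff)
  show "L1_norm (test_fun w) \<le> pi\<^sup>2"
    using le unfolding nn_integral_L1_norm[OF int] by (subst (asm) ennreal_le_iff) auto
qed

text \<open>\<open>weighted_reproducing\<close> with g = b', whose growth bound is the Bloch
  condition. The constant is -2 \<i> * (-\<i> pi / 4) = -pi / 2.\<close>

lemma bracket_test_fun:
  assumes b: "b \<in> bloch_space" and w: "Im w > 0"
  shows "bracket b (test_fun w) = - (of_real pi / 2) * of_real (Im w) * deriv b w"
proof -
  obtain B where B: "B \<ge> 0" "\<And>z. Im z > 0 \<Longrightarrow> Im z * cmod (deriv b z) \<le> B"
    using bloch_spaceD[OF b] by blast
  have M: "cmod (deriv b z) \<le> B / Im z" if "Im z > 0" for z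
    using B(2)[OF that] that by (simp add: field_simps)
  have hol: "deriv b holomorphic_on upper_half_plane"
    using b by (intro holomorphic_deriv open_upper_half_plane) (simp add: bloch_space_def)
  let ?f = "\<lambda>s. deriv b s * of_real (Im s) / (cnj s - w) ^ 3"
  define c where "c = - 2 * \<i> * of_real (Im w)"
  have c: "c \<noteq> 0" using w by (simp add: c_def)
  have eq: "hankel_density b (test_fun w) = (\<lambda>s. c * ?f s)"
    by (simp add: hankel_density_def test_fun_def c_def fun_eq_iff)
  have "integrable hpm (\<lambda>s. c * ?f s)"
    using hankel_density_L1[OF b test_fun_A1(1)[OF w]] unfolding eq .
  then have "integrable hpm (\<lambda>s. 1 / c * (c * ?f s))"
    by (rule integrable_mult_right)
  then have int: "integrable hpm ?f"
    using c by simp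
  have "bracket b (test_fun w) = c * (LINT s|hpm. ?f s)"
    unfolding bracket_eq eq by (rule integral_mult_right_zero)
  also have "(LINT s|hpm. ?f s) = - \<i> * pi / 4 * deriv b w"
    using weighted_reproducing[OF hol _ w int, of B] M by simp
  finally show ?thesis by (simp add: c_def)
qed

lemma integrable_cmod_diff_square:
  assumes [measurable]: "f \<in> borel_measurable hpm" "g \<in> borel_measurable hpm"
    and "integrable hpm (\<lambda>s. (cmod (f s))\<^sup>2)" "integrable hpm (\<lambda>s. (cmod (g s))\<^sup>2)"
  shows "integrable hpm (\<lambda>s. (cmod (f s - g s))\<^sup>2)"
proof (rule integrable_hpm_bound)
  show "integrable hpm (\<lambda>s. 2 * (cmod (f s))\<^sup>2 + 2 * (cmod (g s))\<^sup>2)"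
    using assms by auto
  fix s
  have "(cmod (f s - g s))\<^sup>2 \<le> (cmod (f s) + cmod (g s))\<^sup>2"
    by (intro power_mono norm_triangle_ineq4) auto
  also have "\<dots> \<le> 2 * (cmod (f s))\<^sup>2 + 2 * (cmod (g s))\<^sup>2"
    using sum_squares_bound[of "cmod (f s)" "cmod (g s)"] by (simp add: power2_sum)
  finally show "norm ((cmod (f s - g s))\<^sup>2) \<le> 2 * (cmod (f s))\<^sup>2 + 2 * (cmod (g s))\<^sup>2" by simp
qed measurable

lemma bergman_proj_diff:
  assumes "integrable hpm \<phi>" "integrable hpm \<psi>" "Im z > 0"
  shows "bergman_proj (\<lambda>s. \<phi> s - k * \<psi> s) z = bergman_proj \<phi> z - k * bergman_proj \<psi> z"
proof -
  have i: "integrable hpm (\<lambda>s. \<phi> s / (cnj s - z)\<^sup>2)" "integrable hpm (\<lambda>s. k * (\<psi> s / (cnj s - z)\<^sup>2))"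
    by (intro integrable_mult_right integrable_kernel_L1 assms)+
  have "(LINT s|hpm. (\<phi> s - k * \<psi> s) / (cnj s - z)\<^sup>2) = (LINT s|hpm. \<phi> s / (cnj s - z)\<^sup>2 - k * (\<psi> s / (cnj s - z)\<^sup>2))"
    by (simp add: diff_divide_distrib)
  also have "\<dots> = (LINT s|hpm. \<phi> s / (cnj s - z)\<^sup>2) - k * (LINT s|hpm. \<psi> s / (cnj s - z)\<^sup>2)"
    by (simp only: Bochner_Integration.integral_diff[OF i] integral_mult_right_zero)
  finally show ?thesis by (simp add: bergman_proj_def right_diff_distrib)
qed

text \<open>The constant, independent of \<open>w\<close>, is the product of 2 B from the density,
  14 pi from \<open>kernel_gap_mult_test_le\<close> and pi^2 from \<open>nn_integral_Schur\<close>,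
  where sqrt (Im w) cancels.\<close>

lemma bergman_proj_test_fun_gap:
  assumes b: "b \<in> bloch_space" and B: "B \<ge> 0" "\<And>z. Im z > 0 \<Longrightarrow> Im z * cmod (deriv b z) \<le> B" and w: "Im w > 0"
  shows "(\<integral>\<^sup>+z. ennreal (cmod (bergman_proj (hankel_density b (test_fun w)) z
            + bracket b (test_fun w) / of_real pi / (z - cnj w)\<^sup>2)) \<partial>hpm) \<le> ennreal (28 * B * pi ^ 3)"
proof -
  have "(\<integral>\<^sup>+z. ennreal (cmod (bergman_proj (hankel_density b (test_fun w)) z
            + bracket b (test_fun w) / of_real pi / (z - cnj w)\<^sup>2)) \<partial>hpm)
     \<le> (\<integral>\<^sup>+s. ennreal (cmod (hankel_density b (test_fun w) s)) * kernel_gap s w \<partial>hpm)"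
    unfolding bracket_eq by (intro bergman_proj_gap hankel_density_L1 b test_fun_A1 w)
  also have "\<dots> \<le> (\<integral>\<^sup>+s. ennreal (2 * B * (14 * pi * sqrt (Im w))) * ennreal (1 / sqrt (Im s) / (cmod (s - cnj w))\<^sup>2) \<partial>hpm)"
  proof (intro nn_integral_mono)
    fix s assume "s \<in> space hpm"
    then have s: "Im s > 0" by (simp add: upper_half_plane_def)
    have "ennreal (cmod (hankel_density b (test_fun w) s)) * kernel_gap s w
       \<le> ennreal (2 * B * (Im w / cmod (s - cnj w) ^ 3)) * kernel_gap s w"
      using cmod_hankel_density_le[OF s B(2)[OF s], of "test_fun w"]
      by (intro mult_right_mono ennreal_leI) (auto simp: cmod_test_fun[OF w])
    also have "\<dots> = ennreal (2 * B) * (ennreal (Im w / cmod (s - cnj w) ^ 3) * kernel_gap s w)"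
      using B(1) by (subst ennreal_mult') (auto simp: mult.assoc)
    also have "\<dots> \<le> ennreal (2 * B) * ennreal (14 * pi * sqrt (Im w) * (1 / sqrt (Im s) / (cmod (s - cnj w))\<^sup>2))"
      by (intro mult_left_mono kernel_gap_mult_test_le s w) auto
    also have "\<dots> = ennreal (2 * B * (14 * pi * sqrt (Im w)) * (1 / sqrt (Im s) / (cmod (s - cnj w))\<^sup>2))"
      using B(1) by (subst ennreal_mult'[symmetric]) (auto simp: mult_ac)
    also have "\<dots> = ennreal (2 * B * (14 * pi * sqrt (Im w))) * ennreal (1 / sqrt (Im s) / (cmod (s - cnj w))\<^sup>2)"
      using B(1) w by (intro ennreal_mult') auto
    finally show "ennreal (cmod (hankel_density b (test_fun w) s)) * kernel_gap s w
       \<le> ennreal (2 * B * (14 * pi * sqrt (Im w))) * ennreal (1 / sqrt (Im s) / (cmod (s - cnj w))\<^sup>2)" .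
  qed
  also have "\<dots> = ennreal (2 * B * (14 * pi * sqrt (Im w))) * ennreal (pi\<^sup>2 / sqrt (Im w))"
    unfolding nn_integral_Schur[OF w, symmetric]
    by (intro nn_integral_cmult measurable_hpm_borel) measurable
  also have "\<dots> = ennreal (28 * B * pi ^ 3)"
    using B(1) w by (subst ennreal_mult'[symmetric]) (auto simp: power2_eq_square power3_eq_cube)
  finally show ?thesis .
qed

lemma hankel_bounded_imp_bloch_omega:
  assumes b: "b \<in> bloch_space" and bounded: "hankel_bounded_A1 b"
  shows "b \<in> bloch_omega_space"
proof (cases "\<exists>w0. Im w0 > 0 \<and> deriv b w0 \<noteq> 0")
  \<comment> \<open>If b' vanishes identically, the weighted condition is trivial. Otherwise a point
    with b' nonzero provides a fixed test function whose bracket can be divided by.\<close>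
  case False
  then have "bdd_above ((\<lambda>z. Im z * omega z * norm (deriv b z)) ` upper_half_plane)"
    by (intro bdd_aboveI2[where M = 0]) (auto simp: upper_half_plane_def)
  then show ?thesis using b by (simp add: bloch_omega_space_def bloch_space_def)
next
  case True
  then obtain w0 where w0: "Im w0 > 0" "deriv b w0 \<noteq> 0" by blast
  obtain B where B: "B \<ge> 0" "\<And>z. Im z > 0 \<Longrightarrow> Im z * cmod (deriv b z) \<le> B"
    using bloch_spaceD[OF b] by blast
  obtain C where C: "\<And>f. f \<in> bergman_space_annihilating b \<inter> bergman_space 2 \<Longrightarrow>
      hankel b f \<in> bergman_space 1 \<and> L1_norm (hankel b f) \<le> C * L1_norm f"
    using bounded unfolding hankel_bounded_A1_def by blast
  obtain C0 where C0: "C0 \<ge> 0" "\<And>w. Im w > 0 \<Longrightarrow> ennreal (omega w / 18) \<le> kernel_gap w w0 + ennreal C0"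
    using kernel_gap_ge_omega[OF w0(1)] by blast
  define m where "m = (\<lambda>w. bracket b (test_fun w))"
  have m: "cmod (m w) = pi / 2 * (Im w * cmod (deriv b w))" if "Im w > 0" for w
    using that by (simp add: m_def bracket_test_fun[OF b that] norm_mult norm_divide)
  have m_le: "cmod (m w) \<le> 2 * B" if w: "Im w > 0" for w
  proof -
    have "pi / 2 * (Im w * cmod (deriv b w)) \<le> 2 * B"
      using pi_less_4 B w by (intro mult_mono) auto
    then show ?thesis using m[OF w] by simp
  qed
  have m0: "m w0 \<noteq> 0"
    using m[OF w0(1)] w0 by auto
  define K where "K = 2 * B / cmod (m w0)"
  have K0: "K \<ge> 0" using B(1) by (simp add: K_def)
  define E where "E = 28 * B * pi ^ 3"
  have E0: "E \<ge> 0" using B(1) by (simp add: E_def)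
  \<comment> \<open>The summands bound the error at \<open>w\<close>, the scaled error at
    \<open>w0\<close>, and the L^1 norm of the Hankel image of the corrected test function. The
    absolute value is there because the sign of \<open>C\<close> is unknown.\<close>
  define A where "A = E + K * E + \<bar>C\<bar> * ((1 + K) * pi\<^sup>2)"
  have A0: "A \<ge> 0" using E0 K0 by (simp add: A_def)
  have main: "Im w * omega w * cmod (deriv b w) \<le> 18 * (pi * A + 2 * B * C0)" if w: "Im w > 0" for w
  proof -
    define k where "k = m w / m w0"
    have k_le: "cmod k \<le> K"
      using m_le[OF w] by (simp add: k_def K_def norm_divide divide_right_mono)
    \<comment> \<open>The bracket is conjugate-linear in its second argument: the conjugate here
      produces the coefficient \<open>k\<close> in the density.\<close>
    define f where "f = (\<lambda>s. test_fun w s - cnj k * test_fun w0 s)"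
    let ?\<phi> = "hankel_density b (test_fun w)" and ?\<psi> = "hankel_density b (test_fun w0)"
    note T = test_fun_A1(1)[OF w] test_fun_A1(1)[OF w0(1)] test_fun_A2[OF w] test_fun_A2[OF w0(1)]
    have int: "integrable hpm ?\<phi>" "integrable hpm ?\<psi>"
      using T by (auto intro: hankel_density_L1[OF b])
    have tint: "integrable hpm (test_fun w)" "integrable hpm (test_fun w0)"
      using T by (auto simp: bergman_space_1_iff)
    have dens: "hankel_density b f = (\<lambda>s. ?\<phi> s - k * ?\<psi> s)"
      by (simp add: hankel_density_def f_def fun_eq_iff algebra_simps)
    have hol: "f holomorphic_on upper_half_plane"
      unfolding f_def using w w0 by (intro holomorphic_intros test_fun_holomorphic)
    have f1: "f \<in> bergman_space 1"
      using tint hol by (simp add: bergman_space_1_iff) (simp add: f_def)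
    have f2: "f \<in> bergman_space 2"
    proof -
      have "integrable hpm (\<lambda>s. (cmod (cnj k))\<^sup>2 * (cmod (test_fun w0 s))\<^sup>2)"
        using T(4) by (intro integrable_mult_right) (simp add: bergman_space_2_iff)
      then have "integrable hpm (\<lambda>s. (cmod (f s))\<^sup>2)"
        unfolding f_def using T(3) tint
        by (intro integrable_cmod_diff_square) (auto simp: bergman_space_2_iff norm_mult power_mult_distrib)
      then show ?thesis using hol by (simp add: bergman_space_2_iff)
    qed
    have "bracket b f = m w - k * m w0"
      unfolding bracket_eq dens m_def using int by simp
    then have f0: "bracket b f = 0"
      using m0 by (simp add: k_def)
    have Hf: "hankel b f \<in> bergman_space 1" "L1_norm (hankel b f) \<le> C * L1_norm f"
      using C[of f] f0 f1 f2 by (auto simp: bergman_space_annihilating_def)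
    have L1f: "L1_norm f \<le> (1 + K) * pi\<^sup>2" "0 \<le> L1_norm f"
    proof -
      have "L1_norm f \<le> (LINT s|hpm. cmod (test_fun w s) + cmod k * cmod (test_fun w0 s))"
        unfolding L1_norm_hpm
      proof (rule integral_mono)
        show "cmod (f s) \<le> cmod (test_fun w s) + cmod k * cmod (test_fun w0 s)" for s
          using norm_triangle_ineq4[of "test_fun w s" "cnj k * test_fun w0 s"] by (simp add: f_def norm_mult)
      qed (use tint f1 in \<open>auto simp: bergman_space_1_iff\<close>)
      also have "\<dots> = L1_norm (test_fun w) + cmod k * L1_norm (test_fun w0)"
        unfolding L1_norm_hpm using tint by simp
      also have "\<dots> \<le> pi\<^sup>2 + K * pi\<^sup>2"
        using test_fun_A1(2)[OF w] test_fun_A1(2)[OF w0(1)] k_le K0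
        by (intro add_mono mult_mono) (auto simp: L1_norm_hpm)
      finally show "L1_norm f \<le> (1 + K) * pi\<^sup>2" by (simp add: distrib_right)
      show "0 \<le> L1_norm f" by (simp add: L1_norm_hpm)
    qed
    have H_le: "L1_norm (hankel b f) \<le> \<bar>C\<bar> * ((1 + K) * pi\<^sup>2)"
    proof -
      have "C * L1_norm f \<le> \<bar>C\<bar> * ((1 + K) * pi\<^sup>2)"
        using L1f by (intro mult_mono) auto
      then show ?thesis using Hf(2) by linarith
    qed
    define e where "e = (\<lambda>w z. bergman_proj (hankel_density b (test_fun w)) z + m w / of_real pi / (z - cnj w)\<^sup>2)"
    have e_meas: "e v \<in> borel_measurable hpm" if v: "Im v > 0" for v
    proof -
      have i: "integrable hpm (hankel_density b (test_fun v))"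
        using test_fun_A1(1)[OF v] by (rule hankel_density_L1[OF b])
      have "bergman_proj (hankel_density b (test_fun v)) holomorphic_on upper_half_plane"
        by (intro bergman_proj_holomorphic integrable_kernel_L1 i borel_measurable_integrable[OF i])
      note [measurable] = borel_measurable_hpm_holomorphic[OF this]
      show ?thesis unfolding e_def by measurable
    qed
    have e_le: "(\<integral>\<^sup>+z. ennreal (cmod (e v z)) \<partial>hpm) \<le> ennreal E" if "Im v > 0" for v
      unfolding e_def m_def E_def by (rule bergman_proj_test_fun_gap[OF b B that])
    have h_meas: "hankel b f \<in> borel_measurable hpm"
      using Hf(1) by (auto simp: bergman_space_1_iff)
    note [measurable] = e_meas[OF w] e_meas[OF w0(1)] h_meas
    have "ennreal (cmod (m w) / pi) * kernel_gap w w0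
        = (\<integral>\<^sup>+z. ennreal (cmod (m w) / pi * cmod (1 / (z - cnj w)\<^sup>2 - 1 / (z - cnj w0)\<^sup>2)) \<partial>hpm)"
      unfolding kernel_gap_def
      by (subst nn_integral_cmult[symmetric])
         (auto simp: ennreal_mult'[symmetric] intro!: measurable_hpm_borel nn_integral_cong)
    also have "\<dots> \<le> (\<integral>\<^sup>+z. ennreal (cmod (e w z)) + ennreal (cmod k) * ennreal (cmod (e w0 z))
        + ennreal (cmod (hankel b f z)) \<partial>hpm)"
    proof (intro nn_integral_mono)
      fix z assume "z \<in> space hpm"
      then have z: "Im z > 0" by (simp add: upper_half_plane_def)
      have "hankel b f z = bergman_proj ?\<phi> z - k * bergman_proj ?\<psi> z"
        unfolding hankel_characterization(2)[OF b f2 z] hankel_A1_eq dens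
        by (rule bergman_proj_diff[OF int z])
      moreover have "k * m w0 = m w" using m0 by (simp add: k_def)
      \<comment> \<open>As \<open>k * m w0 = m w\<close>, the two leading terms combine to a single
        multiple of the kernel difference, whose L^1 norm is the gap.\<close>
      ultimately have eq: "m w / of_real pi * (1 / (z - cnj w)\<^sup>2 - 1 / (z - cnj w0)\<^sup>2)
          = e w z - k * e w0 z - hankel b f z"
        by (simp add: e_def right_diff_distrib distrib_left)
      have "cmod (m w) / pi * cmod (1 / (z - cnj w)\<^sup>2 - 1 / (z - cnj w0)\<^sup>2)
          = cmod (m w / of_real pi * (1 / (z - cnj w)\<^sup>2 - 1 / (z - cnj w0)\<^sup>2))"
        by (simp add: norm_mult norm_divide)
      also have "\<dots> \<le> cmod (e w z) + cmod k * cmod (e w0 z) + cmod (hankel b f z)"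
        unfolding eq
        using norm_triangle_ineq4[of "e w z - k * e w0 z" "hankel b f z"] norm_triangle_ineq4[of "e w z" "k * e w0 z"]
        by (simp add: norm_mult)
      finally have "ennreal (cmod (m w) / pi * cmod (1 / (z - cnj w)\<^sup>2 - 1 / (z - cnj w0)\<^sup>2))
          \<le> ennreal (cmod (e w z) + cmod k * cmod (e w0 z) + cmod (hankel b f z))"
        by (rule ennreal_leI)
      then show "ennreal (cmod (m w) / pi * cmod (1 / (z - cnj w)\<^sup>2 - 1 / (z - cnj w0)\<^sup>2))
          \<le> ennreal (cmod (e w z)) + ennreal (cmod k) * ennreal (cmod (e w0 z)) + ennreal (cmod (hankel b f z))"
        by (simp add: ennreal_mult')
    qed
    also have "\<dots> = (\<integral>\<^sup>+z. ennreal (cmod (e w z)) \<partial>hpm) + ennreal (cmod k) * (\<integral>\<^sup>+z. ennreal (cmod (e w0 z)) \<partial>hpm)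
        + (\<integral>\<^sup>+z. ennreal (cmod (hankel b f z)) \<partial>hpm)"
    proof -
      have "(\<lambda>z. ennreal (cmod (e v z))) \<in> borel_measurable hpm" if "Im v > 0" for v
        using e_meas[OF that] by (rule measurable_compose) simp
      from this[OF w] this[OF w0(1)] h_meas show ?thesis
        by (simp add: nn_integral_add nn_integral_cmult)
    qed
    also have "\<dots> \<le> ennreal E + ennreal K * ennreal E + ennreal (\<bar>C\<bar> * ((1 + K) * pi\<^sup>2))"
      using Hf(1) H_le k_le
      by (intro add_mono mult_mono e_le w w0 ennreal_leI) (auto simp: nn_integral_L1_norm bergman_space_1_iff intro: ennreal_leI)
    also have "\<dots> = ennreal A"
      using E0 K0 by (simp add: A_def ennreal_mult' ennreal_plus)
    finally have gap: "ennreal (cmod (m w) / pi) * kernel_gap w w0 \<le> ennreal A" .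
    have om: "omega w \<ge> 0" using omega_ge_1[of w] by linarith
    \<comment> \<open>The additive constant \<open>C0\<close> does no harm, because
      \<open>m_le\<close> bounds |m w| uniformly in \<open>w\<close>.\<close>
    have "ennreal (cmod (m w) / pi * (omega w / 18)) = ennreal (cmod (m w) / pi) * ennreal (omega w / 18)"
      by (intro ennreal_mult') auto
    also have "\<dots> \<le> ennreal (cmod (m w) / pi) * (kernel_gap w w0 + ennreal C0)"
      by (intro mult_left_mono C0 w) auto
    also have "\<dots> \<le> ennreal A + ennreal (cmod (m w) / pi) * ennreal C0"
      unfolding distrib_left by (intro add_mono gap order_refl)
    also have "\<dots> = ennreal (A + cmod (m w) / pi * C0)"
      using A0 C0(1) by (simp add: ennreal_mult'[symmetric])
    finally have "cmod (m w) / pi * (omega w / 18) \<le> A + cmod (m w) / pi * C0"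
      using A0 C0(1) by (subst (asm) ennreal_le_iff) auto
    then have "cmod (m w) * omega w \<le> 18 * (pi * A + cmod (m w) * C0)"
      by (simp add: field_simps)
    also have "\<dots> \<le> 18 * (pi * A + 2 * B * C0)"
      using m_le[OF w] C0(1) by (intro mult_left_mono add_mono mult_right_mono) auto
    finally have "pi / 2 * (Im w * omega w * cmod (deriv b w)) \<le> 18 * (pi * A + 2 * B * C0)"
      unfolding m[OF w] by (simp add: mult_ac)
    moreover have "1 * (Im w * omega w * cmod (deriv b w)) \<le> pi / 2 * (Im w * omega w * cmod (deriv b w))"
      using pi_ge_two w om by (intro mult_right_mono) auto
    ultimately show ?thesis by linarith
  qed
  then have "bdd_above ((\<lambda>z. Im z * omega z * norm (deriv b z)) ` upper_half_plane)"
    by (intro bdd_aboveI2) (auto simp: upper_half_plane_def)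
  then show ?thesis using b by (simp add: bloch_omega_space_def bloch_space_def)
qed

theorem theorem3:
  fixes b :: "complex \<Rightarrow> complex"
  assumes "b \<in> bloch_space"
  shows "(hankel_bounded_A1 b \<longleftrightarrow> b \<in> bloch_omega_space) \<and>
         (\<forall>f \<in> bergman_space 1. bracket b f \<noteq> 0 \<longrightarrow>
            \<not> set_integrable lborel upper_half_plane (hankel_A1 b f))"
  \<comment> \<open>The last claim is a contrapositive: \<open>hankel_A1 b f\<close> is the
    projection of the density, and its integrability would force the bracket to vanish.\<close>
  using bloch_omega_imp_hankel_bounded[OF assms] hankel_bounded_imp_bloch_omega[OF assms]
    integral_eq_0_if_bergman_proj_integrable[OF hankel_density_L1[OF assms]]
  by (auto simp: set_integrable_hpm hankel_A1_eq bracket_eq)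

end
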